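(* The principal 3D slice $\mathcal{T}(1,\mathbf{i_1},\mathbf{j_1})$ of the tricomplex Mandelbrot set (the Arrowheadbrot) can be expressed as $$\mathcal{T}(1,\mathbf{i_1},\mathbf{j_1}) = \bigcup_{y\in \left[-\frac{9}{8},\frac{9}{8}\right]}\{[(\mathcal{M}_1-y)\cap(\mathcal{M}_1+y)] + y\,\mathbf{j_1}\}.$$
   Context: The tricomplex numbers $\mathbb{TC}$ form the commutative, associative unital real algebra generated by three commuting elements $\mathbf{i_1},\mathbf{i_2},\mathbf{i_3}$ with $\mathbf{i_1}^2=\mathbf{i_2}^2=\mathbf{i_3}^2=-1$; it has dimension 8 over $\mathbb{R}$ with basis $1,\mathbf{i_1},\mathbf{i_2},\mathbf{j_1},\mathbf{i_3},\mathbf{j_2},\mathbf{j_3},\mathbf{i_4}$, where $\mathbf{j_1}=\mathbf{i_1}\mathbf{i_2}$, $\mathbf{j_2}=\mathbf{i_1}\mathbf{i_3}$, $\mathbf{j_3}=\mathbf{i_2}\mathbf{i_3}$ and $\mathbf{i_4}=\mathbf{i_1}\mathbf{i_2}\mathbf{i_3}$. Boundedness in $\mathbb{TC}\cong\mathbb{R}^8$ is with respect to the Euclidean norm. For $c\in\mathbb{TC}$ let $P_c(\eta)=\eta^2+c$ and let $P_c^{(n)}$ be its $n$-fold composition. The tricomplex Mandelbrot set is $\mathcal{M}_3=\{c\in\mathbb{TC}:\{P_c^{(n)}(0)\}_{n\in\mathbb{N}}\text{ is bounded}\}$. The classical Mandelbrot set is $\mathcal{M}_1=\{c\in\mathbb{C}(\mathbf{i_1}):\{P_c^{(n)}(0)\}_{n\in\mathbb{N}}\text{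 is bounded}\}$, where $\mathbb{C}(\mathbf{i_1})=\{x+y\mathbf{i_1}:x,y\in\mathbb{R}\}\subset\mathbb{TC}$. For three distinct units $\mathbf{u},\mathbf{v},\mathbf{w}\in\{1,\mathbf{i_1},\mathbf{i_2},\mathbf{j_1},\mathbf{i_3},\mathbf{j_2},\mathbf{j_3},\mathbf{i_4}\}$, the principal 3D slice is $\mathcal{T}(\mathbf{u},\mathbf{v},\mathbf{w})=\mathrm{span}_{\mathbb{R}}\{\mathbf{u},\mathbf{v},\mathbf{w}\}\cap\mathcal{M}_3$. For a set $S\subset\mathbb{TC}$ and $z\in\mathbb{TC}$, $S\pm z=\{s\pm z:s\in S\}$. *)

theory Defs
  imports "HOL-Analysis.Analysis"
begin

text \<open>
  \<open>'a adj\<close> is \<open>'a[u]/(u^2 + 1)\<close>: the element \<open>Adj a b\<close> stands for \<open>a + b u\<close>, where \<open>u\<close>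
  commutes with \<open>'a\<close> and \<open>u^2 = -1\<close>. It carries the Euclidean norm of the product.
  Adjoining a unit twice to the complex numbers gives the tricomplex numbers.
\<close>

datatype 'a adj = Adj (base: 'a) (coef: 'a)

lemma adj_eq_iff: "x = y \<longleftrightarrow> base x = base y \<and> coef x = coef y"
  by (cases x; cases y) simp

instantiation adj :: (ab_group_add) ab_group_add
begin

definition "0 = Adj 0 0"
definition "x + y = Adj (base x + base y) (coef x + coef y)"
definition "- x = Adj (- base x) (- coef x)"
definition "x - y = Adj (base x - base y) (coef x - coef y)"

instance
  by standard
    (simp_all add: adj_eq_iff zero_adj_def plus_adj_def uminus_adj_def minus_adj_def algebra_simps)

end

lemma adj_add_simps [simp]:
  "base 0 = 0" "coef 0 = 0"
  "base (x + y) = base x + base y" "coef (x + y) = coef x + coef y"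
  "base (- x) = - base x" "coef (- x) = - coef x"
  "base (x - y) = base x - base y" "coef (x - y) = coef x - coef y"
  by (simp_all add: zero_adj_def plus_adj_def uminus_adj_def minus_adj_def)

instantiation adj :: (ring) ring
begin

definition
  "x * y = Adj (base x * base y - coef x * coef y) (base x * coef y + coef x * base y)"

instance
  by standard (simp_all add: adj_eq_iff times_adj_def algebra_simps)

end

instantiation adj :: (ring_1) ring_1
begin

definition "1 = Adj 1 0"

instance
  by standard (simp_all add: adj_eq_iff times_adj_def one_adj_def)

end

instance adj :: (comm_ring_1) comm_ring_1
proof
  fix x y z :: "'a adj"
  show "x * y = y * x"
    by (simp add: times_adj_def mult.commute add.commute)
  show "1 * x = x"
    by (rule mult_1_left)
  show "(x + y) * z = x * z + y * z"
    by (rule distrib_right)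
qed

lemma adj_mult_simps [simp]:
  "base (x * y) = base x * base y - coef x * coef y"
  "coef (x * y) = base x * coef y + coef x * base y"
  "base 1 = 1" "coef 1 = 0"
  by (simp_all add: times_adj_def one_adj_def)

instantiation adj :: (real_vector) real_vector
begin

definition "r *\<^sub>R x = Adj (r *\<^sub>R base x) (r *\<^sub>R coef x)"

instance
  by standard (simp_all add: adj_eq_iff scaleR_adj_def scaleR_add_right scaleR_add_left)

end

lemma adj_scaleR_simps [simp]:
  "base (r *\<^sub>R x) = r *\<^sub>R base x" "coef (r *\<^sub>R x) = r *\<^sub>R coef x"
  by (simp_all add: scaleR_adj_def)

instance adj :: (real_algebra) real_algebra
  by standard (simp_all add: adj_eq_iff scaleR_diff_right scaleR_add_right)

instance adj :: (real_algebra_1) real_algebra_1 ..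

instantiation adj :: (real_inner) real_inner
begin

definition "inner x y = inner (base x) (base y) + inner (coef x) (coef y)"
definition "norm x = sqrt ((norm (base x))\<^sup>2 + (norm (coef x))\<^sup>2)"
definition "dist (x :: 'a adj) y = norm (x - y)"
definition "sgn (x :: 'a adj) = x /\<^sub>R norm x"
definition
  "(uniformity :: ('a adj \<times> 'a adj) filter) = (INF e\<in>{0 <..}. principal {(x, y). dist x y < e})"
definition
  "open (U :: 'a adj set) \<longleftrightarrow> (\<forall>x\<in>U. eventually (\<lambda>(x', y). x' = x \<longrightarrow> y \<in> U) uniformity)"

instance
proof
  fix r :: real and x y z :: "'a adj" and U :: "'a adj set"
  show "dist x y = norm (x - y)" by (rule dist_adj_def)
  show "sgn x = x /\<^sub>R norm x" by (rule sgn_adj_def)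
  show "(uniformity :: ('a adj \<times> 'a adj) filter) = (INF e\<in>{0 <..}. principal {(x, y). dist x y < e})"
    by (rule uniformity_adj_def)
  show "open U \<longleftrightarrow> (\<forall>x\<in>U. eventually (\<lambda>(x', y). x' = x \<longrightarrow> y \<in> U) uniformity)"
    by (rule open_adj_def)
  show "inner x y = inner y x"
    by (simp add: inner_adj_def inner_commute)
  show "inner (x + y) z = inner x z + inner y z"
    by (simp add: inner_adj_def inner_add_left)
  show "inner (r *\<^sub>R x) y = r * inner x y"
    by (simp add: inner_adj_def distrib_left)
  show "0 \<le> inner x x"
    by (simp add: inner_adj_def)
  show "inner x x = 0 \<longleftrightarrow> x = 0"
    by (simp add: inner_adj_def adj_eq_iff add_nonneg_eq_0_iff)
  show "norm x = sqrt (inner x x)"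
    by (simp add: inner_adj_def norm_adj_def power2_norm_eq_inner)
qed

end

type_synonym tricomplex = "complex adj adj"

definition i1 :: tricomplex where "i1 = Adj (Adj \<i> 0) 0"
definition i2 :: tricomplex where "i2 = Adj (Adj 0 1) 0"
definition i3 :: tricomplex where "i3 = Adj 0 1"
definition j1 :: tricomplex where "j1 = i1 * i2"
definition j2 :: tricomplex where "j2 = i1 * i3"
definition j3 :: tricomplex where "j3 = i2 * i3"
definition i4 :: tricomplex where "i4 = i1 * i2 * i3"

lemma tricomplex_units_square: "i1\<^sup>2 = -1" "i2\<^sup>2 = -1" "i3\<^sup>2 = -1"
  by (simp_all add: adj_eq_iff power2_eq_square i1_def i2_def i3_def)

lemma tricomplex_coords:
  "a *\<^sub>R 1 + b *\<^sub>R i1 + c *\<^sub>R i2 + d *\<^sub>R j1 + e *\<^sub>R i3 + f *\<^sub>R j2 + g *\<^sub>R j3 + h *\<^sub>R i4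
    = Adj (Adj (Complex a b) (Complex c d)) (Adj (Complex e f) (Complex g h))"
  by (simp add: adj_eq_iff complex_eq_iff i1_def i2_def i3_def i4_def j1_def j2_def j3_def)

lemma tricomplex_basis:
  "\<exists>!(a, b, c, d, e, f, g, h). (z :: tricomplex) =
     a *\<^sub>R 1 + b *\<^sub>R i1 + c *\<^sub>R i2 + d *\<^sub>R j1 + e *\<^sub>R i3 + f *\<^sub>R j2 + g *\<^sub>R j3 + h *\<^sub>R i4"
proof -
  obtain a b c d e f g h where
    "z = Adj (Adj (Complex a b) (Complex c d)) (Adj (Complex e f) (Complex g h))"
    by (metis adj.exhaust complex.exhaust)
  then show ?thesis
    unfolding tricomplex_coords by (intro ex1I[of _ "(a, b, c, d, e, f, g, h)"]) auto
qed

lemma tricomplex_norm: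
  "norm (a *\<^sub>R 1 + b *\<^sub>R i1 + c *\<^sub>R i2 + d *\<^sub>R j1 + e *\<^sub>R i3 + f *\<^sub>R j2 + g *\<^sub>R j3 + h *\<^sub>R i4)
    = sqrt (a\<^sup>2 + b\<^sup>2 + c\<^sup>2 + d\<^sup>2 + e\<^sup>2 + f\<^sup>2 + g\<^sup>2 + h\<^sup>2)"
  unfolding tricomplex_coords by (simp add: norm_adj_def cmod_power2 add.assoc)

definition P :: "tricomplex \<Rightarrow> tricomplex \<Rightarrow> tricomplex" where
  "P c \<eta> = \<eta>\<^sup>2 + c"

definition M3 :: "tricomplex set" where
  "M3 = {c. bounded (range (\<lambda>n. (P c ^^ n) 0))}"

definition C_i1 :: "tricomplex set" where
  "C_i1 = {x *\<^sub>R 1 + y *\<^sub>R i1 | x y. True}"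

definition M1 :: "tricomplex set" where
  "M1 = {c \<in> C_i1. bounded (range (\<lambda>n. (P c ^^ n) 0))}"

definition slice :: "tricomplex \<Rightarrow> tricomplex \<Rightarrow> tricomplex \<Rightarrow> tricomplex set" where
  "slice u v w = span {u, v, w} \<inter> M3"

definition set_shift :: "tricomplex set \<Rightarrow> tricomplex \<Rightarrow> tricomplex set"  (infixl "\<oplus>\<^sub>s" 65) where
  "S \<oplus>\<^sub>s z = {s + z | s. s \<in> S}"

definition set_unshift :: "tricomplex set \<Rightarrow> tricomplex \<Rightarrow> tricomplex set"  (infixl "\<ominus>\<^sub>s" 65) where
  "S \<ominus>\<^sub>s z = {s - z | s. s \<in> S}"

end

theory Submission
  imports Defs
begin

text \<open>
  The elements \<open>(1 + j1)/2\<close> and \<open>(1 - j1)/2\<close> are complementary idempotents. In the coordinates that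
  they define, iterating \<open>P c\<close> means iterating two independent complex quadratic maps. A point
  \<open>z + y j1\<close> with \<open>z\<close> in the first complex plane has the coordinates \<open>z + y\<close> and \<open>z - y\<close>, so it belongs to
  the tricomplex Mandelbrot set exactly if these two numbers belong to the classical one. This gives
  the asserted union with \<open>y\<close> ranging over all reals. What remains is to bound \<open>y\<close>: two points of the
  classical Mandelbrot set on the same horizontal line are at distance at most \<open>9/4\<close>, the
  distance of the two real boundary points \<open>-2\<close> and \<open>1/4\<close> (lemma \<open>width_le\<close>).

  For this, both ends of a horizontal section at height \<open>b\<close> are compared with the same cuspidal curve.
  A point \<open>1/4 + \<delta> + i b\<close> of the set with \<open>\<delta> > 0\<close> satisfies \<open>10 b^2 > 9 \<delta>^3\<close> (\<open>above_cusp_curve\<close>),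
  and a point \<open>-2 + \<epsilon> + i b\<close> with \<open>\<epsilon> \<le> 1/4\<close> satisfies \<open>10 b^2 \<le> 9 \<epsilon>^3\<close>
  (\<open>below_cusp_curve_at_tip\<close>). If the section were longer than \<open>9/4\<close>, it would contain two such
  points with \<open>\<epsilon> < \<delta>\<close>, and the two inequalities would contradict each other.

  Away from \<open>-2\<close> and \<open>1/4\<close> each of the inequalities is a finite computation in interval arithmetic, because
  a box of parameters all of whose orbits leave the disk of radius 2 after few steps misses the set.
  The number of steps is unbounded at \<open>-2\<close> and at \<open>1/4\<close>, and there an argument is needed.

  Just right of \<open>1/4\<close>, the orbit \<open>1/2 + u + i y\<close> has to creep through a gate around \<open>u = 0\<close> whose
  width is about \<open>\<rho> = sqrt \<delta>\<close>. Near the line \<open>y = 0\<close>, the quotient \<open>y/(u^2 + \<delta>)\<close> grows,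
  up to a constant factor, like the function \<open>gate\<close>, which increases by \<open>\<pi>/2\<close> in total. Hence, for \<open>b\<close> below the
  curve, \<open>y\<close> stays so small that the orbit passes the gate without being turned back and then escapes.

  Near \<open>-2\<close>, the map is conjugate to \<open>x \<mapsto> \<beta> x (2 - x)\<close> with \<open>\<beta>\<close> close to \<open>2\<close>, which for \<open>\<beta> = 2\<close> has the
  invariant interval from \<open>0\<close> to \<open>2\<close>. The excess \<open>|x| + |2 - x| - 2\<close> measures the distance to this
  interval by confocal ellipses. It is roughly multiplied by 4 in each step, so on a
  bounded orbit it can be only as large as the perturbation \<open>2 - \<beta>\<close>. Above the curve, however, an orbit that
  leaves the neighbourhood of the repelling fixed point \<open>0\<close> picks up a larger excess.
\<close>

section \<open>The classical Mandelbrot set\<close>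

definition orbit :: "complex \<Rightarrow> nat \<Rightarrow> complex" where
  "orbit c n = ((\<lambda>z. z\<^sup>2 + c) ^^ n) 0"

definition mandelbrot :: "complex set" where
  "mandelbrot = {c. bounded (range (orbit c))}"

lemma orbit_0 [simp]: "orbit c 0 = 0"
  and orbit_Suc [simp]: "orbit c (Suc n) = (orbit c n)\<^sup>2 + c"
  by (simp_all add: orbit_def)

lemma orbit_cnj: "orbit (cnj c) n = cnj (orbit c n)"
  by (induction n) simp_all

lemma mandelbrot_bounded: "c \<in> mandelbrot \<longleftrightarrow> (\<exists>K. \<forall>n. cmod (orbit c n) \<le> K)"
  by (auto simp: mandelbrot_def bounded_iff)

lemma mandelbrot_cnj: "c \<in> mandelbrot \<Longrightarrow> cnj c \<in> mandelbrot"
  by (simp add: mandelbrot_bounded orbit_cnj)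

text \<open>A quantity that is expanded away from \<open>L\<close> whenever it exceeds \<open>L\<close> cannot be bounded unless it stays
  below \<open>L\<close>. Both the escape radius and the bound on the excess come from this.\<close>

lemma expanding_from_below:
  fixes f :: "nat \<Rightarrow> real"
  assumes expand: "\<And>n. m \<le> n \<Longrightarrow> L < f n \<Longrightarrow> q * (f n - L) \<le> f (Suc n) - L"
    and "1 < q" and bound: "\<And>n. f n \<le> K"
  shows "f m \<le> L"
proof (rule ccontr)
  assume "\<not> f m \<le> L"
  then have pos: "0 < f m - L" by simp
  have grow: "q ^ k * (f m - L) \<le> f (m + k) - L" for k
  proof (induction k)
    case (Suc k)
    have "0 < q ^ k * (f m - L)"
      using pos \<open>1 < q\<close> by simp
    then have "q * (f (m + k) - L) \<le> f (Suc (m + k)) - L"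
      using Suc by (intro expand) auto
    moreover have "q * (q ^ k * (f m - L)) \<le> q * (f (m + k) - L)"
      using Suc \<open>1 < q\<close> by (intro mult_left_mono) auto
    ultimately show ?case by (simp add: mult.assoc)
  qed simp
  obtain k where "(K - L) / (f m - L) < q ^ k"
    using real_arch_pow[OF \<open>1 < q\<close>] by blast
  then have "K - L < q ^ k * (f m - L)"
    using pos by (simp add: pos_divide_less_eq)
  with grow[of k] bound[of "m + k"] show False by simp
qed

text \<open>For \<open>|z| > R\<close> the condition on \<open>R\<close> gives \<open>|z^2 + c| - R \<ge> (|z| + R)(|z| - R) - (|c| - R^2 + R)\<close>, so
  that the distance to the disk of radius \<open>R\<close> is expanded. Radii below 2 are used for parameters close to \<open>1/4\<close>.\<close>

lemma mandelbrot_radius: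
  assumes c: "c \<in> mandelbrot" and R: "1 \<le> R" "cmod c \<le> R\<^sup>2 - R"
  shows "cmod (orbit c n) \<le> R"
proof -
  obtain K where K: "\<And>n. cmod (orbit c n) \<le> K"
    using c by (auto simp: mandelbrot_bounded)
  show ?thesis
  proof (rule expanding_from_below[where q = "2 * R" and K = K])
    fix n assume gt: "R < cmod (orbit c n)"
    have "(cmod (orbit c n))\<^sup>2 - cmod c \<le> cmod (orbit c (Suc n))"
      using norm_diff_ineq[of "(orbit c n)\<^sup>2" c] by (simp add: norm_power)
    moreover have "2 * R * (cmod (orbit c n) - R) \<le> (cmod (orbit c n))\<^sup>2 - R\<^sup>2"
      using zero_le_power2[of "cmod (orbit c n) - R"] by (simp add: power2_eq_square algebra_simps)
    ultimately show "2 * R * (cmod (orbit c n) - R) \<le> cmod (orbit c (Suc n)) - R"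
      using R(2) by linarith
  qed (use R K in auto)
qed

lemma mandelbrot_norm_le_2:
  assumes c: "c \<in> mandelbrot"
  shows "cmod c \<le> 2"
proof (rule ccontr)
  assume "\<not> cmod c \<le> 2"
  then have gt: "2 < cmod c" by simp
  then have "2 * cmod c \<le> cmod c * cmod c" by (intro mult_right_mono) auto
  then have "cmod (orbit c (Suc (Suc 0))) \<le> cmod c"
    by (intro mandelbrot_radius[OF c]) (use gt in \<open>auto simp: power2_eq_square\<close>)
  moreover have "orbit c (Suc (Suc 0)) = c * (c + 1)"
    by (simp add: power2_eq_square algebra_simps)
  ultimately have "cmod c * cmod (c + 1) \<le> cmod c * 1"
    by (simp only: norm_mult mult_1_right)
  then have "cmod (c + 1) \<le> 1"
    using gt by (subst (asm) mult_le_cancel_left_pos) auto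
  moreover have "cmod c \<le> cmod (c + 1) + 1"
    using norm_triangle_ineq4[of "c + 1" 1] by simp
  ultimately show False using gt by simp
qed

lemma mandelbrot_orbit_le_2: "c \<in> mandelbrot \<Longrightarrow> cmod (orbit c n) \<le> 2"
  using mandelbrot_norm_le_2 by (intro mandelbrot_radius) auto

section \<open>Certified escape from boxes of parameters\<close>

definition between :: "int \<Rightarrow> int \<Rightarrow> real \<Rightarrow> bool" where
  "between l h x \<longleftrightarrow> of_int l \<le> x \<and> x \<le> of_int h"

definition sq_lo :: "int \<Rightarrow> int \<Rightarrow> int" where
  "sq_lo l h = (if 0 \<le> l then l * l else if h \<le> 0 then h * h else 0)"

definition sq_hi :: "int \<Rightarrow> int \<Rightarrow> int" where
  "sq_hi l h = max (l * l) (h * h)"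

definition mul_lo :: "int \<Rightarrow> int \<Rightarrow> int \<Rightarrow> int \<Rightarrow> int" where
  "mul_lo a b c d = min (min (a * c) (a * d)) (min (b * c) (b * d))"

definition mul_hi :: "int \<Rightarrow> int \<Rightarrow> int \<Rightarrow> int \<Rightarrow> int" where
  "mul_hi a b c d = max (max (a * c) (a * d)) (max (b * c) (b * d))"

lemma scale_between:
  assumes "between l h x"
  shows "min (a * of_int l) (a * of_int h) \<le> a * x" "a * x \<le> max (a * of_int l) (a * of_int h)"
proof -
  have x: "of_int l \<le> x" "x \<le> of_int h" using assms by (auto simp: between_def)
  consider "a * of_int l \<le> a * x" "a * x \<le> a * of_int h" | "a * of_int h \<le> a * x" "a * x \<le> a * of_int l"
    using mult_left_mono[OF x(1)] mult_left_mono[OF x(2)]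
      mult_left_mono_neg[OF x(1)] mult_left_mono_neg[OF x(2)] by (metis linear)
  then show "min (a * of_int l) (a * of_int h) \<le> a * x" "a * x \<le> max (a * of_int l) (a * of_int h)"
    by (cases; linarith)+
qed

lemma between_mult:
  assumes "between a b x" "between c d y"
  shows "between (mul_lo a b c d) (mul_hi a b c d) (x * y)"
proof -
  note x = scale_between[OF assms(1), of y, unfolded mult.commute[of y]]
  note a = scale_between[OF assms(2), of "of_int a"] and b = scale_between[OF assms(2), of "of_int b"]
  show ?thesis
    unfolding between_def mul_lo_def mul_hi_def of_int_min of_int_max of_int_mult
    using order_trans[OF min.mono[OF a(1) b(1)] x(1)] order_trans[OF x(2) max.mono[OF a(2) b(2)]] ..
qed

lemma between_square:
  assumes "between l h x"
  shows "between (sq_lo l h) (sq_hi l h) (x\<^sup>2)"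
proof -
  have "between (mul_lo l h l h) (mul_hi l h l h) (x\<^sup>2)"
    using between_mult[OF assms assms] by (simp add: power2_eq_square)
  moreover have "mul_hi l h l h \<le> sq_hi l h"
  proof -
    have "2 * (l * h) \<le> l * l + h * h"
      using zero_le_power2[of "l - h"] by (simp add: power2_eq_square algebra_simps)
    then show ?thesis by (auto simp: mul_hi_def sq_hi_def mult.commute)
  qed
  moreover have "of_int (sq_lo l h) \<le> x\<^sup>2"
  proof -
    have x: "of_int l \<le> x" "- of_int h \<le> - x" using assms by (auto simp: between_def)
    show ?thesis
      using power_mono[OF x(1), of 2] power_mono[OF x(2), of 2]
      by (simp add: sq_lo_def power2_eq_square)
  qed
  ultimately show ?thesis
    unfolding between_def using of_int_le_iff[of "mul_hi l h l h" "sq_hi l h", where 'a = real] by linarith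
qed

lemma between_add: "between l h x \<Longrightarrow> between l' h' y \<Longrightarrow> between (l + l') (h + h') (x + y)"
  by (simp add: between_def)

lemma between_diff: "between l h x \<Longrightarrow> between l' h' y \<Longrightarrow> between (l - h') (h - l') (x - y)"
  by (simp add: between_def)

lemma drop_bit_bounds:
  "of_int (drop_bit n k) \<le> (of_int k / 2 ^ n :: real)"
  "(of_int k / 2 ^ n :: real) \<le> of_int (drop_bit n k + 1)"
proof -
  have "(of_int k / 2 ^ n :: real) = of_int k / of_int (2 ^ n)" by simp
  then show "of_int (drop_bit n k) \<le> (of_int k / 2 ^ n :: real)"
    "(of_int k / 2 ^ n :: real) \<le> of_int (drop_bit n k + 1)"
    using floor_divide_of_int_eq[of k "2 ^ n", where 'a = real]
      of_int_floor_le[of "of_int k / of_int (2 ^ n) :: real"]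
      real_of_int_floor_add_one_ge[of "of_int k / of_int (2 ^ n) :: real"]
    by (simp_all add: drop_bit_eq_div)
qed

lemma between_drop_bit:
  fixes n :: nat
  assumes "between l h x"
  shows "between (drop_bit n l) (drop_bit n h + 1) (x / 2 ^ n)"
proof -
  have x: "of_int l / 2 ^ n \<le> x / 2 ^ n" "x / 2 ^ n \<le> of_int h / 2 ^ n"
    using assms by (auto simp: between_def intro: divide_right_mono)
  show ?thesis
    unfolding between_def
    using x drop_bit_bounds(1)[where n = n and k = l] drop_bit_bounds(2)[where n = n and k = h] by linarith
qed

lemma between_bisect: "between l h x \<Longrightarrow> between l m x \<or> between m h x"
  by (auto simp: between_def)

text \<open>All coordinates are integers in units of \<open>2^-12\<close>. The orbits of all parameters in the box
  \<open>[a0, a1] + i [b0, b1]\<close> are enclosed by a box with outward rounding; \<open>67108864\<close> is \<open>4\<close> in the units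
  \<open>2^-24\<close> of squares. An enclosure of side longer than \<open>3\<close> is given up as useless. Each case distinction is made by
  pattern matching on a Boolean argument, so that the simplifier evaluates only the branch that is taken.\<close>

function (sequential) escapes and escapes_step where
  "escapes 0 a0 a1 b0 b1 xl xh yl yh = False"
| "escapes (Suc n) a0 a1 b0 b1 xl xh yl yh =
     escapes_step (67108864 < sq_lo xl xh + sq_lo yl yh) (12288 < xh - xl \<or> 12288 < yh - yl)
       n a0 a1 b0 b1 xl xh yl yh"
| "escapes_step True wide n a0 a1 b0 b1 xl xh yl yh = True"
| "escapes_step False True n a0 a1 b0 b1 xl xh yl yh = False"
| "escapes_step False False n a0 a1 b0 b1 xl xh yl yh =
     escapes n a0 a1 b0 b1
       (drop_bit 12 (sq_lo xl xh - sq_hi yl yh) + a0) (drop_bit 12 (sq_hi xl xh - sq_lo yl yh) + 1 + a1)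
       (drop_bit 11 (mul_lo xl xh yl yh) + b0) (drop_bit 11 (mul_hi xl xh yl yh) + 1 + b1)"
  by pat_completeness auto
termination
  by (relation "Wellfounded.measure (\<lambda>x. case x of Inl (n, _) \<Rightarrow> 2 * n | Inr (_, _, n, _) \<Rightarrow> 2 * n + 1)") auto

text \<open>Bisects a box along its longer side until each piece is either accepted by \<open>out\<close> or consists of
  escaping parameters. The argument \<open>d\<close> bounds the depth of the bisection.\<close>

function (sequential) cover and cover_step and cover_split where
  "cover out N 0 a0 a1 b0 b1 = False"
| "cover out N (Suc d) a0 a1 b0 b1 =
     cover_step (out a0 a1 b0 b1 \<or> escapes N a0 a1 b0 b1 a0 a1 b0 b1) out N d a0 a1 b0 b1"
| "cover_step True out N d a0 a1 b0 b1 = True"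
| "cover_step False out N d a0 a1 b0 b1 = cover_split (b1 - b0 \<le> a1 - a0) out N d a0 a1 b0 b1"
| "cover_split True out N d a0 a1 b0 b1 =
     (cover out N d a0 (drop_bit 1 (a0 + a1)) b0 b1 \<and> cover out N d (drop_bit 1 (a0 + a1)) a1 b0 b1)"
| "cover_split False out N d a0 a1 b0 b1 =
     (cover out N d a0 a1 b0 (drop_bit 1 (b0 + b1)) \<and> cover out N d a0 a1 (drop_bit 1 (b0 + b1)) b1)"
  by pat_completeness auto
termination
  by (relation "Wellfounded.measure (\<lambda>x. case x of Inl (_, _, d, _) \<Rightarrow> 3 * d
    | Inr (Inl (_, _, _, d, _)) \<Rightarrow> 3 * d + 2 | Inr (Inr (_, _, _, d, _)) \<Rightarrow> 3 * d + 1)") auto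

definition in_box :: "int \<Rightarrow> int \<Rightarrow> int \<Rightarrow> int \<Rightarrow> complex \<Rightarrow> bool" where
  "in_box a0 a1 b0 b1 c \<longleftrightarrow> between a0 a1 (2 ^ 12 * Re c) \<and> between b0 b1 (2 ^ 12 * Im c)"

lemma in_box_step:
  assumes "in_box xl xh yl yh z" "in_box a0 a1 b0 b1 c"
  shows "in_box (drop_bit 12 (sq_lo xl xh - sq_hi yl yh) + a0)
      (drop_bit 12 (sq_hi xl xh - sq_lo yl yh) + 1 + a1)
      (drop_bit 11 (mul_lo xl xh yl yh) + b0) (drop_bit 11 (mul_hi xl xh yl yh) + 1 + b1) (z\<^sup>2 + c)"
proof -
  have x: "between xl xh (2 ^ 12 * Re z)" and y: "between yl yh (2 ^ 12 * Im z)"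
    and a: "between a0 a1 (2 ^ 12 * Re c)" and b: "between b0 b1 (2 ^ 12 * Im c)"
    using assms by (auto simp: in_box_def)
  have re: "2 ^ 12 * Re (z\<^sup>2 + c) = ((2 ^ 12 * Re z)\<^sup>2 - (2 ^ 12 * Im z)\<^sup>2) / 2 ^ 12 + 2 ^ 12 * Re c"
    by (simp add: power2_eq_square field_simps)
  have im: "2 ^ 12 * Im (z\<^sup>2 + c) = ((2 ^ 12 * Re z) * (2 ^ 12 * Im z)) / 2 ^ 11 + 2 ^ 12 * Im c"
    by (simp add: power2_eq_square field_simps)
  show ?thesis
    unfolding in_box_def re im
    using between_add[OF between_drop_bit[OF between_diff[OF between_square[OF x] between_square[OF y]], of 12] a]
      between_add[OF between_drop_bit[OF between_mult[OF x y], of 11] b] ..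
qed

text \<open>The second statement is the same one for the auxiliary function, which replaces its two tests by
  arguments; the hypothesis on \<open>far\<close> records which test it stands for.\<close>

lemma escapes_sound:
  "escapes n a0 a1 b0 b1 xl xh yl yh \<Longrightarrow> in_box a0 a1 b0 b1 c \<Longrightarrow> in_box xl xh yl yh (orbit c k)
    \<Longrightarrow> \<exists>k. 2 < cmod (orbit c k)"
  "escapes_step far wide n a0 a1 b0 b1 xl xh yl yh \<Longrightarrow>
    (far \<Longrightarrow> 67108864 < sq_lo xl xh + sq_lo yl yh) \<Longrightarrow> in_box a0 a1 b0 b1 c \<Longrightarrow>
    in_box xl xh yl yh (orbit c k) \<Longrightarrow> \<exists>k. 2 < cmod (orbit c k)"
proof (induction n a0 a1 b0 b1 xl xh yl yh and far wide n a0 a1 b0 b1 xl xh yl yh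
    arbitrary: k and k rule: escapes_escapes_step.induct)
  case (2 n a0 a1 b0 b1 xl xh yl yh)
  then show ?case by auto
next
  case (3 wide n a0 a1 b0 b1 xl xh yl yh)
  have "between (sq_lo xl xh) (sq_hi xl xh) ((2 ^ 12 * Re (orbit c k))\<^sup>2)"
    "between (sq_lo yl yh) (sq_hi yl yh) ((2 ^ 12 * Im (orbit c k))\<^sup>2)"
    using 3(4) by (auto simp only: in_box_def intro!: between_square)
  moreover have "real_of_int 67108864 < of_int (sq_lo xl xh + sq_lo yl yh)"
    using 3(2) by (subst of_int_less_iff) simp
  ultimately have "2\<^sup>2 < (Re (orbit c k))\<^sup>2 + (Im (orbit c k))\<^sup>2"
    by (simp add: between_def power_mult_distrib)
  then have "2 < cmod (orbit c k)"
    unfolding cmod_def by (rule real_less_rsqrt)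
  then show ?case by blast
next
  case (5 n a0 a1 b0 b1 xl xh yl yh)
  show ?case
  proof (rule 5(1))
    show "in_box (drop_bit 12 (sq_lo xl xh - sq_hi yl yh) + a0)
      (drop_bit 12 (sq_hi xl xh - sq_lo yl yh) + 1 + a1)
      (drop_bit 11 (mul_lo xl xh yl yh) + b0) (drop_bit 11 (mul_hi xl xh yl yh) + 1 + b1) (orbit c (Suc k))"
      using in_box_step[OF 5(5) 5(4)] by simp
  qed (use 5 in auto)
qed auto

lemma cover_sound:
  assumes c: "c \<in> mandelbrot"
  shows "cover out N d a0 a1 b0 b1 \<Longrightarrow> in_box a0 a1 b0 b1 c \<Longrightarrow>
      \<exists>a0 a1 b0 b1. out a0 a1 b0 b1 \<and> in_box a0 a1 b0 b1 c"
    and "cover_step found out N d a0 a1 b0 b1 \<Longrightarrow>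
      (found \<Longrightarrow> out a0 a1 b0 b1 \<or> escapes N a0 a1 b0 b1 a0 a1 b0 b1) \<Longrightarrow> in_box a0 a1 b0 b1 c \<Longrightarrow>
      \<exists>a0 a1 b0 b1. out a0 a1 b0 b1 \<and> in_box a0 a1 b0 b1 c"
    and "cover_split wide out N d a0 a1 b0 b1 \<Longrightarrow> in_box a0 a1 b0 b1 c \<Longrightarrow>
      \<exists>a0 a1 b0 b1. out a0 a1 b0 b1 \<and> in_box a0 a1 b0 b1 c"
proof (induction out N d a0 a1 b0 b1 and found out N d a0 a1 b0 b1 and wide out N d a0 a1 b0 b1
    rule: cover_cover_step_cover_split.induct)
  case (3 out N d a0 a1 b0 b1)
  have "\<not> escapes N a0 a1 b0 b1 a0 a1 b0 b1"
  proof
    assume "escapes N a0 a1 b0 b1 a0 a1 b0 b1"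
    moreover have "in_box a0 a1 b0 b1 (orbit c 1)" using 3 by simp
    ultimately obtain k where "2 < cmod (orbit c k)"
      using escapes_sound(1) 3(3) by blast
    with mandelbrot_orbit_le_2[OF c, of k] show False by simp
  qed
  then show ?case using 3 by blast
next
  case (5 out N d a0 a1 b0 b1)
  then show ?case
    using between_bisect[of a0 a1 "2 ^ 12 * Re c" "drop_bit 1 (a0 + a1)"] by (auto simp: in_box_def)
next
  case (6 out N d a0 a1 b0 b1)
  then show ?case
    using between_bisect[of b0 b1 "2 ^ 12 * Im c" "drop_bit 1 (b0 + b1)"] by (auto simp: in_box_def)
qed auto

text \<open>The box is \<open>[1/2, 2] + i [0, 2]\<close>.\<close>

lemma cover_half_plane: "cover (\<lambda>_ _ _ _. False) 10 30 2048 8192 0 8192"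
  by code_simp

text \<open>The inequality \<open>10 b^2 \<le> 9 \<epsilon>^3\<close> for \<open>a = -2 + \<epsilon>\<close>, at the corner of the box where it is hardest
  to satisfy; the factor \<open>2^12\<close> makes both sides homogeneous in the unit.\<close>

definition below_cusp_curve :: "int \<Rightarrow> int \<Rightarrow> int \<Rightarrow> int \<Rightarrow> bool" where
  "below_cusp_curve a0 a1 b0 b1 \<longleftrightarrow> 10 * 2 ^ 12 * (b1 * b1) \<le> 9 * ((a0 + 8192) * (a0 + 8192) * (a0 + 8192))"

text \<open>The box is \<open>[-2 + 243/4096, -7/4] + i [0, 2]\<close>; its left edge is to the left of \<open>-2 + 119/2000\<close>,
  where the argument for parameters close to \<open>-2\<close> takes over.\<close>

lemma cover_tip: "cover below_cusp_curve 10 40 (-7949) (-7168) 0 8192"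
  by code_simp

section \<open>Parameters to the right of the cusp\<close>

text \<open>The hypothetical parameters that have to be excluded: points of the Mandelbrot set to the right of the
  cusp and not above the curve. Orbits are written as \<open>1/2 + u + i y\<close>, because \<open>1/2\<close> is the
  parabolic fixed point for the parameter \<open>1/4\<close>.\<close>

locale right_parameter =
  fixes \<delta> b :: real
  assumes mand: "Complex (1/4 + \<delta>) b \<in> mandelbrot"
    and \<delta>: "0 < \<delta>" "\<delta> \<le> 1/4"
    and b: "0 \<le> b" "b\<^sup>2 \<le> 9/10 * \<delta>^3"
begin

definition u :: "nat \<Rightarrow> real" where "u n = Re (orbit (Complex (1/4 + \<delta>) b) n) - 1/2"
definition y :: "nat \<Rightarrow> real" where "y n = Im (orbit (Complex (1/4 + \<delta>) b) n)"
definition H :: "nat \<Rightarrow> real" where "H n = (u n)\<^sup>2 + \<delta>"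

lemma start: "u 0 = -1/2" "y 0 = 0"
  by (simp_all add: u_def y_def)

lemma u_Suc: "u (Suc n) = u n + H n - (y n)\<^sup>2"
  by (simp add: u_def y_def H_def power2_eq_square algebra_simps)

lemma y_Suc: "y (Suc n) = (1 + 2 * u n) * y n + b"
  by (simp add: u_def y_def power2_eq_square algebra_simps)

lemma H_pos: "0 < H n"
  using \<delta> by (simp add: H_def add_nonneg_pos)

text \<open>The escape radius \<open>R\<close> with \<open>R^2 = R + |c|\<close>, squared and estimated.\<close>

lemma radius: "(u n + 1/2)\<^sup>2 + (y n)\<^sup>2 \<le> 146/100 + 7/4 * \<delta>"
proof -
  let ?c = "Complex (1/4 + \<delta>) b"
  define \<rho> where "\<rho> = 146/100 + 7/4 * \<delta>"
  define m where "m = 1/4 + 10563/10000 * \<delta>"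
  have "\<delta>\<^sup>2 \<le> \<delta> * (1/4)"
    using \<delta> unfolding power2_eq_square by (intro mult_left_mono) auto
  then have "9/10 * \<delta>\<^sup>2 \<le> 563/10000 * (1/2 + 20563/10000 * \<delta>)"
    using \<delta> by simp
  then have "\<delta> * (9/10 * \<delta>\<^sup>2) \<le> \<delta> * (563/10000 * (1/2 + 20563/10000 * \<delta>))"
    using \<delta> by (intro mult_left_mono) auto
  moreover have "m\<^sup>2 - (1/4 + \<delta>)\<^sup>2 = \<delta> * (563/10000 * (1/2 + 20563/10000 * \<delta>))"
    by (simp add: m_def power2_eq_square algebra_simps)
  moreover have "9/10 * \<delta>^3 = \<delta> * (9/10 * \<delta>\<^sup>2)"
    by (simp add: power3_eq_cube power2_eq_square)
  ultimately have "(1/4 + \<delta>)\<^sup>2 + b\<^sup>2 \<le> m\<^sup>2"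
    using b(2) by linarith
  then have m: "cmod ?c \<le> m"
    using \<delta> by (simp add: cmod_def m_def real_le_lsqrt)
  have "0 \<le> (\<delta> - 74/1000)\<^sup>2" by simp
  then have "\<rho> \<le> (\<rho> - m)\<^sup>2"
    using \<delta> by (simp add: \<rho>_def m_def power2_eq_square algebra_simps)
  moreover have "m \<le> \<rho>" "1 \<le> \<rho>" using \<delta> by (simp_all add: \<rho>_def m_def)
  ultimately have "sqrt \<rho> \<le> \<rho> - m" by (intro real_le_lsqrt) auto
  then have "cmod (orbit ?c n) \<le> sqrt \<rho>"
    using m \<open>1 \<le> \<rho>\<close> by (intro mandelbrot_radius[OF mand]) auto
  then have "(cmod (orbit ?c n))\<^sup>2 \<le> \<rho>"
    using \<open>1 \<le> \<rho>\<close> by (simp add: sqrt_ge_absD)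
  then show ?thesis
    by (simp add: cmod_power2 u_def y_def \<rho>_def)
qed

lemma u_le_1: "u n \<le> 1"
proof (rule ccontr)
  assume "\<not> u n \<le> 1"
  then have "(3/2)\<^sup>2 \<le> (u n + 1/2)\<^sup>2" by (intro power_mono) auto
  moreover have "(3/2)\<^sup>2 = (9/4 :: real)" by (simp add: power2_eq_square)
  ultimately show False using radius[of n] \<delta> zero_le_power2[of "y n"] by linarith
qed

text \<open>If \<open>u\<close> does not increase in this step, the next point still has a large imaginary part and must lie
  within the escape radius.\<close>

lemma turning_bound:
  assumes "0 \<le> u n" "0 \<le> y n" and turn: "H n \<le> (y n)\<^sup>2"
  shows "((y n)\<^sup>2 - H n)\<^sup>2 + 2 * u n * (1 + 2 * u n) * ((y n)\<^sup>2 - H n)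
      + (1 + 2 * u n)\<^sup>2 * (1/4 + H n) \<le> 146/100 + 7/4 * \<delta>"
proof -
  have "((1 + 2 * u n) * y n)\<^sup>2 \<le> (y (Suc n))\<^sup>2"
    unfolding y_Suc using assms b by (intro power_mono) auto
  moreover have "(u (Suc n) + 1/2)\<^sup>2 + ((1 + 2 * u n) * y n)\<^sup>2 =
      ((y n)\<^sup>2 - H n)\<^sup>2 + 2 * u n * (1 + 2 * u n) * ((y n)\<^sup>2 - H n) + (1 + 2 * u n)\<^sup>2 * (1/4 + H n)"
    unfolding u_Suc by (simp add: power2_eq_square algebra_simps)
  ultimately show ?thesis using radius[of "Suc n"] by linarith
qed

lemma no_turning_right:
  assumes u: "43/100 \<le> u n" and y: "0 \<le> y n"
  shows "(y n)\<^sup>2 < H n"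
proof (rule ccontr)
  assume "\<not> (y n)\<^sup>2 < H n"
  then have turn: "H n \<le> (y n)\<^sup>2" by simp
  have "(186/100)\<^sup>2 \<le> (1 + 2 * u n)\<^sup>2" using u by (intro power_mono) auto
  moreover have "1/4 + (43/100)\<^sup>2 + \<delta> \<le> 1/4 + H n"
    using u power_mono[of "43/100" "u n" 2] by (simp add: H_def)
  ultimately have "(186/100)\<^sup>2 * (1/4 + (43/100)\<^sup>2 + \<delta>) \<le> (1 + 2 * u n)\<^sup>2 * (1/4 + H n)"
    using \<delta> by (intro mult_mono) auto
  moreover have "0 \<le> ((y n)\<^sup>2 - H n)\<^sup>2 + 2 * u n * (1 + 2 * u n) * ((y n)\<^sup>2 - H n)"
    using u turn by (intro add_nonneg_nonneg mult_nonneg_nonneg) auto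
  ultimately have "(186/100)\<^sup>2 * (1/4 + (43/100)\<^sup>2 + \<delta>) \<le> 146/100 + 7/4 * \<delta>"
    using turning_bound[OF _ y turn] u by linarith
  then show False using \<delta> by (simp add: power2_eq_square algebra_simps)
qed

text \<open>If \<open>u\<close> never decreases, it converges. Then \<open>y^2\<close>, which is \<open>H\<close> minus the increment of \<open>u\<close>, converges
  to the positive limit of \<open>H\<close>; but \<open>y\<close> grows at least by the factor \<open>1 + 2 u > 1\<close> in each step.\<close>

lemma turns_eventually:
  assumes "0 < u m" and y: "\<And>n. m \<le> n \<Longrightarrow> 0 \<le> y n"
    and no_turn: "\<And>n. m \<le> n \<Longrightarrow> (y n)\<^sup>2 \<le> H n"
  shows False
proof -
  define U where "U n = u (n + m)" for n
  have inc: "incseq U"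
    unfolding U_def by (rule incseq_SucI) (use no_turn in \<open>auto simp: u_Suc\<close>)
  have "\<forall>n. U n \<le> 1" using u_le_1 by (simp add: U_def)
  with inc obtain L where L: "U \<longlonglongrightarrow> L" and le: "\<forall>n. U n \<le> L"
    by (rule incseq_convergent)
  have "0 < L" using \<open>0 < u m\<close> le[rule_format, of 0] by (simp add: U_def)
  have "(\<lambda>n. (U n)\<^sup>2 + \<delta> - (U (Suc n) - U n)) \<longlonglongrightarrow> L\<^sup>2 + \<delta> - (L - L)"
    by (intro tendsto_intros L LIMSEQ_Suc)
  moreover have "(U n)\<^sup>2 + \<delta> - (U (Suc n) - U n) = (y (n + m))\<^sup>2" for n
    by (simp add: U_def u_Suc H_def)
  ultimately have "(\<lambda>n. (y (n + m))\<^sup>2) \<longlonglongrightarrow> L\<^sup>2 + \<delta>" by simp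
  then have "(\<lambda>n. sqrt ((y (n + m))\<^sup>2)) \<longlonglongrightarrow> sqrt (L\<^sup>2 + \<delta>)"
    by (rule tendsto_real_sqrt)
  then have Y: "(\<lambda>n. y (n + m)) \<longlonglongrightarrow> sqrt (L\<^sup>2 + \<delta>)" using y by simp
  have "(\<lambda>n. (1 + 2 * U n) * y (n + m) + b) \<longlonglongrightarrow> (1 + 2 * L) * sqrt (L\<^sup>2 + \<delta>) + b"
    by (intro tendsto_intros L Y)
  moreover have "(\<lambda>n. (1 + 2 * U n) * y (n + m) + b) = (\<lambda>n. y (Suc n + m))"
    by (simp add: U_def y_Suc)
  ultimately have "(1 + 2 * L) * sqrt (L\<^sup>2 + \<delta>) + b = sqrt (L\<^sup>2 + \<delta>)"
    using LIMSEQ_unique[OF LIMSEQ_Suc[OF Y]] by metis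
  then have "2 * L * sqrt (L\<^sup>2 + \<delta>) + b = 0" by (simp add: algebra_simps)
  moreover have "0 < sqrt (L\<^sup>2 + \<delta>)" using \<delta> by (simp add: add_nonneg_pos)
  ultimately show False using \<open>0 < L\<close> b by (smt (verit) mult_pos_pos)
qed

text \<open>Beyond \<open>43/100\<close>, turning back would require a point outside the escape radius, so \<open>u\<close> would increase
  forever.\<close>

lemma stays_left:
  assumes "0 \<le> y n"
  shows "u n < 43/100"
proof (rule ccontr)
  assume "\<not> u n < 43/100"
  then have right: "43/100 \<le> u n" by simp
  have inv: "43/100 \<le> u (n + k) \<and> 0 \<le> y (n + k)" for k
  proof (induction k)
    case (Suc k)
    with no_turning_right[of "n + k"] b show ?case by (auto simp: u_Suc y_Suc)
  qed (use right assms in auto)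
  have inv': "43/100 \<le> u k \<and> 0 \<le> y k" if "n \<le> k" for k
    using inv[of "k - n"] that by simp
  show False
  proof (rule turns_eventually[of n])
    show "0 < u n" using right by simp
  qed (use inv' no_turning_right in \<open>auto intro: less_imp_le\<close>)
qed

end

subsection \<open>Not too close to the cusp\<close>

text \<open>All quantities are in units of \<open>2^-20\<close>; \<open>450888\<close> is \<open>43/100\<close>, rounded up. For \<open>y \<ge> 0\<close>, a
  lower bound of \<open>u\<close> and an upper bound of \<open>y\<close> determine a lower bound of the next \<open>u\<close>, at least for
  \<open>u \<ge> -1/2\<close>, where \<open>u + u^2\<close> is increasing. The upper bound of \<open>u\<close>, needed only for the growth of \<open>y\<close>, is cut off at
  \<open>43/100\<close> because \<open>u\<close> cannot pass this value.\<close>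

function track :: "nat \<Rightarrow> int \<Rightarrow> int \<Rightarrow> int \<Rightarrow> int \<Rightarrow> int \<Rightarrow> int \<Rightarrow> bool"
  and track_step :: "bool \<Rightarrow> bool \<Rightarrow> nat \<Rightarrow> int \<Rightarrow> int \<Rightarrow> int \<Rightarrow> int \<Rightarrow> int \<Rightarrow> int \<Rightarrow> bool" where
  "track 0 d0 d1 bh ul uh yh = False"
| "track (Suc n) d0 d1 bh ul uh yh = track_step (450888 \<le> ul) (ul < -524288) n d0 d1 bh ul uh yh"
| "track_step True low n d0 d1 bh ul uh yh = True"
| "track_step False True n d0 d1 bh ul uh yh = False"
| "track_step False False n d0 d1 bh ul uh yh = track n d0 d1 bh (ul + d0 + drop_bit 20 (ul * ul - yh * yh))
     (min 450888 (uh + d1 + 1 + drop_bit 20 (uh * uh))) (yh + bh + 1 + drop_bit 19 (uh * yh))"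
  by pat_completeness auto
termination
  by (relation "Wellfounded.measure (\<lambda>x. case x of Inl (n, _) \<Rightarrow> 2 * n | Inr (_, _, n, _) \<Rightarrow> 2 * n + 1)") auto

text \<open>Covers the values of \<open>\<rho> = sqrt \<delta>\<close> from \<open>r\<close> up to \<open>1/2\<close> by intervals whose length is
  proportional to \<open>r^2\<close>. The bound \<open>972/1024 \<rho>^3\<close> for \<open>b\<close> is slightly larger than \<open>sqrt (9/10) \<rho>^3\<close>.\<close>

function sweep :: "nat \<Rightarrow> int \<Rightarrow> bool"
  and sweep_step :: "bool \<Rightarrow> nat \<Rightarrow> int \<Rightarrow> bool"
  and sweep_box :: "nat \<Rightarrow> int \<Rightarrow> int \<Rightarrow> bool" where
  "sweep 0 r = False"
| "sweep (Suc n) r = sweep_step (524288 \<le> r) n r"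
| "sweep_step True n r = True"
| "sweep_step False n r = sweep_box n r (r + drop_bit 30 (40 * (r * r)))"
| "sweep_box n r r' = (track 200 (drop_bit 20 (r * r)) (drop_bit 20 (r' * r') + 1)
     (drop_bit 50 (972 * (r' * r' * r')) + 1) (-524288) (-524288) 0 \<and> sweep n r')"
  by pat_completeness auto
termination
  by (relation "Wellfounded.measure (\<lambda>x. case x of Inl (n, _) \<Rightarrow> 3 * n
    | Inr (Inl (_, n, _)) \<Rightarrow> 3 * n + 2 | Inr (Inr (n, _)) \<Rightarrow> 3 * n + 1)") auto

context right_parameter
begin

lemma track_sound:
  "track n d0 d1 bh ul uh yh \<Longrightarrow> between d0 d1 (2^20 * \<delta>) \<Longrightarrow> 2^20 * b \<le> of_int bh \<Longrightarrow>
    between ul uh (2^20 * u k) \<Longrightarrow> between 0 yh (2^20 * y k) \<Longrightarrow> False"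
  "track_step far low n d0 d1 bh ul uh yh \<Longrightarrow> (far \<Longrightarrow> 450888 \<le> ul) \<Longrightarrow> (\<not> low \<Longrightarrow> -524288 \<le> ul) \<Longrightarrow>
    between d0 d1 (2^20 * \<delta>) \<Longrightarrow> 2^20 * b \<le> of_int bh \<Longrightarrow>
    between ul uh (2^20 * u k) \<Longrightarrow> between 0 yh (2^20 * y k) \<Longrightarrow> False"
proof (induction n d0 d1 bh ul uh yh and far low n d0 d1 bh ul uh yh
    arbitrary: k and k rule: track_track_step.induct)
  case (2 n d0 d1 bh ul uh yh)
  then show ?case by auto
next
  case (3 low n d0 d1 bh ul uh yh)
  have "real_of_int 450888 \<le> of_int ul" using 3(2) by (subst of_int_le_iff) simp
  then have "43/100 \<le> u k" using 3(6) by (simp add: between_def)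
  with stays_left[of k] 3(7) show False by (simp add: between_def)
next
  case (5 n d0 d1 bh ul uh yh)
  let ?S = "2 ^ 20 :: real"
  have d: "of_int d0 \<le> ?S * \<delta>" "?S * \<delta> \<le> of_int d1" and ul: "of_int ul \<le> ?S * u k"
    and uh: "?S * u k \<le> of_int uh" and y: "0 \<le> y k" and yh: "?S * y k \<le> of_int yh"
    using 5 by (auto simp: between_def)
  have low: "- (?S / 2) \<le> of_int ul"
    using 5(4) of_int_le_iff[of "-524288" ul, where 'a = real] by simp
  have uk: "-1/2 \<le> u k" using low ul by simp
  have left: "u k < 43/100" using stays_left[OF y] .
  have "y k \<le> 2"
    using mandelbrot_orbit_le_2[OF mand, of k] abs_Im_le_cmod[of "orbit (Complex (1/4 + \<delta>) b) k"]
    by (simp add: y_def)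
  have ysq: "(?S * y k)\<^sup>2 \<le> (of_int yh)\<^sup>2" using y yh by (intro power_mono) auto
  have mono: "p + p\<^sup>2 / ?S \<le> q + q\<^sup>2 / ?S" if "p \<le> q" "- (?S / 2) \<le> p" for p q
  proof -
    have "0 \<le> (q - p) * (1 + (p + q) / ?S)"
      using that by (intro mult_nonneg_nonneg) (auto simp: field_simps)
    then show ?thesis by (simp add: power2_eq_square field_simps)
  qed
  have u': "?S * u (Suc k) = ?S * u k + (?S * u k)\<^sup>2 / ?S + ?S * \<delta> - (?S * y k)\<^sup>2 / ?S"
    by (simp add: u_Suc H_def power2_eq_square field_simps)
  have y': "?S * y (Suc k) = ?S * y k * (1 + 2 * (?S * u k) / ?S) + ?S * b"
    by (simp add: y_Suc field_simps)
  show ?case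
  proof (rule 5(1)[of "Suc k"])
    have "of_int (ul + d0 + drop_bit 20 (ul * ul - yh * yh)) \<le>
        of_int ul + (of_int ul)\<^sup>2 / ?S + of_int d0 - (of_int yh)\<^sup>2 / ?S"
      using drop_bit_bounds(1)[of 20 "ul * ul - yh * yh"] by (simp add: power2_eq_square diff_divide_distrib)
    also have "\<dots> \<le> ?S * u (Suc k)"
      unfolding u' using mono[OF ul low] d(1) divide_right_mono[OF ysq, of ?S, simplified] by simp
    finally have lo: "of_int (ul + d0 + drop_bit 20 (ul * ul - yh * yh)) \<le> ?S * u (Suc k)" .
    have "?S * u (Suc k) \<le> of_int uh + (of_int uh)\<^sup>2 / ?S + of_int d1"
    proof -
      have "- (?S / 2) \<le> ?S * u k" using uk by simp
      moreover have "0 \<le> (?S * y k)\<^sup>2 / ?S" by simp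
      ultimately show ?thesis unfolding u' using mono[OF uh] d(2) by linarith
    qed
    also have "\<dots> \<le> of_int (uh + d1 + 1 + drop_bit 20 (uh * uh))"
      using drop_bit_bounds(2)[of "uh * uh" 20] by (simp add: power2_eq_square)
    finally have hi: "?S * u (Suc k) \<le> of_int (uh + d1 + 1 + drop_bit 20 (uh * uh))" .
    have yS: "0 \<le> y (Suc k)"
    proof -
      have "0 \<le> 1 + 2 * u k" using uk by simp
      then show ?thesis unfolding y_Suc using mult_nonneg_nonneg[OF _ y] b(1) by (meson add_nonneg_nonneg)
    qed
    have cap: "?S * u (Suc k) \<le> of_int 450888"
      using stays_left[OF yS] by simp
    show "between (ul + d0 + drop_bit 20 (ul * ul - yh * yh))
        (min 450888 (uh + d1 + 1 + drop_bit 20 (uh * uh))) (?S * u (Suc k))"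
      unfolding between_def of_int_min using lo hi cap by simp
    have "?S * y (Suc k) \<le> of_int yh * (1 + 2 * of_int uh / ?S) + of_int bh"
    proof -
      have "0 \<le> 1 + 2 * (?S * u k) / ?S" "0 \<le> ?S * y k" "0 \<le> real_of_int yh"
        "1 + 2 * (?S * u k) / ?S \<le> 1 + 2 * of_int uh / ?S"
        using uk uh y yh by (simp_all add: field_simps)
      then show ?thesis unfolding y' using yh 5(6) add_mono[OF mult_mono] by blast
    qed
    also have "\<dots> \<le> of_int (yh + bh + 1 + drop_bit 19 (uh * yh))"
      using drop_bit_bounds(2)[of "uh * yh" 19] by (simp add: field_simps)
    finally show "between 0 (yh + bh + 1 + drop_bit 19 (uh * yh)) (?S * y (Suc k))"
      using yS by (simp add: between_def)
  qed (use 5 in auto)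
qed auto

lemma sweep_sound:
  assumes \<rho>: "0 < \<rho>" "\<rho>\<^sup>2 = \<delta>"
  shows "sweep n r \<Longrightarrow> of_int r \<le> 2^20 * \<rho> \<Longrightarrow> 0 \<le> r \<Longrightarrow> 2^20 * \<rho> < 2^19 \<Longrightarrow> False"
    and "sweep_step far n r \<Longrightarrow> (far \<Longrightarrow> 524288 \<le> r) \<Longrightarrow> of_int r \<le> 2^20 * \<rho> \<Longrightarrow> 0 \<le> r \<Longrightarrow>
      2^20 * \<rho> < 2^19 \<Longrightarrow> False"
    and "sweep_box n r r' \<Longrightarrow> of_int r \<le> 2^20 * \<rho> \<Longrightarrow> 0 \<le> r \<Longrightarrow> 0 \<le> r' \<Longrightarrow> 2^20 * \<rho> < 2^19 \<Longrightarrow> False"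
proof (induction n r and far n r and n r r' rule: sweep_sweep_step_sweep_box.induct)
  case (3 n r)
  have "real_of_int 524288 \<le> of_int r" using 3 by (subst of_int_le_iff) simp
  then show False using 3 by simp
next
  case (4 n r)
  have "0 \<le> r + drop_bit 30 (40 * (r * r))" using 4 by simp
  then show False using 4 by simp
next
  case (5 n r r')
  show False
  proof (cases "of_int r' \<le> 2^20 * \<rho>")
    case True
    then show ?thesis using 5 by simp
  next
    case False
    have r: "of_int r \<le> 2^20 * \<rho>" "0 \<le> real_of_int r" "2^20 * \<rho> \<le> of_int r'"
      using 5 False by simp_all
    have "(of_int r)\<^sup>2 \<le> (2^20 * \<rho>)\<^sup>2" "(2^20 * \<rho>)\<^sup>2 \<le> (of_int r')\<^sup>2" "(2^20 * \<rho>)^3 \<le> (of_int r')^3"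
      using power_mono[OF r(1) r(2), of 2] power_mono[OF r(3), of 2] power_mono[OF r(3), of 3] \<rho>(1)
      by (simp_all only: mult_nonneg_nonneg zero_le_power zero_le_numeral less_imp_le)
    then have *: "(of_int r)\<^sup>2 / 2^20 \<le> 2^20 * \<delta>" "2^20 * \<delta> \<le> (of_int r')\<^sup>2 / 2^20"
      "2^20 * (972 / 2^10 * \<rho>^3) \<le> 972 * (of_int r')^3 / 2^50"
      unfolding \<rho>(2)[symmetric] by (simp_all add: power_mult_distrib field_simps)
    have "b\<^sup>2 \<le> (972 / 2^10 * \<rho>^3)\<^sup>2"
    proof -
      have "b\<^sup>2 \<le> 9/10 * \<rho>^6" using b unfolding \<rho>(2)[symmetric] by simp
      also have "\<dots> \<le> (972 / 2^10)\<^sup>2 * \<rho>^6"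
        using \<rho> by (intro mult_right_mono) (auto simp: power2_eq_square)
      also have "\<dots> = (972 / 2^10 * \<rho>^3)\<^sup>2" by (simp add: power_mult_distrib power_divide)
      finally show ?thesis .
    qed
    then have "b \<le> 972 / 2^10 * \<rho>^3"
      using \<rho> by (intro power2_le_imp_le[of b]) auto
    then have "2^20 * b \<le> 972 * (of_int r')^3 / 2^50" using *(3) by simp
    also have "\<dots> \<le> of_int (drop_bit 50 (972 * (r' * r' * r')) + 1)"
      using drop_bit_bounds(2)[of "972 * (r' * r' * r')" 50] by (simp add: power3_eq_cube)
    finally have "2^20 * b \<le> of_int (drop_bit 50 (972 * (r' * r' * r')) + 1)" .
    moreover have "between (drop_bit 20 (r * r)) (drop_bit 20 (r' * r') + 1) (2^20 * \<delta>)"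
      using *(1,2) drop_bit_bounds(1)[of 20 "r * r"] drop_bit_bounds(2)[of "r' * r'" 20]
      unfolding between_def by (simp add: power2_eq_square)
    ultimately show ?thesis
      using 5 track_sound(1)[of 200 "drop_bit 20 (r * r)" "drop_bit 20 (r' * r') + 1"
        "drop_bit 50 (972 * (r' * r' * r')) + 1" "-524288" "-524288" 0 0]
      by (simp add: between_def start)
  qed
qed auto

end

text \<open>The starting point \<open>52428\<close> is \<open>1/20\<close> in units of \<open>2^-20\<close>, rounded down.\<close>

lemma sweep_from_20th: "sweep 500 52428"
  by code_simp

subsection \<open>Close to the cusp\<close>

text \<open>The antiderivative of \<open>\<rho>^3/(t^2 + \<rho>^2)^2\<close> that vanishes at \<open>0\<close>. In the limit of slow motion, \<open>u\<close>
  has the velocity \<open>u^2 + \<rho>^2\<close> and \<open>y\<close> satisfies \<open>y' = 2 u y + b\<close>, so that \<open>y/(u^2 + \<rho>^2)\<close> changes with \<open>u\<close> at the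
  rate \<open>b/(u^2 + \<rho>^2)^2\<close>.\<close>

definition gate :: "real \<Rightarrow> real \<Rightarrow> real" where
  "gate \<rho> t = (arctan (t / \<rho>) + t * \<rho> / (t\<^sup>2 + \<rho>\<^sup>2)) / 2"

lemma gate_deriv:
  assumes "0 < \<rho>"
  shows "(gate \<rho> has_real_derivative \<rho>^3 / (t\<^sup>2 + \<rho>\<^sup>2)\<^sup>2) (at t)"
proof -
  have pos: "0 < t\<^sup>2 + \<rho>\<^sup>2" using assms by (simp add: add_nonneg_pos)
  have "(gate \<rho> has_real_derivative
      (inverse (1 + (t / \<rho>)\<^sup>2) * (1 / \<rho>) + (\<rho> * (t\<^sup>2 + \<rho>\<^sup>2) - t * \<rho> * (2 * t)) / (t\<^sup>2 + \<rho>\<^sup>2)\<^sup>2) / 2) (at t)"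
    unfolding gate_def using assms pos
    by (auto intro!: derivative_eq_intros simp: power2_eq_square ac_simps)
  moreover have "inverse (1 + (t / \<rho>)\<^sup>2) * (1 / \<rho>) = \<rho> / (t\<^sup>2 + \<rho>\<^sup>2)"
    using assms pos by (simp add: field_simps power2_eq_square)
  moreover have "\<rho> / (t\<^sup>2 + \<rho>\<^sup>2) = \<rho> * (t\<^sup>2 + \<rho>\<^sup>2) / (t\<^sup>2 + \<rho>\<^sup>2)\<^sup>2"
    using pos by (simp add: power2_eq_square)
  moreover have "(\<rho> * (t\<^sup>2 + \<rho>\<^sup>2) / (t\<^sup>2 + \<rho>\<^sup>2)\<^sup>2 + (\<rho> * (t\<^sup>2 + \<rho>\<^sup>2) - t * \<rho> * (2 * t)) / (t\<^sup>2 + \<rho>\<^sup>2)\<^sup>2) / 2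
      = \<rho>^3 / (t\<^sup>2 + \<rho>\<^sup>2)\<^sup>2"
  proof -
    have "\<rho> * (t\<^sup>2 + \<rho>\<^sup>2) + (\<rho> * (t\<^sup>2 + \<rho>\<^sup>2) - t * \<rho> * (2 * t)) = 2 * \<rho>^3"
      by (simp add: power2_eq_square power3_eq_cube algebra_simps)
    then show ?thesis unfolding add_divide_distrib[symmetric] by simp
  qed
  ultimately show ?thesis by simp
qed

text \<open>The discrete counterpart of the derivative: \<open>(s^2 + \<rho>^2)(t^2 + \<rho>^2)\<close> is the right denominator, because
  the invariant compares \<open>y/H\<close> at two consecutive points.\<close>

lemma gate_step:
  assumes \<rho>: "0 < \<rho>" and "s \<le> t"
  shows "\<rho>^3 * (t - s) / ((s\<^sup>2 + \<rho>\<^sup>2) * (t\<^sup>2 + \<rho>\<^sup>2)) \<le> gate \<rho> t - gate \<rho> s"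
proof -
  define h where "h = s\<^sup>2 + \<rho>\<^sup>2"
  have h: "0 < h" using \<rho> by (simp add: h_def add_nonneg_pos)
  define D where "D x = gate \<rho> x - \<rho>^3 * (x - s) / (h * (x\<^sup>2 + \<rho>\<^sup>2))" for x
  have "\<exists>d. (D has_real_derivative d) (at x) \<and> 0 \<le> d" for x
  proof -
    define q where "q = x\<^sup>2 + \<rho>\<^sup>2"
    have q: "0 < q" using \<rho> by (simp add: q_def add_nonneg_pos)
    have "(D has_real_derivative \<rho>^3 / q\<^sup>2 - (\<rho>^3 * (h * q) - \<rho>^3 * (x - s) * (h * (2 * x))) / (h * q)\<^sup>2) (at x)"
      unfolding D_def q_def using h q[unfolded q_def]
      by (auto intro!: derivative_eq_intros gate_deriv[OF \<rho>] simp: power2_eq_square)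
    moreover have "\<rho>^3 / q\<^sup>2 - (\<rho>^3 * (h * q) - \<rho>^3 * (x - s) * (h * (2 * x))) / (h * q)\<^sup>2
        = \<rho>^3 * (h - q + 2 * x * (x - s)) / (h * q\<^sup>2)"
      using h q by (simp add: field_simps power2_eq_square)
    moreover have "h - q + 2 * x * (x - s) = (x - s)\<^sup>2"
      by (simp add: h_def q_def power2_eq_square algebra_simps)
    ultimately show ?thesis using \<rho> h by auto
  qed
  then have "D s \<le> D t"
    using \<open>s \<le> t\<close> by (intro DERIV_nonneg_imp_nondecreasing[of s t D]) auto
  then show ?thesis by (simp add: D_def h_def)
qed

lemma gate_0 [simp]: "gate \<rho> 0 = 0"
  by (simp add: gate_def)

lemma gate_minus: "gate \<rho> (- t) = - gate \<rho> t"
proof -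
  have eq1: "arctan (- t / \<rho>) = - arctan (t / \<rho>)" by (simp add: arctan_minus)
  have eq2: "- t * \<rho> / ((- t)\<^sup>2 + \<rho>\<^sup>2) = - (t * \<rho> / (t\<^sup>2 + \<rho>\<^sup>2))" by simp
  have "(- a + - c) / 2 = - ((a + c) / 2)" for a c :: real by (simp add: add_divide_distrib)
  then show ?thesis unfolding gate_def eq1 eq2 .
qed

lemma gate_mono: "0 < \<rho> \<Longrightarrow> s \<le> t \<Longrightarrow> gate \<rho> s \<le> gate \<rho> t"
  by (rule order_trans[OF _ diff_ge_0_iff_ge[THEN iffD1, OF order_trans[OF _ gate_step]]]) auto

lemma arctan_lower:
  assumes "0 \<le> w"
  shows "w / (1 + w\<^sup>2) \<le> arctan w"
proof -
  define z where "z = w / (1 + w\<^sup>2)"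
  have "z \<le> gate 1 w" using gate_step[of 1 0 w] assms by (simp add: z_def add.commute)
  moreover have "gate 1 w = (arctan w + z) / 2" by (simp add: gate_def z_def add.commute)
  ultimately have "z \<le> arctan w" unfolding add_divide_distrib by linarith
  then show ?thesis by (simp add: z_def)
qed

lemma gate_pos_eq:
  assumes "0 < \<rho>" "0 < t"
  shows "gate \<rho> t = pi/4 - (arctan (\<rho> / t) - (\<rho> / t) / (1 + (\<rho> / t)\<^sup>2)) / 2"
proof -
  have "arctan (t / \<rho>) = pi/2 - arctan (\<rho> / t)"
    using arctan_inverse[of "\<rho> / t"] assms by (simp add: inverse_eq_divide)
  moreover have "t * \<rho> / (t\<^sup>2 + \<rho>\<^sup>2) = (\<rho> / t) / (1 + (\<rho> / t)\<^sup>2)"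
    using assms by (simp add: field_simps power2_eq_square)
  ultimately show ?thesis by (simp add: gate_def field_simps)
qed

lemma gate_le: "0 < \<rho> \<Longrightarrow> gate \<rho> t \<le> pi/4"
proof (cases "0 < t")
  case False
  assume "0 < \<rho>"
  then have "gate \<rho> t \<le> 0" using gate_mono[of \<rho> t 0] False by simp
  then show ?thesis using pi_gt_zero by linarith
next
  case True
  assume "0 < \<rho>"
  have "A - (X - Y) / 2 \<le> A" if "Y \<le> X" for A X Y :: real using that by simp
  then show ?thesis
    unfolding gate_pos_eq[OF \<open>0 < \<rho>\<close> True]
    using arctan_lower[of "\<rho> / t"] True \<open>0 < \<rho>\<close> by (metis divide_nonneg_pos less_imp_le)
qed

lemma gate_ge: "0 < \<rho> \<Longrightarrow> - (pi/4) \<le> gate \<rho> t"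
  using gate_le[of \<rho> "- t"] by (simp add: gate_minus)

lemma gate_ge_right:
  assumes "0 < \<rho>" "\<rho> \<le> 1/20" "13/100 \<le> t"
  shows "3/4 \<le> gate \<rho> t"
proof -
  define w where "w = \<rho> / t"
  have w: "0 < w" "w \<le> 2/5" using assms by (auto simp: w_def field_simps)
  have "arctan w \<le> w" using w(1) by (rule arctan_le_self[OF less_imp_le])
  have "w - w / (1 + w\<^sup>2) = w^3 / (1 + w\<^sup>2)"
    by (simp add: field_simps power2_eq_square power3_eq_cube add_nonneg_eq_0_iff)
  moreover have "w^3 / (1 + w\<^sup>2) \<le> (2/5)^3 / 1"
    using w by (intro frac_le power_mono) auto
  moreover have "(2/5)^3 / 1 = (8/125 :: real)" by (simp add: power3_eq_cube)
  ultimately have "arctan w - w / (1 + w\<^sup>2) \<le> 8/125"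
    using \<open>arctan w \<le> w\<close> by linarith
  moreover have "3/4 \<le> pi/4 - X / 2" if "X \<le> 8/125" for X
    using that pi_approx(1) by simp
  ultimately have "3/4 \<le> pi/4 - (arctan w - w / (1 + w\<^sup>2)) / 2" by blast
  moreover have "0 < t" using assms by simp
  ultimately show ?thesis
    unfolding w_def gate_pos_eq[OF assms(1) \<open>0 < t\<close>] by blast
qed

lemma quadratic_nonneg:
  fixes a b c x y :: real
  assumes "0 < a" "b\<^sup>2 \<le> 4 * a * c"
  shows "0 \<le> a * x\<^sup>2 - b * x * y + c * y\<^sup>2"
proof -
  have "4 * a * (a * x\<^sup>2 - b * x * y + c * y\<^sup>2) = (2 * a * x - b * y)\<^sup>2 + (4 * a * c - b\<^sup>2) * y\<^sup>2"
    by (simp add: power2_eq_square algebra_simps)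
  also have "0 \<le> \<dots>" using assms by simp
  finally show ?thesis using assms by (simp add: zero_le_mult_iff)
qed

text \<open>The weight \<open>1 + 2/5 (U + y)\<close> compensates the second-order terms in the growth of
  \<open>y/(H + y^2)\<close> to the right of the gate; it must not grow too fast itself.\<close>

lemma weight_growth:
  fixes U y h :: real
  assumes U: "0 \<le> U" "U \<le> 43/100" and y: "0 \<le> y" and h: "U\<^sup>2 \<le> h"
  shows "2/5 * (1 + 2 * U) * (h - y\<^sup>2 + 2 * U * y) \<le> 86/100 * (h + y\<^sup>2) * (1 + 2/5 * (U + y))"
proof -
  define A where "A = 46/100 * U\<^sup>2 - 8/10 * U * y + 126/100 * y\<^sup>2"
  define C where "C = - (456/1000) * U^3 - 1256/1000 * U\<^sup>2 * y + 1144/1000 * U * y\<^sup>2 + 344/1000 * y^3"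
  have A: "0 \<le> A" unfolding A_def by (rule quadratic_nonneg) (simp_all add: power2_eq_square)
  have "0 \<le> U * (26392/100000 * U\<^sup>2 - 134008/100000 * U * y + 175192/100000 * y\<^sup>2) + 14792/100000 * y^3"
    using U y quadratic_nonneg[of "26392/100000" "134008/100000" "175192/100000" U y]
    by (simp add: power2_eq_square)
  also have "\<dots> = U * A + 43/100 * C"
    by (simp add: A_def C_def power2_eq_square power3_eq_cube algebra_simps)
  finally have "0 \<le> U * A + 43/100 * C" .
  moreover have "U * A \<le> 43/100 * A" using U A by (intro mult_right_mono) auto
  ultimately have AC: "0 \<le> A + C" by linarith
  have "0 \<le> (h - U\<^sup>2) * (46/100 - 456/1000 * U + 344/1000 * y)"
    using U y h by (intro mult_nonneg_nonneg) auto
  moreover have "86/100 * (h + y\<^sup>2) * (1 + 2/5 * (U + y)) - 2/5 * (1 + 2 * U) * (h - y\<^sup>2 + 2 * U * y)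
      = A + C + (h - U\<^sup>2) * (46/100 - 456/1000 * U + 344/1000 * y)"
    by (simp add: A_def C_def power2_eq_square power3_eq_cube field_simps)
  ultimately show ?thesis using AC by linarith
qed

text \<open>The invariant gives \<open>y (1 + 2/5 (u + y)) \<le> 1508/1000 (H + y^2)\<close>. The lemma shows that this is incompatible
  with a point that has just been turned back, that is, \<open>y^2\<close> has come to exceed \<open>H\<close> in one step while
  the turning bound holds. Here \<open>q = sqrt H\<close>.\<close>

lemma not_turning:
  fixes U q y \<delta> :: real
  assumes U: "0 \<le> U" "U < 43/100" and q: "0 < q" "q\<^sup>2 = U\<^sup>2 + \<delta>" and \<delta>: "0 < \<delta>" "\<delta> \<le> 1/400"
    and y: "q \<le> y" "y \<le> (1 + 2 * U) * q + 1/400 * q"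
    and turn: "(y\<^sup>2 - q\<^sup>2)\<^sup>2 + 2 * U * (1 + 2 * U) * (y\<^sup>2 - q\<^sup>2) + (1 + 2 * U)\<^sup>2 * (1/4 + q\<^sup>2)
      \<le> 146/100 + 7/4 * \<delta>"
  shows "1508/1000 * (q\<^sup>2 + y\<^sup>2) < y * (1 + 2/5 * (U + y))"
proof -
  define k where "k = y / q"
  have yk: "y = k * q" using q by (simp add: k_def)
  have k1: "1 \<le> k" using y q by (simp add: k_def)
  have key: "1508/1000 + 1108/1000 * k\<^sup>2 < m * k \<Longrightarrow> m * q \<le> 1 + 2/5 * U \<Longrightarrow> ?thesis" for m
  proof -
    assume 1: "1508/1000 + 1108/1000 * k\<^sup>2 < m * k" and 2: "m * q \<le> 1 + 2/5 * U"
    have "(1508/1000 + 1108/1000 * k\<^sup>2) * q\<^sup>2 < m * k * q\<^sup>2"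
      using 1 q(1) by (intro mult_strict_right_mono) auto
    also have "m * k * q\<^sup>2 = (m * q) * y" by (simp add: yk power2_eq_square)
    also have "\<dots> \<le> (1 + 2/5 * U) * y" using 2 y q by (intro mult_right_mono) auto
    finally have "(1508/1000 + 1108/1000 * k\<^sup>2) * q\<^sup>2 < (1 + 2/5 * U) * y" .
    moreover have "(1508/1000 + 1108/1000 * k\<^sup>2) * q\<^sup>2 = 1508/1000 * q\<^sup>2 + 1108/1000 * y\<^sup>2"
      by (simp add: yk power_mult_distrib algebra_simps)
    moreover have "y * (1 + 2/5 * (U + y)) = (1 + 2/5 * U) * y + 2/5 * y\<^sup>2"
      by (simp add: power2_eq_square field_simps)
    moreover have "1508/1000 * (q\<^sup>2 + y\<^sup>2) = 1508/1000 * q\<^sup>2 + 1508/1000 * y\<^sup>2"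
      by (rule distrib_left)
    ultimately show ?thesis by linarith
  qed
  have mq: "m * q \<le> 1 + 2/5 * U" if "0 \<le> m" "m\<^sup>2 * (U\<^sup>2 + 1/400) \<le> (1 + 2/5 * U)\<^sup>2" for m
  proof (rule power2_le_imp_le)
    have "(m * q)\<^sup>2 \<le> m\<^sup>2 * (U\<^sup>2 + 1/400)"
      unfolding power_mult_distrib q(2) using \<delta> by (intro mult_left_mono) auto
    then show "(m * q)\<^sup>2 \<le> (1 + 2/5 * U)\<^sup>2" using that by simp
  qed (use U in auto)
  show ?thesis
  proof (cases "U \<le> 38/100")
    case True
    have "k * q \<le> ((1 + 2 * U) + 1/400) * q"
      using y(2) unfolding yk distrib_right[of "1 + 2 * U"] .
    then have "k \<le> (1 + 2 * U) + 1/400"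
      using q(1) by (rule mult_right_le_imp_le)
    then have "k \<le> 17625/10000" using True by simp
    then have "0 \<le> (k - 1) * (17625/10000 - k)" using k1 by simp
    then have "1508/1000 + 1108/1000 * k\<^sup>2 < 3 * k"
      using k1 \<open>k \<le> 17625/10000\<close> by (simp add: power2_eq_square field_simps)
    moreover have "3 * q \<le> 1 + 2/5 * U"
    proof (rule mq)
      have "0 \<le> U * (38/100 - U)" using U True by simp
      then show "3\<^sup>2 * (U\<^sup>2 + 1/400) \<le> (1 + 2/5 * U)\<^sup>2"
        using U True by (simp add: power2_eq_square field_simps)
    qed simp
    ultimately show ?thesis by (rule key)
  next
    case False
    define \<tau> where "\<tau> = y\<^sup>2 - q\<^sup>2"
    have \<tau>: "0 \<le> \<tau>" using y q power_mono[of q y 2] by (simp add: \<tau>_def)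
    have U2: "(38/100)\<^sup>2 \<le> U\<^sup>2" using False by (intro power_mono) auto
    have "(176/100)\<^sup>2 \<le> (1 + 2 * U)\<^sup>2" using False by (intro power_mono) auto
    moreover have "1/4 + (38/100)\<^sup>2 + \<delta> \<le> 1/4 + q\<^sup>2" using U2 q by simp
    ultimately have "(176/100)\<^sup>2 * (1/4 + (38/100)\<^sup>2 + \<delta>) \<le> (1 + 2 * U)\<^sup>2 * (1/4 + q\<^sup>2)"
      using \<delta> by (intro mult_mono) auto
    moreover have "2 * (38/100) * (176/100) * \<tau> \<le> 2 * U * (1 + 2 * U) * \<tau>"
      using False \<tau> U by (intro mult_right_mono mult_mono) auto
    moreover have "12216/10000 \<le> (176/100)\<^sup>2 * (1/4 + (38/100)\<^sup>2 + \<delta>)"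
      using \<delta> by (simp add: power2_eq_square)
    ultimately have quad: "\<tau>\<^sup>2 + 13376/10000 * \<tau> \<le> 2429/10000"
      using turn[folded \<tau>_def] \<delta> by linarith
    have "\<tau> \<le> 162/1000"
    proof (rule ccontr)
      assume "\<not> \<tau> \<le> 162/1000"
      then have "(162/1000)\<^sup>2 \<le> \<tau>\<^sup>2" by (intro power_mono) auto
      with quad \<open>\<not> \<tau> \<le> 162/1000\<close> show False by (simp add: power2_eq_square)
    qed
    moreover have "k\<^sup>2 * q\<^sup>2 = q\<^sup>2 + \<tau>" by (simp add: \<tau>_def yk power_mult_distrib)
    moreover have "1444/10000 \<le> q\<^sup>2" using U2 q \<delta> by (simp add: power2_eq_square)
    ultimately have "k\<^sup>2 * q\<^sup>2 \<le> (1457/1000)\<^sup>2 * q\<^sup>2" by (simp add: power2_eq_square)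
    then have "k\<^sup>2 \<le> (1457/1000)\<^sup>2" using q(1) by simp
    then have k2: "k \<le> 1457/1000" by (rule power2_le_imp_le) simp
    then have "0 \<le> (k - 1) * (1457/1000 - k)" using k1 by simp
    then have "1508/1000 + 1108/1000 * k\<^sup>2 < 27/10 * k"
      using k1 k2 by (simp add: power2_eq_square field_simps)
    moreover have "27/10 * q \<le> 1 + 2/5 * U"
    proof (rule mq)
      have "0 \<le> U * (43/100 - U)" using U by simp
      then show "(27/10)\<^sup>2 * (U\<^sup>2 + 1/400) \<le> (1 + 2/5 * U)\<^sup>2"
        using U by (simp add: power2_eq_square field_simps)
    qed simp
    ultimately show ?thesis by (rule key)
  qed
qed

text \<open>The error terms of one step to the right of the gate: on the left, the effect of \<open>b\<close> on the weight, and the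
  loss because \<open>u\<close> moves by \<open>H - y^2\<close> instead of \<open>H\<close>; on the right, the surplus of
  \<open>H + y^2\<close> over its weighted growth.\<close>

lemma gate_absorbs_weight:
  fixes U y \<rho> p M b H N T :: real
  assumes U: "0 \<le> U" "U < 43/100" and \<rho>: "0 < \<rho>" "\<rho> \<le> 1/20" and H: "H = U\<^sup>2 + \<rho>\<^sup>2"
    and y: "0 \<le> y" "y\<^sup>2 \<le> H" and N: "N = H + y\<^sup>2" and T: "T = 1 + 2/5 * (U + y)"
    and M: "0 \<le> M" "M \<le> 96/100" and inv: "y * T \<le> M * p * N"
    and p: "785/1000 + \<rho> * U / H \<le> p" "p \<le> 15708/10000" "13/100 \<le> U \<Longrightarrow> 3/2 \<le> p"
    and next_left: "U + H - y\<^sup>2 < 43/100" and b: "0 \<le> b" "b \<le> 95/100 * \<rho>^3"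
  shows "\<rho>^3 * (2/5 * (U + H - y\<^sup>2 + 2 * ((1 + 2 * U) * y) + b) + y\<^sup>2 / H)
    \<le> p * N * (N - 4 * \<rho>\<^sup>2 * y\<^sup>2 / N - 2/5 * (1 + 2 * U) * (H - y\<^sup>2 + 2 * U * y) / T)"
proof -
  have Hpos: "0 < H" using \<rho> by (simp add: H add_nonneg_pos)
  have Npos: "0 < N" "H \<le> N" "N \<le> 2 * H" using Hpos y by (simp_all add: N add_pos_nonneg)
  have T1: "1 \<le> T" using U y by (simp add: T)
  have \<rho>H: "\<rho>\<^sup>2 \<le> H" by (simp add: H)
  have \<rho>3: "\<rho>^3 \<le> 1/20 * H"
  proof -
    have "\<rho>^3 = \<rho> * \<rho>\<^sup>2" by (simp add: power3_eq_cube power2_eq_square)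
    also have "\<dots> \<le> 1/20 * H" using \<rho> \<rho>H by (intro mult_mono) auto
    finally show ?thesis .
  qed
  have p0: "785/1000 \<le> p" using p(1) U \<rho> Hpos by (smt (verit) divide_nonneg_pos mult_nonneg_nonneg)
  have yM: "y \<le> M * p * N"
    using inv mult_left_mono[OF T1 y(1)] by simp
  also have "\<dots> \<le> 96/100 * p * N" using M p0 Npos by (intro mult_right_mono) auto
  finally have yp: "y \<le> 96/100 * p * N" .
  also have "\<dots> \<le> 96/100 * (15708/10000) * N" using p p0 Npos by (intro mult_right_mono mult_left_mono) auto
  finally have y1: "y \<le> 1508/1000 * N" using Npos by simp
  have small: "4 * \<rho>\<^sup>2 * y\<^sup>2 / N \<le> 228/10000 * N"
  proof -
    have "y\<^sup>2 \<le> (1508/1000 * N)\<^sup>2" using y y1 by (intro power_mono) auto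
    moreover have "\<rho>\<^sup>2 \<le> (1/20)\<^sup>2" using \<rho> by (intro power_mono) auto
    ultimately have "\<rho>\<^sup>2 * y\<^sup>2 \<le> (1/20)\<^sup>2 * (1508/1000 * N)\<^sup>2"
      by (intro mult_mono) auto
    also have "\<dots> \<le> 57/10000 * N\<^sup>2" by (simp add: power2_eq_square)
    finally have "4 * (\<rho>\<^sup>2 * y\<^sup>2) \<le> 228/10000 * N * N" by (simp add: power2_eq_square)
    then show ?thesis using Npos by (simp add: pos_divide_le_eq mult.assoc)
  qed
  define W where "W = 2/5 * (1 + 2 * U) * (H - y\<^sup>2 + 2 * U * y) / T"
  define L where "L = \<rho>^3 * (2/5 * (U + H - y\<^sup>2 + 2 * ((1 + 2 * U) * y) + b) + y\<^sup>2 / H)"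
  have Bpos: ?thesis if "c * N \<le> N - 4 * \<rho>\<^sup>2 * y\<^sup>2 / N - W" "L \<le> p * N * (c * N)" for c
  proof -
    have "0 \<le> p * N" using p0 Npos by simp
    then show ?thesis
      using order_trans[OF that(2) mult_left_mono[OF that(1)]]
      unfolding W_def L_def by simp
  qed
  have b': "b \<le> 95/100 * (1/20 * H)" using b \<rho>3 by linarith
  show ?thesis
  proof (cases "13/100 \<le> U")
    case True
    have "2/5 * (1 + 2 * U) * (H - y\<^sup>2 + 2 * U * y) \<le> 86/100 * N * T"
      unfolding N T by (rule weight_growth) (use U y H in auto)
    then have W: "W \<le> 86/100 * N"
      unfolding W_def by (subst pos_divide_le_eq) (use T1 in auto)
    have U2: "(13/100)\<^sup>2 \<le> U\<^sup>2" using True by (intro power_mono) auto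
    moreover have "U\<^sup>2 \<le> N" using Npos(2) zero_le_power2[of \<rho>] unfolding H by linarith
    ultimately have N0: "169/10000 \<le> N" by (simp add: power2_eq_square)
    have "\<rho>^3 \<le> (1/20)^3" using \<rho> by (intro power_mono) auto
    then have r3: "\<rho>^3 \<le> 125/1000000" by (simp add: power3_eq_cube)
    have c1: "y\<^sup>2 / H \<le> 302/100 * y"
    proof -
      have "y * y \<le> (1508/1000 * (2 * H)) * y" using y y1 Npos by (intro mult_right_mono) auto
      also have "\<dots> \<le> 302/100 * y * H" using y Hpos by simp
      finally show ?thesis using Hpos by (simp add: power2_eq_square pos_divide_le_eq)
    qed
    have c2: "(1 + 2 * U) * y \<le> 186/100 * y" using U y by (intro mult_right_mono) auto
    have c3: "b \<le> 1/1000" using b r3 by linarith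
    have "2/5 * (U + H - y\<^sup>2 + 2 * ((1 + 2 * U) * y) + b) + y\<^sup>2 / H \<le> 1724/10000 + 681/100 * N"
    proof -
      have "2/5 * (X + 2 * A + b) + B \<le> 1724/10000 + 681/100 * N"
        if "B \<le> 302/100 * y" "A \<le> 186/100 * y" "b \<le> 1/1000" "X < 43/100" "y \<le> 1508/1000 * N" "0 < N"
        for X A B
        using that by (simp add: field_simps)
      then show ?thesis using c1 c2 c3 next_left y1 Npos(1) by blast
    qed
    then have "L \<le> 125/1000000 * (1724/10000 + 681/100 * N)"
      unfolding L_def using r3 \<rho> Npos by (intro mult_mono') (use U y b H Hpos in \<open>auto intro!: add_nonneg_nonneg mult_nonneg_nonneg\<close>)
    also have "\<dots> \<le> 3/2 * N * (1172/10000 * N)"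
    proof -
      have "0 \<le> (N - 169/10000) * (N + 1/100)" using N0 by simp
      then show ?thesis using N0 by (simp add: power2_eq_square algebra_simps)
    qed
    also have "\<dots> \<le> p * N * (1172/10000 * N)"
      using p(3)[OF True] Npos by (intro mult_right_mono) auto
    finally show ?thesis
      using small W by (intro Bpos[of "1172/10000"]) auto
  next
    case False
    then have U13: "U \<le> 13/100" by simp
    have "U\<^sup>2 \<le> (13/100)\<^sup>2" "\<rho>\<^sup>2 \<le> (1/20)\<^sup>2" using U U13 \<rho> by (auto intro!: power_mono)
    then have H1: "H \<le> 194/10000" by (simp add: H power2_eq_square)
    have Uy: "2 * U * y \<le> 2 * (13/100) * (1508/1000 * N)"
      using U U13 y y1 by (intro mult_mono) auto
    have "0 \<le> 2/5 * (1 + 2 * U) * (H - y\<^sup>2 + 2 * U * y)"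
      using U y by (intro mult_nonneg_nonneg) auto
    then have "W \<le> 2/5 * (1 + 2 * U) * (H - y\<^sup>2 + 2 * U * y)"
      unfolding W_def using divide_left_mono[OF T1, of "2/5 * (1 + 2 * U) * (H - y\<^sup>2 + 2 * U * y)"] T1
      by simp
    also have "\<dots> \<le> 2/5 * (126/100) * (1393/1000 * N)"
    proof -
      have "H - y\<^sup>2 + 2 * U * y \<le> 1393/1000 * N"
        using Uy Npos zero_le_power2[of y] by linarith
      then show ?thesis using U U13 y by (intro mult_mono) auto
    qed
    finally have W: "W \<le> 7021/10000 * N" using Npos by simp
    have low: "2/5 * (\<rho>^3 * U) \<le> 15/100 * p * N\<^sup>2 - 36/1000 * H\<^sup>2"
    proof -
      have "\<rho>^3 * U \<le> \<rho> * U * H"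
        using mult_left_mono[OF \<rho>H, of "\<rho> * U"] \<rho> U
        by (simp add: power3_eq_cube power2_eq_square mult_ac)
      moreover have "(785/1000 + \<rho> * U / H) * H\<^sup>2 \<le> p * N\<^sup>2"
        using p p0 Npos Hpos by (intro mult_mono power_mono) auto
      moreover have "(785/1000 + \<rho> * U / H) * H\<^sup>2 = 785/1000 * H\<^sup>2 + \<rho> * U * H"
        using Hpos by (simp add: field_simps power2_eq_square)
      ultimately have 1: "\<rho>^3 * U \<le> p * N\<^sup>2 - 785/1000 * H\<^sup>2" by linarith
      have 2: "\<rho>^3 * U \<le> 326/1000 * H\<^sup>2"
      proof -
        have "0 \<le> (U\<^sup>2 - \<rho>\<^sup>2 / 3)\<^sup>2 + \<rho>\<^sup>2 * (8/3 * U\<^sup>2 - 307/100 * U * \<rho> + 8/9 * \<rho>\<^sup>2)"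
          by (intro add_nonneg_nonneg mult_nonneg_nonneg quadratic_nonneg) (simp_all add: power2_eq_square)
        also have "\<dots> = H\<^sup>2 - 307/100 * (\<rho>^3 * U)"
          by (simp add: H power2_eq_square power3_eq_cube field_simps)
        finally show ?thesis using zero_le_power2[of H] by linarith
      qed
      show ?thesis using 1 2 zero_le_power2[of H] by linarith
    qed
    have "L = 2/5 * (\<rho>^3 * U) + \<rho>^3 * (2/5 * (H - y\<^sup>2)) + \<rho>^3 * (4/5 * ((1 + 2 * U) * y))
        + \<rho>^3 * (2/5 * b) + \<rho>^3 * (y\<^sup>2 / H)"
      unfolding L_def by (simp add: field_simps)
    moreover have "\<rho>^3 * (2/5 * (H - y\<^sup>2)) \<le> 1/20 * H * (2/5 * H)"
      using \<rho>3 y Hpos \<rho> by (intro mult_mono) auto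
    moreover have "\<rho>^3 * (4/5 * ((1 + 2 * U) * y)) \<le> 1/20 * N * (4/5 * (126/100 * (96/100 * p * N)))"
      using \<rho>3 y yp U U13 Npos p0 \<rho> by (intro mult_mono) auto
    moreover have "\<rho>^3 * (2/5 * b) \<le> 1/20 * H * (2/5 * (95/100 * (1/20 * H)))"
      using \<rho>3 b b' Hpos \<rho> by (intro mult_mono) auto
    moreover have "\<rho>^3 * (y\<^sup>2 / H) \<le> 1/20 * (96/100 * p * N)\<^sup>2"
    proof -
      have "\<rho>^3 * (y\<^sup>2 / H) = (\<rho>^3 / H) * y\<^sup>2" by simp
      also have "\<dots> \<le> 1/20 * (96/100 * p * N)\<^sup>2"
        using \<rho>3 y yp Hpos \<rho> by (intro mult_mono power_mono) (auto simp: pos_divide_le_eq)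
      finally show ?thesis .
    qed
    moreover have "(96/100 * p * N)\<^sup>2 \<le> 1448/1000 * p * N\<^sup>2"
    proof -
      have "p * p \<le> 15708/10000 * p" using p p0 by (intro mult_right_mono) auto
      then have "p * p * N\<^sup>2 \<le> 15708/10000 * p * N\<^sup>2" by (rule mult_right_mono) simp
      moreover have "(96/100 * p * N)\<^sup>2 = 9216/10000 * (p * p * N\<^sup>2)"
        by (simp add: power2_eq_square)
      moreover have "0 \<le> p * N\<^sup>2" using p0 by simp
      ultimately show ?thesis by linarith
    qed
    moreover have "1/20 * H * (2/5 * H) = 1/50 * H\<^sup>2"
      "1/20 * N * (4/5 * (126/100 * (96/100 * p * N))) = 48384/1000000 * (p * N\<^sup>2)"
      "1/20 * H * (2/5 * (95/100 * (1/20 * H))) = 95/100000 * H\<^sup>2"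
      by (simp_all add: power2_eq_square)
    ultimately have "L \<le> 2708/10000 * (p * N\<^sup>2)"
      using low zero_le_power2[of H] mult_nonneg_nonneg[OF _ zero_le_power2[of N], of p] p0 by linarith
    also have "\<dots> \<le> 2751/10000 * (p * N\<^sup>2)" using p0 by (intro mult_right_mono) auto
    also have "\<dots> = p * N * (2751/10000 * N)" by (simp add: power2_eq_square)
    finally show ?thesis
      using small W by (intro Bpos[of "2751/10000"]) auto
  qed
qed

text \<open>The height \<open>H + y^2\<close> grows by the factor \<open>1 + 2 u + H + y^2\<close>, slightly more than \<open>y\<close>, up to a
  small correction. This is why \<open>H + y^2\<close> replaces \<open>H\<close> in the invariant once \<open>u > 0\<close>.\<close>

lemma height_step:
  fixes u y \<delta> :: real
  shows "((u + (u\<^sup>2 + \<delta>) - y\<^sup>2)\<^sup>2 + \<delta>) + ((1 + 2 * u) * y)\<^sup>2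
    = (u\<^sup>2 + \<delta> + y\<^sup>2) * (1 + 2 * u + (u\<^sup>2 + \<delta> + y\<^sup>2)) - 4 * \<delta> * y\<^sup>2"
  by (simp add: power2_eq_square algebra_simps)

lemma weighted_step:
  fixes U Y h b :: real
  shows "((1 + 2 * U) * Y + b) * (1 + 2/5 * ((U + h - Y\<^sup>2) + ((1 + 2 * U) * Y + b)))
    = (1 + 2 * U) * (Y * (1 + 2/5 * (U + Y))) + Y * (2/5 * (1 + 2 * U) * (h - Y\<^sup>2 + 2 * U * Y))
      + (b * (2/5 * (U + h - Y\<^sup>2 + 2 * ((1 + 2 * U) * Y) + b)) + b)"
  by (simp add: power2_eq_square field_simps)

locale right_parameter_near_cusp = right_parameter +
  fixes \<rho> :: real
  assumes \<rho>: "0 < \<rho>" "\<rho> \<le> 1/20" "\<rho>\<^sup>2 = \<delta>"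
begin

definition K :: real where "K = b / \<rho>^3"
definition p :: "nat \<Rightarrow> real" where "p n = gate \<rho> (u n) + pi/4"
definition M :: real where "M = 101/100 * K"

lemma K\<rho>: "K * \<rho>^3 = b"
  using \<rho> by (simp add: K_def)

lemma K: "0 \<le> K" "K \<le> 949/1000"
proof -
  show K0: "0 \<le> K" using b \<rho> by (simp add: K_def)
  have "(K * \<rho>^3)\<^sup>2 \<le> 9/10 * \<rho>^6"
    unfolding K\<rho> using b(2) unfolding \<rho>(3)[symmetric] by simp
  then have "K\<^sup>2 * \<rho>^6 \<le> 9/10 * \<rho>^6" by (simp add: power_mult_distrib)
  then have "K\<^sup>2 \<le> 9/10" using \<rho> by simp
  also have "\<dots> \<le> (949/1000)\<^sup>2" by (simp add: power2_eq_square)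
  finally show "K \<le> 949/1000" by (rule power2_le_imp_le) simp
qed

lemma cancel_height: "0 < h \<Longrightarrow> 0 < h' \<Longrightarrow> K * (\<rho>^3 * d / (h * h')) * h' = b * d / h"
  by (simp add: mult.assoc[symmetric] K\<rho>)

lemma b_le: "b \<le> 949/1000 * \<rho>^3"
  using mult_right_mono[OF K(2), of "\<rho>^3"] \<rho> by (simp add: K\<rho>)

lemma \<delta>_small: "\<delta> \<le> 1/400"
  using power_mono[of \<rho> "1/20" 2] \<rho> by (simp add: power2_eq_square)

lemma \<rho>3: "\<rho>^3 \<le> 1/20 * \<delta>"
  using \<rho> unfolding \<rho>(3)[symmetric] by (simp add: power3_eq_cube power2_eq_square)

lemma p_bounds: "0 \<le> p n" "p n \<le> 15708/10000" "u n \<le> 0 \<Longrightarrow> p n \<le> 7854/10000"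
  using gate_ge[OF \<rho>(1), of "u n"] gate_le[OF \<rho>(1), of "u n"] gate_mono[OF \<rho>(1), of "u n" 0] pi_approx
  by (auto simp: p_def)

lemma p_step:
  assumes "u n \<le> u (Suc n)"
  shows "p n + \<rho>^3 * (u (Suc n) - u n) / (H n * H (Suc n)) \<le> p (Suc n)"
  using gate_step[OF \<rho>(1) assms] by (simp add: p_def H_def \<rho>(3))

text \<open>To the left of the gate the invariant is \<open>y \<le> K p H\<close>, which is exactly what the slow-motion
  equation predicts. There \<open>p\<close> is at most \<open>\<pi>/4\<close>, and \<open>u\<close> keeps increasing because \<open>y^2\<close> is much
  smaller than \<open>H\<close>.\<close>

lemma entering:
  assumes u: "-1/2 \<le> u n" "u n \<le> 0" and y: "0 \<le> y n" "y n \<le> K * p n * H n"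
  shows "8/10 * H n \<le> H n - (y n)\<^sup>2" "0 \<le> y (Suc n)" "y (Suc n) \<le> K * p (Suc n) * H (Suc n)" "u (Suc n) \<le> \<delta>"
proof -
  have H1: "H n \<le> 1/4 + \<delta>"
    using power_mono[of "- u n" "1/2" 2] u by (simp add: H_def power2_eq_square)
  have "K * p n \<le> 949/1000 * (7854/10000)" using K p_bounds u by (intro mult_mono) auto
  then have "K * p n * H n \<le> 949/1000 * (7854/10000) * H n"
    using H_pos[of n] by (intro mult_right_mono) auto
  with y(2) have "y n \<le> 949/1000 * (7854/10000) * H n" by linarith
  then have yH: "y n \<le> 746/1000 * H n" using H_pos[of n] by simp
  have "(y n)\<^sup>2 \<le> (746/1000 * H n)\<^sup>2" using y yH by (intro power_mono) auto
  also have "\<dots> = (746/1000)\<^sup>2 * H n * H n" by (simp add: power2_eq_square)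
  also have "\<dots> \<le> (746/1000)\<^sup>2 * (1/4 + 1/400) * H n"
    using H1 \<delta>_small H_pos[of n] by (intro mult_right_mono mult_left_mono) auto
  finally have y2: "(y n)\<^sup>2 \<le> 141/1000 * H n" using H_pos[of n] by (simp add: power2_eq_square)
  then show gap: "8/10 * H n \<le> H n - (y n)\<^sup>2" using H_pos[of n] by simp
  have "0 \<le> (1 + 2 * u n) * y n" using u y by simp
  then show "0 \<le> y (Suc n)" using b by (simp add: y_Suc)
  have "u n * (1 + u n) \<le> 0" using u by (simp add: mult_nonpos_nonneg)
  then show "u (Suc n) \<le> \<delta>"
    using zero_le_power2[of "y n"] unfolding u_Suc H_def power2_eq_square distrib_left by linarith
  have up: "u n \<le> u (Suc n)" using gap H_pos[of n] by (simp add: u_Suc)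
  have "K * (p n + \<rho>^3 * (u (Suc n) - u n) / (H n * H (Suc n))) * H (Suc n) \<le> K * p (Suc n) * H (Suc n)"
    using p_step[OF up] K H_pos[of "Suc n"] by (intro mult_right_mono mult_left_mono) auto
  moreover have "K * (p n + \<rho>^3 * (u (Suc n) - u n) / (H n * H (Suc n))) * H (Suc n)
      = K * p n * H (Suc n) + b * (H n - (y n)\<^sup>2) / H n"
    using cancel_height[OF H_pos[of n] H_pos[of "Suc n"], of "H n - (y n)\<^sup>2"]
    unfolding distrib_left distrib_right u_Suc by simp
  moreover have "y n * (1 + 2 * u n + H n - 2 * (y n)\<^sup>2) \<le> K * p n * H (Suc n)"
  proof -
    have "H (Suc n) = H n * (1 + 2 * u n + H n - 2 * (y n)\<^sup>2) - 2 * u n * (y n)\<^sup>2 + (y n)^4"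
      by (simp add: H_def u_Suc power2_eq_square power4_eq_xxxx algebra_simps)
    moreover have "0 \<le> - u n * (y n)\<^sup>2" "0 \<le> (y n)^4" using u by (simp_all add: mult_nonpos_nonneg)
    ultimately have "H n * (1 + 2 * u n + H n - 2 * (y n)\<^sup>2) \<le> H (Suc n)" by linarith
    then have "K * p n * (H n * (1 + 2 * u n + H n - 2 * (y n)\<^sup>2)) \<le> K * p n * H (Suc n)"
      using K p_bounds by (intro mult_left_mono) auto
    moreover have "y n * (1 + 2 * u n + H n - 2 * (y n)\<^sup>2) \<le> K * p n * H n * (1 + 2 * u n + H n - 2 * (y n)\<^sup>2)"
      using y u y2 H_pos[of n] by (intro mult_right_mono) auto
    ultimately show ?thesis by (simp add: mult.assoc)
  qed
  moreover have "b * (y n)\<^sup>2 / H n \<le> y n * (H n - 2 * (y n)\<^sup>2)"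
  proof -
    have "b \<le> 949/1000 * (1/20 * \<delta>)" using b_le \<rho>3 by linarith
    also have "\<dots> \<le> 1/20 * H n" using \<delta> by (simp add: H_def)
    finally have "b * y n \<le> 1/20 * H n * (746/1000 * H n)" using yH y b H_pos[of n] by (intro mult_mono) auto
    then have "b * y n / H n \<le> 1/20 * (746/1000 * H n)"
      using H_pos[of n] by (simp add: pos_divide_le_eq)
    also have "\<dots> \<le> H n - 2 * (y n)\<^sup>2" using y2 H_pos[of n] by linarith
    finally have "y n * (b * y n / H n) \<le> y n * (H n - 2 * (y n)\<^sup>2)" using y by (intro mult_left_mono)
    then show ?thesis by (simp add: power2_eq_square mult_ac)
  qed
  moreover have "b * (H n - (y n)\<^sup>2) / H n = b - b * (y n)\<^sup>2 / H n"
    using H_pos[of n] by (simp add: field_simps)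
  moreover have "y (Suc n) = y n * (1 + 2 * u n + H n - 2 * (y n)\<^sup>2) - y n * (H n - 2 * (y n)\<^sup>2) + b"
    by (simp add: y_Suc algebra_simps)
  ultimately show "y (Suc n) \<le> K * p (Suc n) * H (Suc n)" by linarith
qed

text \<open>The invariant to the right of the gate. The constant \<open>M\<close> exceeds \<open>K\<close> by one percent in order
  to accommodate the weight at the moment of entering.\<close>

definition inside :: "nat \<Rightarrow> bool" where
  "inside n \<longleftrightarrow> 0 < u n \<and> 0 \<le> y n \<and> (y n)\<^sup>2 \<le> H n \<and>
     y n * (1 + 2/5 * (u n + y n)) \<le> M * p n * (H n + (y n)\<^sup>2)"

lemma M: "0 \<le> M" "M \<le> 96/100" "K \<le> M"
  using K by (simp_all add: M_def)

lemma entered: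
  assumes "-1/2 \<le> u n" "u n \<le> 0" "0 \<le> y n" "y n \<le> K * p n * H n" "0 < u (Suc n)"
  shows "inside (Suc n)"
proof -
  let ?u = "u (Suc n)" and ?y = "y (Suc n)" and ?H = "H (Suc n)"
  note e = entering[OF assms(1-4)]
  have "?u\<^sup>2 \<le> \<delta>\<^sup>2" using e assms by (intro power_mono) auto
  also have "\<delta>\<^sup>2 \<le> 1/400 * \<delta>" using \<delta> \<delta>_small by (simp add: power2_eq_square)
  finally have H: "?H \<le> 401/400 * \<delta>" by (simp add: H_def)
  have "K * p (Suc n) \<le> 949/1000 * (15708/10000)" using K p_bounds by (intro mult_mono) auto
  then have "K * p (Suc n) * ?H \<le> 949/1000 * (15708/10000) * (401/400 * \<delta>)"
    using H H_pos[of "Suc n"] K p_bounds by (intro mult_mono) auto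
  then have y: "?y \<le> 15/10 * \<delta>" using e(3) \<delta> by linarith
  have T: "1 + 2/5 * (?u + ?y) \<le> 101/100" using e(4) y \<delta>_small by simp
  have "?y * (1 + 2/5 * (?u + ?y)) \<le> ?y * (101/100)" using T e(2) by (intro mult_left_mono)
  also have "\<dots> \<le> M * p (Suc n) * ?H" using e(3) by (simp add: M_def)
  also have "\<dots> \<le> M * p (Suc n) * (?H + ?y\<^sup>2)" using M p_bounds by (intro mult_left_mono) auto
  finally have inv: "?y * (1 + 2/5 * (?u + ?y)) \<le> M * p (Suc n) * (?H + ?y\<^sup>2)" .
  have "?y\<^sup>2 \<le> (15/10 * \<delta>)\<^sup>2" using y e by (intro power_mono) auto
  also have "\<dots> = 225/100 * \<delta> * \<delta>" by (simp add: power2_eq_square)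
  also have "\<dots> \<le> 225/100 * (1/400) * \<delta>" using \<delta> \<delta>_small by (intro mult_right_mono mult_left_mono) auto
  also have "\<dots> \<le> ?H" using \<delta> zero_le_power2[of ?u] unfolding H_def by linarith
  finally show ?thesis using inv e assms by (simp add: inside_def)
qed

text \<open>The growth of \<open>y\<close> is balanced by that of \<open>H + y^2\<close> and of \<open>p\<close>. That the point is not turned
  back is then a consequence of the invariant at the new point, since \<open>M p\<close> is at most \<open>1508/1000\<close>.\<close>

lemma inside_step:
  assumes "inside n"
  shows "inside (Suc n)"
proof -
  define U Y h N T where "U = u n" "Y = y n" "h = H n" "N = H n + (y n)\<^sup>2" "T = 1 + 2/5 * (u n + y n)"
  note defs = this
  let ?u = "u (Suc n)" and ?y = "y (Suc n)" and ?H = "H (Suc n)" and ?p = "p (Suc n)"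
  have i: "0 < U" "0 \<le> Y" "Y\<^sup>2 \<le> h" "Y * T \<le> M * p n * N"
    using assms by (auto simp: inside_def defs)
  have hpos: "0 < h" "0 < ?H" by (simp_all add: defs H_pos)
  have Npos: "0 < N" using hpos by (simp add: defs add_pos_nonneg)
  have Tpos: "1 \<le> T" using i by (simp add: defs)
  have y': "?y = (1 + 2 * U) * Y + b" and u': "?u = U + h - Y\<^sup>2" by (simp_all add: defs y_Suc u_Suc)
  have up: "u n \<le> ?u" using i by (simp add: u_Suc defs)
  have Y': "0 \<le> (1 + 2 * U) * Y" using i by simp
  have y0: "0 \<le> ?y" using Y' b by (simp add: y')
  have left: "U < 43/100" "U + h - Y\<^sup>2 < 43/100"
    using stays_left[of n] stays_left[OF y0] i by (simp_all add: u' defs)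
  have Bb: "b \<le> 95/100 * \<rho>^3" using b_le \<rho>(1) zero_less_power[of \<rho> 3] by linarith
  have p1: "785/1000 + \<rho> * U / h \<le> p n"
    using gate_step[OF \<rho>(1), of 0 U] i \<rho> pi_approx
    by (simp add: p_def defs H_def power2_eq_square power3_eq_cube)
  have p3: "3/2 \<le> p n" if "13/100 \<le> U"
    using gate_ge_right[OF \<rho>(1,2) that] pi_approx by (simp add: p_def defs)
  define E where "E = 2/5 * (U + h - Y\<^sup>2 + 2 * ((1 + 2 * U) * Y) + b) + Y\<^sup>2 / h"
  define G where "G = N - 4 * \<rho>\<^sup>2 * Y\<^sup>2 / N - 2/5 * (1 + 2 * U) * (h - Y\<^sup>2 + 2 * U * Y) / T"
  have absorb: "\<rho>^3 * E \<le> p n * N * G"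
    unfolding E_def G_def
    by (rule gate_absorbs_weight[where M = M])
      (use i left \<rho> M p1 p3 p_bounds(2)[of n] b Bb in \<open>auto simp: defs H_def\<close>)
  have E0: "0 \<le> E" unfolding E_def using i b Y' hpos by (intro add_nonneg_nonneg mult_nonneg_nonneg) auto
  have bE: "b * E \<le> M * p n * N * G"
  proof -
    have "b * E = K * (\<rho>^3 * E)" by (simp add: mult.assoc[symmetric] K\<rho>)
    also have "\<dots> \<le> M * (\<rho>^3 * E)" using M \<rho> E0 by (intro mult_right_mono) auto
    also have "\<dots> \<le> M * (p n * N * G)" using absorb M by (intro mult_left_mono)
    finally show ?thesis by (simp add: mult.assoc)
  qed
  define Nh where "Nh = N * (1 + 2 * U + N) - 4 * \<rho>\<^sup>2 * Y\<^sup>2"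
  have Nh: "?H + ((1 + 2 * U) * Y)\<^sup>2 = Nh"
    unfolding Nh_def \<rho>(3) defs H_def u_Suc by (rule height_step)
  have "((1 + 2 * U) * Y)\<^sup>2 \<le> ?y\<^sup>2" unfolding y' using Y' b by (intro power_mono) auto
  then have N': "Nh \<le> ?H + ?y\<^sup>2" using Nh by linarith
  have inv: "?y * (1 + 2/5 * (?u + ?y)) \<le> M * ?p * (?H + ?y\<^sup>2)"
  proof -
    have step: "p n + \<rho>^3 * (h - Y\<^sup>2) / (h * ?H) \<le> ?p"
      using p_step[OF up] by (simp add: u' defs)
    have "M * p n * Nh + b * (1 - Y\<^sup>2 / h) \<le> M * ?p * (?H + ?y\<^sup>2)"
    proof -
      have nn: "0 \<le> M * (\<rho>^3 * (h - Y\<^sup>2) / (h * ?H))" using M \<rho> i hpos by simp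
      have "b * (1 - Y\<^sup>2 / h) = K * (\<rho>^3 * (h - Y\<^sup>2) / (h * ?H)) * ?H"
        unfolding cancel_height[OF hpos] using hpos by (simp add: diff_divide_distrib right_diff_distrib)
      also have "\<dots> \<le> M * (\<rho>^3 * (h - Y\<^sup>2) / (h * ?H)) * ?H"
        using M \<rho> i hpos by (intro mult_right_mono) auto
      also have "\<dots> \<le> M * (\<rho>^3 * (h - Y\<^sup>2) / (h * ?H)) * (?H + ?y\<^sup>2)"
        using nn by (intro mult_left_mono) auto
      finally have 1: "b * (1 - Y\<^sup>2 / h) \<le> M * (\<rho>^3 * (h - Y\<^sup>2) / (h * ?H)) * (?H + ?y\<^sup>2)" .
      have 2: "M * p n * Nh \<le> M * p n * (?H + ?y\<^sup>2)"
        using N' M p_bounds by (intro mult_left_mono) auto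
      have "M * (p n + \<rho>^3 * (h - Y\<^sup>2) / (h * ?H)) * (?H + ?y\<^sup>2) \<le> M * ?p * (?H + ?y\<^sup>2)"
        using step M hpos by (intro mult_right_mono mult_left_mono) auto
      with 1 2 show ?thesis unfolding distrib_left distrib_right by linarith
    qed
    moreover have "?y * (1 + 2/5 * (?u + ?y)) \<le> M * p n * Nh + b * (1 - Y\<^sup>2 / h)"
    proof -
      define Q where "Q = 2/5 * (1 + 2 * U) * (h - Y\<^sup>2 + 2 * U * Y)"
      have Q: "0 \<le> Q" unfolding Q_def using i by (intro mult_nonneg_nonneg) auto
      have "?y * (1 + 2/5 * (?u + ?y)) = (1 + 2 * U) * (Y * T) + Y * Q + b * E + b * (1 - Y\<^sup>2 / h)"
      proof -
        have T: "T = 1 + 2/5 * (U + Y)" by (simp add: defs)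
        have "b * E + b * (1 - Y\<^sup>2 / h) = b * (2/5 * (U + h - Y\<^sup>2 + 2 * ((1 + 2 * U) * Y) + b)) + b"
          unfolding E_def distrib_left right_diff_distrib by simp
        moreover have "?y * (1 + 2/5 * (?u + ?y)) = (1 + 2 * U) * (Y * T) + Y * Q
            + (b * (2/5 * (U + h - Y\<^sup>2 + 2 * ((1 + 2 * U) * Y) + b)) + b)"
          unfolding y' u' Q_def T by (rule weighted_step)
        ultimately show ?thesis by linarith
      qed
      also have "Y * Q = (Y * T) * (Q / T)" using Tpos by simp
      also have "(1 + 2 * U) * (Y * T) + (Y * T) * (Q / T) + b * E + b * (1 - Y\<^sup>2 / h)
          \<le> (1 + 2 * U) * (M * p n * N) + (M * p n * N) * (Q / T) + M * p n * N * G + b * (1 - Y\<^sup>2 / h)"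
      proof -
        have "(1 + 2 * U) * (Y * T) \<le> (1 + 2 * U) * (M * p n * N)"
          using i by (intro mult_left_mono) auto
        moreover have "(Y * T) * (Q / T) \<le> (M * p n * N) * (Q / T)"
          using i Q Tpos by (intro mult_right_mono) auto
        ultimately show ?thesis using bE by (intro add_mono order_refl)
      qed
      also have "\<dots> = M * p n * (N * (1 + 2 * U + N) - N * (4 * \<rho>\<^sup>2 * Y\<^sup>2 / N)) + b * (1 - Y\<^sup>2 / h)"
      proof -
        have "(1 + 2 * U) * (X * N) + (X * N) * W + X * N * (N - Z - W) = X * (N * (1 + 2 * U + N) - N * Z)"
          for X Z W by (simp add: algebra_simps)
        then show ?thesis unfolding G_def Q_def by (simp only:)
      qed
      also have "N * (4 * \<rho>\<^sup>2 * Y\<^sup>2 / N) = 4 * \<rho>\<^sup>2 * Y\<^sup>2" using Npos by simp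
      finally show ?thesis by (simp add: Nh_def)
    qed
    ultimately show ?thesis by linarith
  qed
  have "?y\<^sup>2 \<le> ?H"
  proof (rule ccontr)
    assume "\<not> ?y\<^sup>2 \<le> ?H"
    then have turn: "?H \<le> ?y\<^sup>2" by simp
    define q where "q = sqrt ?H"
    have q: "0 < q" "q\<^sup>2 = ?u\<^sup>2 + \<delta>" "q\<^sup>2 = ?H" using hpos by (simp_all add: q_def H_def)
    have U': "0 \<le> ?u" using up i by (simp add: defs)
    have "q \<le> ?y" using turn y0 by (simp add: q_def real_le_lsqrt)
    moreover have "?y \<le> (1 + 2 * ?u) * q + 1/400 * q"
    proof -
      have "h \<le> ?H" using up i unfolding defs H_def by (simp add: power_mono)
      then have "Y\<^sup>2 \<le> q\<^sup>2" using i(3) unfolding q(3) by simp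
      then have "Y \<le> q" using q(1) by (intro power2_le_imp_le[of Y q]) auto
      then have "(1 + 2 * U) * Y \<le> (1 + 2 * ?u) * q"
        using i(1,2) up by (intro mult_mono) (auto simp: defs)
      moreover have "b \<le> 1/400 * q"
      proof -
        have "\<rho>\<^sup>2 \<le> q\<^sup>2" unfolding \<rho>(3) q(2) by simp
        then have "\<rho> \<le> q" using q(1) by (intro power2_le_imp_le[of \<rho> q]) auto
        then have "\<rho>\<^sup>2 * \<rho> \<le> 1/400 * q" using \<delta>_small \<rho> by (intro mult_mono) auto
        moreover have "b \<le> 1 * \<rho>^3" using b_le \<rho>(1) zero_less_power[of \<rho> 3] by linarith
        ultimately show ?thesis by (simp add: power3_eq_cube power2_eq_square)
      qed
      ultimately show ?thesis by (simp add: y')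
    qed
    moreover note turning_bound[OF U' y0 turn, folded q(3)]
    ultimately have "1508/1000 * (q\<^sup>2 + ?y\<^sup>2) < ?y * (1 + 2/5 * (?u + ?y))"
      by (intro not_turning[OF U' stays_left[OF y0] q(1,2) \<delta>(1) \<delta>_small])
    also have "\<dots> \<le> M * ?p * (q\<^sup>2 + ?y\<^sup>2)" using inv unfolding q(3) .
    also have "\<dots> \<le> 96/100 * (15708/10000) * (q\<^sup>2 + ?y\<^sup>2)"
      using M p_bounds by (intro mult_right_mono mult_mono) auto
    finally have "1508/1000 * (q\<^sup>2 + ?y\<^sup>2) < 96/100 * (15708/10000) * (q\<^sup>2 + ?y\<^sup>2)" .
    moreover have "0 \<le> q\<^sup>2 + ?y\<^sup>2" by simp
    ultimately show False by (simp add: mult_less_cancel_right)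
  qed
  then show ?thesis
    using inv y0 i up by (simp add: inside_def defs)
qed

text \<open>The orbit starts at \<open>u = -1/2\<close>, moves right until \<open>u > 0\<close>, and from then on \<open>u\<close> never decreases,
  which is impossible for a bounded orbit.\<close>

theorem contradiction: False
proof -
  have "\<exists>n. 0 < u n"
  proof (rule ccontr)
    assume "\<not> (\<exists>n. 0 < u n)"
    then have neg: "u n \<le> 0" for n by (simp add: not_less)
    have inv: "-1/2 + 8/10 * \<delta> * n \<le> u n \<and> 0 \<le> y n \<and> y n \<le> K * p n * H n" for n
    proof (induction n)
      case 0
      then show ?case using start K p_bounds H_pos[of 0] by (simp add: less_imp_le)
    next
      case (Suc n)
      have "0 \<le> 8/10 * \<delta> * n" using \<delta> by simp
      then have "-1/2 \<le> u n" using Suc by linarith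
      then have e: "8/10 * H n \<le> H n - (y n)\<^sup>2" "0 \<le> y (Suc n)" "y (Suc n) \<le> K * p (Suc n) * H (Suc n)"
        using entering[of n] neg[of n] Suc by auto
      have "8/10 * \<delta> * real (Suc n) = 8/10 * \<delta> * n + 8/10 * \<delta>" by (simp add: field_simps)
      moreover have "\<delta> \<le> H n" by (simp add: H_def)
      ultimately have "-1/2 + 8/10 * \<delta> * real (Suc n) \<le> u (Suc n)"
        using e(1) Suc unfolding u_Suc by linarith
      then show ?case using e by simp
    qed
    obtain n :: nat where "1 < 8/10 * \<delta> * n"
      using ex_less_of_nat_mult[of "8/10 * \<delta>" 1] \<delta> by (auto simp: mult.commute)
    then show False using inv[of n] neg[of n] by linarith
  qed
  then obtain k where k: "0 < u k" "\<And>n. n < k \<Longrightarrow> u n \<le> 0"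
    unfolding exists_least_iff[of "\<lambda>n. 0 < u n"] not_less by blast
  have inv: "n < k \<Longrightarrow> -1/2 \<le> u n \<and> 0 \<le> y n \<and> y n \<le> K * p n * H n" for n
  proof (induction n)
    case 0
    then show ?case using start K p_bounds H_pos[of 0] by (simp add: less_imp_le)
  next
    case (Suc n)
    then show ?case using entering[of n] k(2)[of n] H_pos[of n] by (simp add: u_Suc)
  qed
  obtain j where j: "k = Suc j" using k(1) start by (cases k) auto
  have "inside k"
    using entered[of j] inv[of j] k j by simp
  have ins: "inside n" if "k \<le> n" for n
    using that by (induction n rule: dec_induct) (use \<open>inside k\<close> in \<open>auto intro: inside_step\<close>)
  show False
    by (rule turns_eventually[of k]) (use k ins in \<open>auto simp: inside_def\<close>)
qed

end

section \<open>Parameters near the left end\<close>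

text \<open>The level sets are the ellipses with foci \<open>0\<close> and \<open>2\<close>. For \<open>\<beta> = 2\<close> the map \<open>x \<mapsto> \<beta> x (2 - x)\<close> sends
  each of them into another one.\<close>

definition excess :: "complex \<Rightarrow> real" where
  "excess x = cmod x + cmod (2 - x) - 2"

lemma excess_nonneg: "0 \<le> excess x"
  using norm_triangle_ineq[of x "2 - x"] by (simp add: excess_def)

text \<open>Since \<open>2 - x' - \<gamma> = \<beta> (1 - x)^2\<close> and \<open>x' = \<beta> x (2 - x)\<close>, the parallelogram law applied to \<open>x\<close> and
  \<open>2 - x\<close> expresses \<open>|x'| + |2 - x' - \<gamma>|\<close> by the excess of \<open>x\<close>.\<close>

lemma excess_step:
  fixes x \<beta> \<gamma> :: complex
  assumes \<beta>: "\<beta> = 2 - \<gamma>" and x': "x' = \<beta> * x * (2 - x)"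
  shows "excess x' = cmod \<beta> * (2 * excess x + (excess x)\<^sup>2 / 2) - (2 - cmod \<beta>)
    + (cmod (2 - x') - cmod (2 - x' - \<gamma>))"
proof -
  have "(cmod x)\<^sup>2 + (cmod (2 - x))\<^sup>2 = 2 + 2 * (cmod (1 - x))\<^sup>2"
    unfolding cmod_power2 by (simp add: power2_eq_square algebra_simps)
  then have "(excess x + 2)\<^sup>2 = 2 + 2 * (cmod (1 - x))\<^sup>2 + 2 * (cmod x * cmod (2 - x))"
    by (simp add: excess_def power2_eq_square algebra_simps)
  then have "cmod \<beta> * (excess x + 2)\<^sup>2 = 2 * cmod \<beta> + 2 * (cmod \<beta> * (cmod (1 - x))\<^sup>2) + 2 * (cmod \<beta> * cmod x * cmod (2 - x))"
    by (simp add: algebra_simps)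
  moreover have "cmod \<beta> * (cmod (1 - x))\<^sup>2 = cmod (2 - x' - \<gamma>)"
  proof -
    have "2 - x' - \<gamma> = \<beta> * (1 - x)\<^sup>2"
      by (simp add: x' \<beta> power2_eq_square algebra_simps)
    then show ?thesis by (simp add: norm_mult norm_power)
  qed
  moreover have "cmod \<beta> * cmod x * cmod (2 - x) = cmod x'"
    by (simp add: x' norm_mult)
  ultimately have "cmod \<beta> * (excess x + 2)\<^sup>2 = 2 * cmod \<beta> + 2 * cmod (2 - x' - \<gamma>) + 2 * cmod x'"
    by simp
  moreover have "cmod \<beta> * (excess x + 2)\<^sup>2 = 2 * (cmod \<beta> * (2 * excess x + (excess x)\<^sup>2 / 2)) + 4 * cmod \<beta>"
    by (simp add: power2_eq_square algebra_simps)
  ultimately show ?thesis by (simp add: excess_def)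
qed

lemma excess_ge:
  assumes "0 < cmod x" "\<bar>Re x\<bar> \<le> cmod x"
  shows "(Im x)\<^sup>2 / (2 * cmod x) \<le> excess x"
proof -
  have "(Im x)\<^sup>2 = (cmod x - Re x) * (cmod x + Re x)"
    by (simp add: cmod_power2 power2_eq_square[symmetric] algebra_simps flip: power2_eq_square)
  also have "\<dots> \<le> (cmod x - Re x) * (2 * cmod x)"
    using assms by (intro mult_left_mono) auto
  finally have "(Im x)\<^sup>2 / (2 * cmod x) \<le> cmod x - Re x"
    using assms by (simp add: pos_divide_le_eq)
  moreover have "2 - Re x \<le> cmod (2 - x)" using complex_Re_le_cmod[of "2 - x"] by simp
  ultimately show ?thesis by (simp add: excess_def)
qed

text \<open>Projecting \<open>w\<close> on the direction of \<open>z - w\<close>, whose slope is at most \<open>T\<close>, bounds the change of the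
  norm from below.\<close>

lemma norm_shift_ge:
  fixes z w :: complex
  assumes R: "0 < Re z - Re w" and T: "\<bar>Im z - Im w\<bar> \<le> T * (Re z - Re w)" "0 \<le> T" and w: "0 \<le> Re w"
  shows "Re w - (\<bar>Im w\<bar> * T + Re w * T\<^sup>2 / 2) \<le> cmod z - cmod (z - w)"
proof -
  define v where "v = z - w"
  define r where "r = cmod v"
  have v: "0 < Re v" "\<bar>Im v\<bar> \<le> T * Re v" using assms by (simp_all add: v_def)
  have r: "Re v \<le> r" unfolding r_def by (rule complex_Re_le_cmod)
  with v(1) have r0: "0 < r" by simp
  note r = r r0
  have r2: "r\<^sup>2 = (Re v)\<^sup>2 + (Im v)\<^sup>2" by (simp add: r_def cmod_power2)
  have "(r + (Re w * Re v + Im w * Im v) / r)\<^sup>2 \<le> (cmod z)\<^sup>2"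
  proof -
    define d where "d = (Re w * Re v + Im w * Im v) / r"
    have dr: "d * r = Re w * Re v + Im w * Im v" using r by (simp add: d_def)
    have "(d * r)\<^sup>2 \<le> (cmod w)\<^sup>2 * r\<^sup>2"
      using zero_le_power2[of "Re w * Im v - Im w * Re v"] unfolding dr r2 cmod_power2
      by (simp add: power2_eq_square algebra_simps)
    then have "d\<^sup>2 \<le> (cmod w)\<^sup>2" using r by (simp add: power_mult_distrib)
    moreover have "(cmod z)\<^sup>2 = r\<^sup>2 + 2 * (d * r) + (cmod w)\<^sup>2"
      unfolding dr r2 cmod_power2 by (simp add: v_def power2_eq_square algebra_simps)
    ultimately show ?thesis unfolding d_def[symmetric] by (simp add: power2_eq_square algebra_simps)
  qed
  then have "r + (Re w * Re v + Im w * Im v) / r \<le> cmod z"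
    by (rule power2_le_imp_le) simp
  moreover have "Re w * (1 - T\<^sup>2 / 2) - \<bar>Im w\<bar> * T \<le> (Re w * Re v + Im w * Im v) / r"
  proof -
    have "r\<^sup>2 \<le> (Re v * (1 + T\<^sup>2 / 2))\<^sup>2"
    proof -
      have "(Im v)\<^sup>2 \<le> (T * Re v)\<^sup>2" 
        using power_mono[OF v(2) abs_ge_zero, of 2] by simp
      then have "r\<^sup>2 \<le> (Re v)\<^sup>2 * (1 + T\<^sup>2)" unfolding r2 by (simp add: power_mult_distrib algebra_simps)
      also have "\<dots> \<le> (Re v)\<^sup>2 * (1 + T\<^sup>2 / 2)\<^sup>2"
      proof (rule mult_left_mono)
        have "(1 + T\<^sup>2 / 2)\<^sup>2 = 1 + T\<^sup>2 + (T\<^sup>2 / 2)\<^sup>2" by (simp add: power2_eq_square field_simps)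
        then show "1 + T\<^sup>2 \<le> (1 + T\<^sup>2 / 2)\<^sup>2" using zero_le_power2[of "T\<^sup>2 / 2"] by linarith
      qed simp
      finally show ?thesis unfolding power_mult_distrib .
    qed
    moreover have "0 \<le> Re v * (1 + T\<^sup>2 / 2)"
      by (intro mult_nonneg_nonneg add_nonneg_nonneg divide_nonneg_nonneg zero_le_power2) (use v(1) in simp_all)
    ultimately have r_le: "r \<le> Re v * (1 + T\<^sup>2 / 2)" by (rule power2_le_imp_le)
    have "(1 - T\<^sup>2 / 2) * r \<le> Re v"
    proof (cases "0 \<le> 1 - T\<^sup>2 / 2")
      case True
      have gen: "(1 - X) * (Y * (1 + X)) = Y - Y * X\<^sup>2" for X Y :: real
        by (simp add: power2_eq_square algebra_simps)
      from True have "(1 - T\<^sup>2 / 2) * r \<le> (1 - T\<^sup>2 / 2) * (Re v * (1 + T\<^sup>2 / 2))" by (intro mult_left_mono r_le)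
      also have "\<dots> = Re v - Re v * (T\<^sup>2 / 2)\<^sup>2"
        using gen[of "T\<^sup>2 / 2" "Re v"] .
      also have "\<dots> \<le> Re v"
        using mult_nonneg_nonneg[OF less_imp_le[OF v(1)] zero_le_power2[of "T\<^sup>2 / 2"]] by linarith
      finally show ?thesis .
    next
      case False
      then have "(1 - T\<^sup>2 / 2) * r \<le> 0" using r0 by (intro mult_nonpos_nonneg) linarith+
      then show ?thesis using v(1) by linarith
    qed
    then have 1: "Re w * ((1 - T\<^sup>2 / 2) * r) \<le> Re w * Re v" by (intro mult_left_mono w)
    have "\<bar>Im w\<bar> * \<bar>Im v\<bar> \<le> \<bar>Im w\<bar> * (T * r)"

      using v(2) mult_left_mono[OF r(1) T(2)] by (intro mult_left_mono) linarith+
    moreover have "- (\<bar>Im w\<bar> * \<bar>Im v\<bar>) \<le> Im w * Im v" 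
      using abs_ge_minus_self[of "Im w * Im v"] unfolding abs_mult by linarith
    moreover define X where "X = 1 - T\<^sup>2 / 2"
    have "(Re w * X - \<bar>Im w\<bar> * T) * r = Re w * (X * r) - \<bar>Im w\<bar> * (T * r)"
      by (simp add: algebra_simps)
    ultimately have "(Re w * X - \<bar>Im w\<bar> * T) * r \<le> Re w * Re v + Im w * Im v"
      using 1[folded X_def] by linarith
    then show ?thesis unfolding X_def[symmetric] pos_le_divide_eq[OF r0] .
  qed
  moreover have "Re w * (1 - T\<^sup>2 / 2) - \<bar>Im w\<bar> * T = Re w - (\<bar>Im w\<bar> * T + Re w * T\<^sup>2 / 2)"
    by (simp add: right_diff_distrib)
  ultimately have "Re w - (\<bar>Im w\<bar> * T + Re w * T\<^sup>2 / 2) \<le> cmod z - r" by linarith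
  then show ?thesis unfolding r_def v_def .
qed

text \<open>Near the fixed point \<open>0\<close> the orbit stays in the cone spanned by the direction of \<open>\<gamma> = e + i m\<close>. The
  rotation by the multiplier \<open>2 \<beta>\<close> tends to move \<open>x\<close> out of the cone, but the quadratic term compresses arguments
  by more as soon as \<open>x\<close> is larger than \<open>e (1 + t^2)\<close>.\<close>

lemma cone_step:
  fixes x :: complex
  assumes e: "0 < e" "e \<le> 1/50" and m: "0 \<le> m" "m = t * e" and t: "0 \<le> t" "t \<le> 1"
    and x: "\<bar>Im x\<bar> \<le> t * Re x" "e * (1 + t\<^sup>2) \<le> Re x" "Re x \<le> 1"
    and x': "x' = Complex (2 - e) (- m) * x * (2 - x)"
  shows "0 < Re x'" "\<bar>Im x'\<bar> \<le> t * Re x'"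
proof -
  define p q where "p = Re x" "q = Im x"
  note pq = this
  define P Q where "P = p * (2 - p) + q\<^sup>2" "Q = 2 * q * (1 - p)"
  note PQ = this
  have re: "Re x' = (2 - e) * P + m * Q" and im: "Im x' = (2 - e) * Q - m * P"
    by (simp_all add: x' pq PQ power2_eq_square algebra_simps)
  have "0 < e * (1 + t\<^sup>2)" using e by (simp add: add_pos_nonneg)
  then have p: "0 < p" "p \<le> 1" "e * (1 + t\<^sup>2) \<le> p" "\<bar>q\<bar> \<le> t * p" using x by (simp_all add: pq)
  define R where "R = 2 * t * p * (1 - p)"
  have R0: "0 \<le> R" using p t by (simp add: R_def)
  have absQ: "\<bar>Q\<bar> \<le> R"
  proof -
    have "\<bar>Q\<bar> = 2 * (1 - p) * \<bar>q\<bar>" using p by (simp add: PQ abs_mult)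
    also have "\<dots> \<le> 2 * (1 - p) * (t * p)" using p by (intro mult_left_mono) auto
    finally show ?thesis by (simp add: R_def mult_ac)
  qed
  have P: "p * (2 - p) \<le> P" by (simp add: PQ)
  have mQ: "- (m * R) \<le> m * Q" "m * Q \<le> m * R"
    using mult_left_mono[of Q R m] mult_left_mono[of "- R" Q m] absQ m by auto
  have gap: "(2 - e) * R + m * P \<le> t * ((2 - e) * P - m * R)"
  proof -
    have "0 \<le> 2 * t * p * (p - e - t\<^sup>2 * e * (1 - p))"
    proof -
      have "t\<^sup>2 * e * (1 - p) \<le> t\<^sup>2 * e" using e p by (simp add: mult_left_le)
      then have "0 \<le> p - e - t\<^sup>2 * e * (1 - p)" using p(3) by (simp add: algebra_simps)
      then show ?thesis using t p by simp
    qed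
    also have "\<dots> = t * ((2 - 2 * e) * (p * (2 - p)) - m * R) - (2 - e) * R"
      unfolding R_def m(2) by (simp add: power2_eq_square algebra_simps)
    also have "\<dots> \<le> t * ((2 - 2 * e) * P - m * R) - (2 - e) * R"
      using P t e by (intro diff_right_mono mult_left_mono) auto
    finally show ?thesis unfolding m(2) by (simp add: algebra_simps)
  qed
  have pos: "m * R < (2 - e) * P"
  proof -
    have "m \<le> 1/50" using m t e mult_mono[of t 1 e "1/50"] by simp
    then have "m * R \<le> 1/50 * (2 * 1 * p * 1)"
      unfolding R_def using m t p by (intro mult_mono) auto
    also have "\<dots> < (2 - e) * (p * (2 - p))"
    proof -
      have "1 * (p * 1) \<le> (2 - e) * (p * (2 - p))" using e p by (intro mult_mono) auto
      then show ?thesis using p by linarith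
    qed
    also have "\<dots> \<le> (2 - e) * P" using P e by (intro mult_left_mono) auto
    finally show ?thesis .
  qed
  show "0 < Re x'" using pos mQ unfolding re by linarith
  have "t * ((2 - e) * P - m * R) \<le> t * Re x'" unfolding re using mQ t by (intro mult_left_mono) auto
  moreover have "0 \<le> m * P"
    using mult_nonneg_nonneg[of p "2 - p"] P p by (intro mult_nonneg_nonneg m(1)) linarith
  moreover have "- ((2 - e) * R) \<le> (2 - e) * Q" "(2 - e) * Q \<le> (2 - e) * R"
    using mult_left_mono[of Q R "2 - e"] mult_left_mono[of "- R" Q "2 - e"] absQ e by auto
  ultimately show "\<bar>Im x'\<bar> \<le> t * Re x'" using gap unfolding im by linarith
qed

text \<open>The parameter is \<open>\<beta> - \<beta>^2\<close>, where \<open>\<beta> = 2 - e - i m\<close> is the repelling fixed point. In the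
  coordinate \<open>x\<close> with \<open>z = \<beta> (1 - x)\<close>, the orbit starts at \<open>1\<close> and comes close to the fixed point \<open>0\<close> in
  two steps.\<close>

locale left_parameter =
  fixes e m :: real
  assumes e: "0 < e" "e \<le> 1/50" and m: "0 \<le> m"
    and mand: "Complex (2 - e) (- m) - (Complex (2 - e) (- m))\<^sup>2 \<in> mandelbrot"
begin

definition \<beta> :: complex where "\<beta> = Complex (2 - e) (- m)"
definition \<gamma> :: complex where "\<gamma> = Complex e m"
definition t :: real where "t = m / e"
definition x :: "nat \<Rightarrow> complex" where "x n = 1 - orbit (\<beta> - \<beta>\<^sup>2) n / \<beta>"
definition a :: "nat \<Rightarrow> real" where "a n = cmod (x n)"
definition s :: "nat \<Rightarrow> real" where "s n = excess (x n)"

lemma m_eq: "m = t * e" and t0: "0 \<le> t"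
  using e m by (simp_all add: t_def)

lemma \<beta>\<gamma>: "\<beta> = 2 - \<gamma>"
  by (simp add: \<beta>_def \<gamma>_def complex_eq_iff)

lemma \<beta>0: "\<beta> \<noteq> 0"
  using e by (simp add: \<beta>_def complex_eq_iff)

lemma x_Suc: "x (Suc n) = \<beta> * x n * (2 - x n)"
  using \<beta>0 by (simp add: x_def field_simps power2_eq_square)

lemma x_2: "x 2 = \<beta>\<^sup>2 * \<gamma>"
proof -
  have "x 0 = 1" by (simp add: x_def)
  then have "x (Suc (Suc 0)) = \<beta>\<^sup>2 * (2 - \<beta>)" unfolding x_Suc by (simp add: power2_eq_square)
  then show ?thesis using \<beta>\<gamma> by (simp add: numeral_2_eq_2)
qed

lemma a_Suc: "a (Suc n) = cmod \<beta> * a n * (2 + s n - a n)"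
  by (simp add: a_def s_def x_Suc norm_mult excess_def)

lemma s_nonneg: "0 \<le> s n"
  by (simp add: s_def excess_nonneg)

lemma \<beta>_ge: "2 - e \<le> cmod \<beta>"
  using complex_Re_le_cmod[of \<beta>] by (simp add: \<beta>_def)

lemma \<gamma>_sq: "(cmod \<gamma>)\<^sup>2 = e\<^sup>2 + m\<^sup>2"
  by (simp add: \<gamma>_def cmod_power2)

lemma \<gamma>_ge: "e \<le> cmod \<gamma>" "m \<le> cmod \<gamma>"
  using complex_Re_le_cmod[of \<gamma>] abs_Im_le_cmod[of \<gamma>] by (simp_all add: \<gamma>_def)

lemma s_step: "s (Suc n) = cmod \<beta> * (2 * s n + (s n)\<^sup>2 / 2) - (2 - cmod \<beta>)
    + (cmod (2 - x (Suc n)) - cmod (2 - x (Suc n) - \<gamma>))"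
  unfolding s_def by (rule excess_step[OF \<beta>\<gamma> x_Suc])

text \<open>The excess is multiplied by at least \<open>4 - 2 e\<close> and loses at most \<open>e + |\<gamma>|\<close> in each step.\<close>

lemma s_bound: "s n \<le> (e + cmod \<gamma>) / (3 - 2 * e)"
proof -
  define L where "L = (e + cmod \<gamma>) / (3 - 2 * e)"
  have L: "L * (3 - 2 * e) = e + cmod \<gamma>" using e by (simp add: L_def)
  have "0 \<le> L" using e by (simp add: L_def)
  show "s n \<le> L"
  proof (rule expanding_from_below[where q = "4 - 2 * e" and K = 6])
    fix k assume "L < s k"
    have "- cmod \<gamma> \<le> cmod (2 - x (Suc k)) - cmod (2 - x (Suc k) - \<gamma>)"
      using norm_triangle_ineq4[of "2 - x (Suc k)" \<gamma>] by linarith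
    moreover have "(2 - e) * (2 * s k) \<le> cmod \<beta> * (2 * s k + (s k)\<^sup>2 / 2)"
      using \<beta>_ge s_nonneg[of k] e by (intro mult_mono) auto
    ultimately have "(2 - e) * (2 * s k) - e - cmod \<gamma> \<le> s (Suc k)"
      unfolding s_step using \<beta>_ge by linarith
    then show "(4 - 2 * e) * (s k - L) \<le> s (Suc k) - L"
      using L by (simp add: algebra_simps)
  next
    fix k
    have "cmod (orbit (\<beta> - \<beta>\<^sup>2) k) \<le> 2"
      using mand by (intro mandelbrot_orbit_le_2) (simp add: \<beta>_def)
    also have "2 \<le> 2 * cmod \<beta>" using \<beta>_ge e by simp
    finally have "cmod (orbit (\<beta> - \<beta>\<^sup>2) k / \<beta>) \<le> 2"
      using \<beta>0 by (simp add: norm_divide pos_divide_le_eq)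
    then have "cmod (x k) \<le> 3"
      unfolding x_def using norm_triangle_ineq4[of 1 "orbit (\<beta> - \<beta>\<^sup>2) k / \<beta>"] by simp
    moreover have "cmod (2 - x k) \<le> 2 + cmod (x k)" using norm_triangle_ineq4[of 2 "x k"] by simp
    ultimately show "s k \<le> 6" by (simp add: s_def excess_def)
  qed (use e in auto)
qed

text \<open>From \<open>|c| \<le> 2\<close> alone.\<close>

lemma crude: "m\<^sup>2 \<le> 31/10 * e"
proof -
  have "cmod (\<beta> - \<beta>\<^sup>2) \<le> 2"
    using mand by (intro mandelbrot_norm_le_2) (simp add: \<beta>_def)
  moreover have "\<beta> - \<beta>\<^sup>2 = \<beta> * (1 - \<beta>)" by (simp add: power2_eq_square algebra_simps)
  ultimately have "cmod \<beta> * cmod (1 - \<beta>) \<le> 2" by (simp add: norm_mult)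
  moreover have "(2 - e) * cmod (1 - \<beta>) \<le> cmod \<beta> * cmod (1 - \<beta>)"
    using \<beta>_ge by (intro mult_right_mono) auto
  ultimately have "(2 - e) * cmod (1 - \<beta>) \<le> 2" by linarith
  then have "((2 - e) * cmod (1 - \<beta>))\<^sup>2 \<le> 2\<^sup>2" using e by (intro power_mono) auto
  then have "(2 - e)\<^sup>2 * ((1 - e)\<^sup>2 + m\<^sup>2) \<le> 4"
    by (simp add: power_mult_distrib cmod_power2 \<beta>_def power2_commute[of e 1])
  moreover have "(2 - e)\<^sup>2 * (1 - e)\<^sup>2 = (2 - 3 * e + e\<^sup>2)\<^sup>2"
    by (simp add: power2_eq_square algebra_simps)
  moreover have "(2 - 3 * e)\<^sup>2 \<le> (2 - 3 * e + e\<^sup>2)\<^sup>2" using e by (intro power_mono) auto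
  moreover have "392/100 * m\<^sup>2 \<le> (2 - e)\<^sup>2 * m\<^sup>2"
    using power_mono[of "198/100" "2 - e" 2] e by (intro mult_right_mono) (auto simp: power2_eq_square)
  moreover have "4 - 12 * e \<le> (2 - 3 * e)\<^sup>2" by (simp add: power2_eq_square algebra_simps)
  ultimately have "392/100 * m\<^sup>2 \<le> 12 * e" unfolding distrib_left by linarith
  then show ?thesis using e by linarith
qed

lemma \<beta>_le: "cmod \<beta> \<le> 2"
proof -
  have "e * e \<le> 1/50 * e" using e by (intro mult_right_mono) auto
  moreover have "(cmod \<beta>)\<^sup>2 = (2 - e)\<^sup>2 + m\<^sup>2"
    by (simp add: \<beta>_def cmod_power2)
  moreover have "(2 - e)\<^sup>2 = 4 - 4 * e + e * e" by (simp add: power2_eq_square algebra_simps)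
  ultimately have "(cmod \<beta>)\<^sup>2 \<le> 4" using crude e by linarith
  then have "(cmod \<beta>)\<^sup>2 \<le> 2\<^sup>2" by simp
  then show ?thesis by (rule power2_le_imp_le) simp
qed

lemma a_le: "a (Suc n) \<le> 2 * a n * (2 + s n - a n)"
proof -
  have "0 \<le> a n * (2 + s n - a n)" by (simp add: a_def s_def excess_def)
  then show ?thesis unfolding a_Suc using mult_right_mono[OF \<beta>_le] by (simp add: mult.assoc)
qed

lemma a_2: "39204/10000 * cmod \<gamma> \<le> a 2" "a 2 \<le> 4 * cmod \<gamma>"
proof -
  have eq: "a 2 = (cmod \<beta>)\<^sup>2 * cmod \<gamma>" by (simp add: a_def x_2 norm_mult norm_power)
  have "(198/100)\<^sup>2 \<le> (cmod \<beta>)\<^sup>2" "(cmod \<beta>)\<^sup>2 \<le> 2\<^sup>2"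
    using power_mono[of "198/100" "cmod \<beta>" 2] power_mono[OF \<beta>_le, of 2] \<beta>_ge e by simp_all
  then show "39204/10000 * cmod \<gamma> \<le> a 2" "a 2 \<le> 4 * cmod \<gamma>"
    unfolding eq using mult_right_mono[of "39204/10000" "(cmod \<beta>)\<^sup>2" "cmod \<gamma>"]
      mult_right_mono[of "(cmod \<beta>)\<^sup>2" 4 "cmod \<gamma>"] by (simp_all add: power_divide)
qed

lemma Re_x_2: "Re (x 2) = 4 * e - 4 * (e\<^sup>2 - m\<^sup>2) + e^3 - 3 * e * m\<^sup>2"
  and Im_x_2: "Im (x 2) = m * (4 - 8 * e + 3 * e\<^sup>2 - m\<^sup>2)"
  by (simp_all add: x_2 \<beta>_def \<gamma>_def power2_eq_square power3_eq_cube algebra_simps)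

lemma s_ge: "a n - Re (x n) \<le> s n"
  using complex_Re_le_cmod[of "2 - x n"] by (simp add: s_def a_def excess_def)

lemma s_crude: "s n \<le> (e + cmod \<gamma>) / (296/100)"
proof -
  have "(e + cmod \<gamma>) / (3 - 2 * e) \<le> (e + cmod \<gamma>) / (296/100)"
    using e \<gamma>_ge by (intro divide_left_mono) auto
  then show ?thesis using s_bound[of n] by linarith
qed

text \<open>At time 2 the excess is at least \<open>|x| - Re x\<close>, which is about \<open>4 (|\<gamma>| - e)\<close>. The bound on the excess
  therefore limits the slope of \<open>\<gamma>\<close>; the estimate is applied twice because the first application
  uses only the crude bound on \<open>m\<close>.\<close>

lemma \<gamma>_le: "cmod \<gamma> \<le> 126/100 * e"
proof -
  define g where "g = cmod \<gamma>"
  have g: "e \<le> g" "m \<le> g" using \<gamma>_ge by (simp_all add: g_def)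
  have "e\<^sup>2 * e \<le> e\<^sup>2 * 4" using e by (intro mult_left_mono) auto
  then have "e^3 \<le> 4 * e\<^sup>2" by (simp add: power2_eq_square power3_eq_cube)
  moreover have "0 \<le> 3 * e * m\<^sup>2" using e by simp
  ultimately have "Re (x 2) \<le> 4 * e + 4 * m\<^sup>2"
    unfolding Re_x_2 right_diff_distrib by linarith
  moreover have "s 2 \<le> (e + g) / (296/100)" unfolding g_def by (rule s_crude)
  ultimately have main: "39204/10000 * g - 4 * e - 4 * m\<^sup>2 \<le> (e + g) / (296/100)"
    using s_ge[of 2] a_2 unfolding g_def by linarith
  have step: "g \<le> k * e" if "m \<le> c" "0 \<le> c" "43379/10000 \<le> k * (35825/10000 - 4 * c)" "4 * c < 35" "0 < 35825/10000 - 4 * c" for c k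
  proof -
    have "m\<^sup>2 \<le> c * g" unfolding power2_eq_square using that g m by (intro mult_mono) auto
    then have "g * (35825/10000 - 4 * c) \<le> 43379/10000 * e"
      using main g e by (simp add: field_simps)
    also have "\<dots> \<le> k * (35825/10000 - 4 * c) * e" using that e by (intro mult_right_mono) auto
    finally have "g * (35825/10000 - 4 * c) \<le> (k * e) * (35825/10000 - 4 * c)" by (simp add: mult_ac)
    then show ?thesis using that by simp
  qed
  have "m\<^sup>2 \<le> (1/4)\<^sup>2" using crude e by (simp add: power2_eq_square)
  then have "m \<le> 1/4" by (rule power2_le_imp_le) simp
  then have "g \<le> 168/100 * e" by (rule step) simp_all
  then have "m \<le> 34/1000" using g e by linarith
  then have "g \<le> 126/100 * e" by (rule step) simp_all
  then show ?thesis by (simp add: g_def)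
qed

end

context left_parameter begin

text \<open>The auxiliary \<open>Y\<close> bounds \<open>(Re x' + e)/(2 - Re x' - e)\<close>, and \<open>t Y\<close> bounds the slope of the vector from
  \<open>x' + \<gamma>\<close> to \<open>2\<close>.\<close>

lemma s_growth:
  assumes n: "0 < Re (x (Suc n))" "\<bar>Im (x (Suc n))\<bar> \<le> t * Re (x (Suc n))"
    and v: "a (Suc n) + e \<le> v" "v < 2" "v \<le> Y * (2 - v)"
  shows "cmod \<beta> * (2 * s n + (s n)\<^sup>2 / 2) - e * t\<^sup>2 * (Y + Y\<^sup>2 / 2) \<le> s (Suc n)"
proof -
  define p q where "p = Re (x (Suc n))" and "q = Im (x (Suc n))"
  have pq: "0 < p" "\<bar>q\<bar> \<le> t * p" using n by (simp_all add: p_def q_def)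
  have p: "p + e \<le> v" using complex_Re_le_cmod[of "x (Suc n)"] v(1) by (simp add: p_def a_def)
  have "0 < Y * (2 - v)" using p pq e v(3) by linarith
  then have Y: "0 < Y" using v(2) by (simp add: zero_less_mult_iff)
  have "Y * (2 - v) \<le> Y * (2 - p - e)" using Y p by (intro mult_left_mono) auto
  then have pe: "p + e \<le> Y * (2 - p - e)" using p v(3) by linarith
  have "\<bar>- q - m\<bar> \<le> t * p + m" using pq m by linarith
  also have "\<dots> = t * (p + e)" by (simp add: distrib_left m_eq[symmetric])
  also have "\<dots> \<le> t * (Y * (2 - p - e))" using pe t0 by (intro mult_left_mono) auto
  finally have im: "\<bar>- q - m\<bar> \<le> t * Y * (2 - p - e)" by (simp only: mult.assoc)
  have \<gamma>: "Re \<gamma> = e" "Im \<gamma> = m" by (simp_all add: \<gamma>_def)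
  have "Re \<gamma> - (\<bar>Im \<gamma>\<bar> * (t * Y) + Re \<gamma> * (t * Y)\<^sup>2 / 2)
      \<le> cmod (2 - x (Suc n)) - cmod (2 - x (Suc n) - \<gamma>)"
  proof (rule norm_shift_ge)
    show "0 < Re (2 - x (Suc n)) - Re \<gamma>" using p v(2) by (simp add: \<gamma> p_def)
    show "\<bar>Im (2 - x (Suc n)) - Im \<gamma>\<bar> \<le> t * Y * (Re (2 - x (Suc n)) - Re \<gamma>)"
      using im by (simp add: \<gamma> p_def q_def)
    show "0 \<le> t * Y" using t0 Y by simp
    show "0 \<le> Re \<gamma>" using e by (simp add: \<gamma>)
  qed
  moreover have "(\<tau> * e) * (\<tau> * Y) + e * (\<tau> * Y)\<^sup>2 / 2 = e * \<tau>\<^sup>2 * (Y + Y\<^sup>2 / 2)" for \<tau>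
    by (simp add: power2_eq_square algebra_simps)
  from this[of t] have "\<bar>Im \<gamma>\<bar> * (t * Y) + Re \<gamma> * (t * Y)\<^sup>2 / 2 = e * t\<^sup>2 * (Y + Y\<^sup>2 / 2)"
    unfolding m_eq[symmetric] \<gamma> abs_of_nonneg[OF m] .
  ultimately show ?thesis unfolding s_step using \<beta>_ge \<gamma>(1) by linarith
qed

lemma t_sq: "m\<^sup>2 = e\<^sup>2 * t\<^sup>2" "t\<^sup>2 \<le> 5876/10000" "t \<le> 1" "m\<^sup>2 \<le> 1/1000"
proof -
  have "(t * e)\<^sup>2 = e\<^sup>2 * t\<^sup>2" by (simp add: power_mult_distrib)
  then show eq: "m\<^sup>2 = e\<^sup>2 * t\<^sup>2" unfolding m_eq[symmetric] .
  have "(cmod \<gamma>)\<^sup>2 \<le> (126/100 * e)\<^sup>2" using \<gamma>_le by (intro power_mono) auto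
  then have "e\<^sup>2 * t\<^sup>2 \<le> e\<^sup>2 * (5876/10000)"
    unfolding \<gamma>_sq eq[symmetric] by (simp add: power_mult_distrib power2_eq_square)
  then show t: "t\<^sup>2 \<le> 5876/10000" using e by simp
  then have "t\<^sup>2 \<le> 1\<^sup>2" by simp
  then show "t \<le> 1" by (rule power2_le_imp_le) simp
  have "e\<^sup>2 * t\<^sup>2 \<le> (1/50)\<^sup>2 * 1" using e t by (intro mult_mono power_mono) auto
  then show "m\<^sup>2 \<le> 1/1000" unfolding eq by (simp add: power2_eq_square)
qed

lemma cone_Suc_if:
  assumes "\<bar>Im (x n)\<bar> \<le> t * Re (x n)" "e * (1 + t\<^sup>2) \<le> Re (x n)" "Re (x n) \<le> 1"
  shows "0 < Re (x (Suc n))" "\<bar>Im (x (Suc n))\<bar> \<le> t * Re (x (Suc n))"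
  by (rule cone_step[OF e m m_eq t0 t_sq(3) assms x_Suc[unfolded \<beta>_def]])+

lemma Im_x_2_nonneg: "3839/1000 * m \<le> Im (x 2)"
proof -
  have "3839/1000 \<le> 4 - 8 * e + 3 * e\<^sup>2 - m\<^sup>2" using e t_sq(4) zero_le_power2[of e] by linarith
  then have "3839/1000 * m \<le> (4 - 8 * e + 3 * e\<^sup>2 - m\<^sup>2) * m" using m by (intro mult_right_mono) auto
  then show ?thesis unfolding Im_x_2 by (simp add: mult.commute)
qed

lemma cone_2: "38/10 * e \<le> Re (x 2)" "\<bar>Im (x 2)\<bar> \<le> t * Re (x 2)" "a 2 \<le> 11/100"
proof -
  have e2: "e\<^sup>2 \<le> 1/50 * e" "e^3 \<le> 1/50 * e\<^sup>2" "0 \<le> e^3" and em: "e * m\<^sup>2 \<le> 1/50 * m\<^sup>2"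
    using e mult_right_mono[of e "1/50" e] mult_right_mono[of e "1/50" "e\<^sup>2"] mult_right_mono[of e "1/50" "m\<^sup>2"]
    by (simp_all add: power2_eq_square power3_eq_cube)
  show "38/10 * e \<le> Re (x 2)"
    unfolding Re_x_2 right_diff_distrib mult.assoc[of 3 e] using e2 em e zero_le_power2[of m] by linarith
  have "e * (4 - 8 * e + 3 * e\<^sup>2 - m\<^sup>2) = 4 * e - 8 * e\<^sup>2 + 3 * e^3 - e * m\<^sup>2"
    by (simp add: power2_eq_square power3_eq_cube algebra_simps)
  also have "\<dots> \<le> Re (x 2)"
    unfolding Re_x_2 right_diff_distrib mult.assoc[of 3 e] using e2 em zero_le_power2[of m] zero_le_power2[of e] by linarith
  finally have "t * (e * (4 - 8 * e + 3 * e\<^sup>2 - m\<^sup>2)) \<le> t * Re (x 2)" using t0 by (intro mult_left_mono)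
  moreover have "Im (x 2) = t * (e * (4 - 8 * e + 3 * e\<^sup>2 - m\<^sup>2))" 
    unfolding Im_x_2 by (simp only: mult.assoc[symmetric] m_eq[symmetric])
  ultimately show "\<bar>Im (x 2)\<bar> \<le> t * Re (x 2)" using Im_x_2_nonneg m by linarith
  show "a 2 \<le> 11/100" using a_2(2) \<gamma>_le e by linarith
qed

lemma s_2: "(Im (x 2))\<^sup>2 \<le> 2 * a 2 * s 2"
proof -
  have "0 < a 2" using a_2(1) \<gamma>_ge e by linarith
  then show ?thesis
    using excess_ge[of "x 2"] abs_Re_le_cmod[of "x 2"] by (simp add: a_def s_def pos_divide_le_eq mult_ac)
qed

text \<open>For a steep \<open>\<gamma>\<close>, the excess at time 2 is already so large that the one at time 3 violates its upper
  bound.\<close>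

lemma t_small: "t < 35/100"
proof (rule ccontr)
  define g where "g = cmod \<gamma>"
  have g: "e \<le> g" "g \<le> 126/100 * e" using \<gamma>_ge \<gamma>_le by (simp_all add: g_def)
  assume "\<not> t < 35/100"
  then have "(35/100)\<^sup>2 \<le> t\<^sup>2" by (intro power_mono) auto
  then have "1225/10000 \<le> t\<^sup>2" by (simp add: power_divide)
  then have "e\<^sup>2 * (1225/10000) \<le> e\<^sup>2 * t\<^sup>2" by (intro mult_left_mono) auto
  moreover have "(10594/10000 * e)\<^sup>2 = 112232836/100000000 * e\<^sup>2" by (simp add: power_mult_distrib power_divide)
  ultimately have "(10594/10000 * e)\<^sup>2 \<le> g\<^sup>2"
    unfolding g_def \<gamma>_sq t_sq(1) using zero_le_power2[of e] by linarith
  then have g_ge: "10594/10000 * e \<le> g" using e g by (intro power2_le_imp_le[of "10594/10000 * e" g]) linarith+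
  have g2: "m\<^sup>2 = (g - e) * (g + e)" using \<gamma>_sq by (simp add: g_def power2_eq_square algebra_simps)
  have s2: "s 2 \<le> 1/50" using s_crude[of 2] g e by (simp add: g_def)
  have Suc2: "Suc 2 = 3" by simp
  have x3: "0 < Re (x 3)" "\<bar>Im (x 3)\<bar> \<le> t * Re (x 3)"
  proof -
    have "e * (1 + t\<^sup>2) \<le> e * (38/10)" using t_sq e by (intro mult_left_mono) auto
    then have "e * (1 + t\<^sup>2) \<le> Re (x 2)" using cone_2 by linarith
    moreover have "Re (x 2) \<le> 1" using complex_Re_le_cmod[of "x 2"] cone_2 by (simp add: a_def)
    ultimately show "0 < Re (x 3)" "\<bar>Im (x 3)\<bar> \<le> t * Re (x 3)"
      using cone_Suc_if[OF cone_2(2)] unfolding Suc2 by blast+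
  qed
  have "a 3 \<le> 2 * a 2 * (2 + s 2 - a 2)" using a_le[of 2] by simp
  also have "\<dots> \<le> 2 * a 2 * (202/100)"
  proof -
    have "0 \<le> a 2" by (simp add: a_def)
    then show ?thesis using s2 by (intro mult_left_mono) auto
  qed
  finally have a3: "a 3 \<le> 404/100 * a 2" by simp
  have "cmod \<beta> * (2 * s 2 + (s 2)\<^sup>2 / 2) - e * t\<^sup>2 * (272/1000 + (272/1000)\<^sup>2 / 2) \<le> s 3"
  proof -
    have "a 3 + e \<le> 4273/10000" using a3 a_2(2) g e unfolding g_def by linarith
    then show ?thesis
      using s_growth[of 2 "4273/10000" "272/1000", unfolded Suc2, OF x3] by simp
  qed
  moreover have "198/100 * (2 * s 2) \<le> cmod \<beta> * (2 * s 2 + (s 2)\<^sup>2 / 2)"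
    using \<beta>_ge s_nonneg[of 2] e by (intro mult_mono) auto
  moreover have "e * t\<^sup>2 * (272/1000 + (272/1000)\<^sup>2 / 2) \<le> e * t\<^sup>2 * (31/100)"
    using e by (intro mult_left_mono) (auto simp: power2_eq_square)
  ultimately have s3: "396/100 * s 2 - 31/100 * (e * t\<^sup>2) \<le> s 3" by linarith
  have "396/100 * (s 2 * g) - 31/100 * (e * t\<^sup>2 * g) \<le> s 3 * g"
    using mult_right_mono[OF s3, of g] g e by (simp add: algebra_simps)
  moreover have "s 3 * g \<le> (e + g) / (296/100) * g"
    using s_crude[of 3] g e by (intro mult_right_mono) (auto simp: g_def)
  moreover have "e * t\<^sup>2 * g \<le> 126/100 * m\<^sup>2"
  proof -
    have "e * t\<^sup>2 * g \<le> e * t\<^sup>2 * (126/100 * e)" using g e by (intro mult_left_mono) auto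
    also have "\<dots> = 126/100 * m\<^sup>2" unfolding t_sq(1) by (simp add: power2_eq_square)
    finally show ?thesis .
  qed
  moreover have "184/100 * m\<^sup>2 \<le> s 2 * g"
  proof -
    have "(3839/1000 * m)\<^sup>2 \<le> (Im (x 2))\<^sup>2" using Im_x_2_nonneg m by (intro power_mono) auto
    moreover have "2 * a 2 * s 2 \<le> 2 * (4 * g) * s 2" using a_2 s_nonneg by (intro mult_right_mono) (auto simp: g_def)
    moreover have "(3839/1000 * m)\<^sup>2 = 14737921/1000000 * m\<^sup>2" by (simp add: power_mult_distrib power_divide)
    moreover have "2 * (4 * g) * s 2 = 8 * (s 2 * g)" by simp
    ultimately show ?thesis using s_2 zero_le_power2[of m] by linarith
  qed
  ultimately have "689/100 * m\<^sup>2 \<le> (e + g) / (296/100) * g" using zero_le_power2[of m] by linarith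
  moreover have "(689/100 * (g - e)) * (g + e) = 689/100 * ((g - e) * (g + e))"
    "(g / (296/100)) * (g + e) = (e + g) / (296/100) * g" by simp_all
  ultimately have "(689/100 * (g - e)) * (g + e) \<le> (g / (296/100)) * (g + e)" unfolding g2 by linarith
  then have "689/100 * (g - e) \<le> g / (296/100)" using g e by (simp add: mult_le_cancel_right)
  then show False using g_ge e by (simp add: right_diff_distrib)
qed

end

text \<open>The inequality \<open>27/10 e < t^2\<close> says \<open>m^2 > 27/10 e^3\<close>: the parameter lies above the curve.\<close>

locale narrow_left_parameter = left_parameter +
  assumes wide: "27/10 * e < t\<^sup>2"
begin

lemma t_sq_le: "t\<^sup>2 \<le> 1225/10000"
  using power_mono[of t "35/100" 2] t_small t0 by (simp add: power2_eq_square)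

lemma \<gamma>_le_narrow: "cmod \<gamma> \<le> 10595/10000 * e"
proof -
  have "e\<^sup>2 * t\<^sup>2 \<le> e\<^sup>2 * (1225/10000)" using t_sq_le by (intro mult_left_mono) auto
  moreover have "(10595/10000 * e)\<^sup>2 = 112254025/100000000 * e\<^sup>2" by (simp add: power_mult_distrib power_divide)
  ultimately have "(cmod \<gamma>)\<^sup>2 \<le> (10595/10000 * e)\<^sup>2"
    unfolding \<gamma>_sq t_sq(1) using zero_le_power2[of e] by linarith
  then show ?thesis by (rule power2_le_imp_le) (use e in simp)
qed

lemma s_le: "s n \<le> 6958/10000 * e"
proof -
  have "(e + cmod \<gamma>) / (296/100) \<le> (e + 10595/10000 * e) / (296/100)"
    using \<gamma>_le_narrow by (intro divide_right_mono) auto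
  also have "\<dots> = 20595/29600 * e" by simp
  finally show ?thesis using s_crude[of n] e by linarith
qed

text \<open>A point in the cone whose excess is at least of the order \<open>t^2 |x|\<close>, the size of \<open>|x| - Re x\<close> on
  the boundary of the cone. The lower bound \<open>38/10 e\<close> separates \<open>x\<close> from the fixed point.\<close>

definition widened :: "nat \<Rightarrow> bool" where
  "widened n \<longleftrightarrow> 0 < Re (x n) \<and> \<bar>Im (x n)\<bar> \<le> t * Re (x n) \<and> 38/10 * e \<le> a n \<and> 42/100 * t\<^sup>2 * a n \<le> s n"

lemma widened_2: "widened 2"
proof -
  define B where "B = (cmod \<beta>)\<^sup>2"
  have "(2 - e)\<^sup>2 = 4 - 4 * e + e\<^sup>2" by (simp add: power2_eq_square algebra_simps)
  moreover have "B = (2 - e)\<^sup>2 + m\<^sup>2" unfolding B_def cmod_power2 by (simp add: \<beta>_def)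
  ultimately have B: "B = 4 - 4 * e + e\<^sup>2 + m\<^sup>2" by linarith
  have B0: "0 \<le> B" by (simp add: B_def)
  have a2: "a 2 = B * cmod \<gamma>" by (simp add: a_def x_2 norm_mult norm_power B_def)
  have "975/1000 * B \<le> 4 - 8 * e + 3 * e\<^sup>2 - m\<^sup>2"
    unfolding B distrib_left right_diff_distrib using e t_sq(4) zero_le_power2[of e] by linarith
  from mult_right_mono[OF this m] have "975/1000 * B * m \<le> Im (x 2)"
    unfolding Im_x_2 mult.commute[of m] .
  then have "(975/1000 * B * m)\<^sup>2 \<le> (Im (x 2))\<^sup>2" using B0 m by (intro power_mono mult_nonneg_nonneg) auto
  moreover have "(975/1000 * B * m)\<^sup>2 = 950625/1000000 * (B\<^sup>2 * m\<^sup>2)" by (simp add: power_mult_distrib power_divide)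
  moreover have "2 * a 2 * s 2 = 2 * (s 2 * a 2)" by simp
  ultimately have 1: "950625/1000000 * (B\<^sup>2 * m\<^sup>2) \<le> 2 * (s 2 * a 2)" using s_2 by linarith
  have "(cmod \<gamma>)\<^sup>2 \<le> (10595/10000 * e)\<^sup>2" using \<gamma>_le_narrow by (intro power_mono) auto
  then have "t\<^sup>2 * B\<^sup>2 * (cmod \<gamma>)\<^sup>2 \<le> t\<^sup>2 * B\<^sup>2 * (10595/10000 * e)\<^sup>2" by (intro mult_left_mono) auto
  also have "\<dots> = 112254025/100000000 * (B\<^sup>2 * m\<^sup>2)" by (simp add: t_sq(1) power_mult_distrib power_divide)
  finally have 2: "t\<^sup>2 * (a 2)\<^sup>2 \<le> 112254025/100000000 * (B\<^sup>2 * m\<^sup>2)" unfolding a2 by (simp add: power_mult_distrib mult_ac)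
  have a2_pos: "0 < a 2" "38/10 * e \<le> a 2" using a_2(1) \<gamma>_ge e by linarith+
  have "0 \<le> B\<^sup>2 * m\<^sup>2" by simp
  then have "42/100 * (t\<^sup>2 * (a 2)\<^sup>2) \<le> s 2 * a 2"
    using 1 2 by linarith
  then have "(42/100 * t\<^sup>2 * a 2) * a 2 \<le> s 2 * a 2" by (simp add: power2_eq_square[of "a 2"] mult_ac)
  then have "42/100 * t\<^sup>2 * a 2 \<le> s 2" using a2_pos by (simp add: mult_le_cancel_right)
  then show ?thesis using cone_2 e a2_pos by (simp add: widened_def)
qed

lemma a_s: "widened n \<Longrightarrow> 1134/1000 * (e * a n) \<le> s n"
proof -
  assume w: "widened n"
  then have "0 \<le> a n" by (simp add: a_def)
  have "1134/1000 * (e * a n) = 42/100 * (27/10 * e) * a n" by simp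
  also have "\<dots> \<le> 42/100 * t\<^sup>2 * a n" using wide \<open>0 \<le> a n\<close> by (intro mult_right_mono mult_left_mono) auto
  also have "\<dots> \<le> s n" using w by (simp add: widened_def)
  finally show ?thesis .
qed

lemma a_le_614: "widened n \<Longrightarrow> a n \<le> 614/1000"
proof -
  assume "widened n"
  then have "e * (1134/1000 * a n) \<le> e * (6958/10000)" using a_s[of n] s_le[of n] by linarith
  then show ?thesis using e by simp
qed

lemma cone_Suc:
  assumes w: "widened n"
  shows "0 < Re (x (Suc n))" "\<bar>Im (x (Suc n))\<bar> \<le> t * Re (x (Suc n))"
proof -
  define p where "p = Re (x n)"
  have p: "0 < p" "\<bar>Im (x n)\<bar> \<le> t * p" "38/10 * e \<le> a n" using w by (simp_all add: widened_def p_def)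
  have "(Im (x n))\<^sup>2 \<le> (t * p)\<^sup>2" using power_mono[OF p(2) abs_ge_zero, of 2] by simp
  moreover have "t\<^sup>2 * p\<^sup>2 \<le> 1225/10000 * p\<^sup>2" using t_sq_le by (intro mult_right_mono) auto
  moreover have "(11/10 * p)\<^sup>2 = 121/100 * p\<^sup>2" "(t * p)\<^sup>2 = t\<^sup>2 * p\<^sup>2"
    by (simp_all add: power_mult_distrib power_divide)
  ultimately have "(a n)\<^sup>2 \<le> (11/10 * p)\<^sup>2"
    unfolding a_def cmod_power2 p_def[symmetric] using zero_le_power2[of p] by linarith
  then have "a n \<le> 11/10 * p" by (rule power2_le_imp_le) (use p in simp)
  moreover have "e * (1 + t\<^sup>2) \<le> e * 2" using t_sq e by (intro mult_left_mono) auto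
  ultimately have "e * (1 + t\<^sup>2) \<le> p" using p e by linarith
  moreover have "p \<le> 1" using complex_Re_le_cmod[of "x n"] a_le_614[OF w] by (simp add: a_def p_def)
  ultimately show "0 < Re (x (Suc n))" "\<bar>Im (x (Suc n))\<bar> \<le> t * Re (x (Suc n))"
    using cone_Suc_if[of n] p(2) unfolding p_def by blast+
qed

lemma a_Suc_le:
  assumes w: "widened n"
  shows "a (Suc n) + e \<le> 403/100 * a n - 2 * (a n)\<^sup>2 + e"
proof -
  have "s n \<le> 15/1000" using s_le[of n] e by linarith
  then have "2 * a n * s n \<le> 2 * a n * (15/1000)" by (intro mult_left_mono) (auto simp: a_def)
  moreover have "2 * a n * (2 + s n - a n) = 4 * a n + 2 * a n * s n - 2 * (a n)\<^sup>2"
    by (simp add: power2_eq_square algebra_simps)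
  ultimately show ?thesis using a_le[of n] by linarith
qed

lemma growth:
  assumes w: "widened n"
    and v: "403/100 * a n - 2 * (a n)\<^sup>2 + e \<le> v" "v < 2" "v \<le> Y * (2 - v)"
  shows "cmod \<beta> * (2 * s n + (s n)\<^sup>2 / 2) - e * t\<^sup>2 * (Y + Y\<^sup>2 / 2) \<le> s (Suc n)"
  using s_growth[of n v Y] cone_Suc[OF w] a_Suc_le[OF w] v by linarith

text \<open>While \<open>a n\<close> is small, the choice \<open>Y = k (a n)\<close> makes the loss proportional to \<open>a n\<close>. The conditions on
  \<open>c\<close>, \<open>k\<close> and \<open>h\<close> say that the quadratic polynomial which decides \<open>v \<le> Y (2 - v)\<close> is nonnegative at \<open>h\<close> and
  decreasing up to \<open>h\<close>.\<close>

lemma growth_linear: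
  assumes w: "widened n" and c: "e \<le> (c - 403/100) * a n" and h: "a n \<le> h" "c * h < 2" "0 \<le> c"
    and k: "0 \<le> k" "0 \<le> 2 * k - c + (2 - k * c) * h + 2 * k * h\<^sup>2" "2 - k * c + 4 * k * h \<le> 0"
  shows "cmod \<beta> * (2 * s n + (s n)\<^sup>2 / 2) - e * t\<^sup>2 * ((k + k\<^sup>2 * h / 2) * a n) \<le> s (Suc n)"
proof -
  have a0: "0 \<le> a n" by (simp add: a_def)
  define v where "v = c * a n - 2 * (a n)\<^sup>2"
  have "c * a n \<le> c * h" using h by (intro mult_left_mono)
  then have v2: "v < 2" using h zero_le_power2[of "a n"] unfolding v_def by linarith
  have "0 \<le> (2 - k * c + 4 * k * h) * (a n - h)" using k h by (intro mult_nonpos_nonpos) auto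
  moreover have "0 \<le> 2 * k * (h - a n)\<^sup>2" using k by simp
  moreover have "2 * k - c + (2 - k * c) * a n + 2 * k * (a n)\<^sup>2 = 2 * k - c + (2 - k * c) * h + 2 * k * h\<^sup>2
      + (2 - k * c + 4 * k * h) * (a n - h) + 2 * k * (h - a n)\<^sup>2"
    by (simp add: power2_eq_square algebra_simps)
  ultimately have "0 \<le> 2 * k - c + (2 - k * c) * a n + 2 * k * (a n)\<^sup>2" using k by linarith
  then have "0 \<le> a n * (2 * k - c + (2 - k * c) * a n + 2 * k * (a n)\<^sup>2)" using a0 by simp
  also have "\<dots> = k * a n * (2 - v) - v" by (simp add: v_def power2_eq_square algebra_simps)
  finally have "v \<le> k * a n * (2 - v)" by simp
  moreover have "403/100 * a n - 2 * (a n)\<^sup>2 + e \<le> v"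
    using c unfolding v_def left_diff_distrib by linarith
  ultimately have *: "cmod \<beta> * (2 * s n + (s n)\<^sup>2 / 2) - e * t\<^sup>2 * (k * a n + (k * a n)\<^sup>2 / 2) \<le> s (Suc n)"
    using growth[OF w _ v2] by simp
  have "k\<^sup>2 * a n * a n \<le> k\<^sup>2 * a n * h" using h a0 by (intro mult_left_mono) auto
  then have "k * a n + (k * a n)\<^sup>2 / 2 \<le> (k + k\<^sup>2 * h / 2) * a n"
    by (simp add: power2_eq_square algebra_simps)
  then have "e * t\<^sup>2 * (k * a n + (k * a n)\<^sup>2 / 2) \<le> e * t\<^sup>2 * ((k + k\<^sup>2 * h / 2) * a n)"
    using e by (intro mult_left_mono) auto
  with * show ?thesis by linarith
qed

text \<open>The lower bound of the excess in terms of \<open>a n\<close> turns the loss into a fraction of the excess. Nearly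
  four times an excess of \<open>\<sigma> e\<close> then exceeds the upper bound that holds at the next step.\<close>

lemma too_large:
  assumes w: "widened n"
    and g: "cmod \<beta> * (2 * s n + (s n)\<^sup>2 / 2) - e * t\<^sup>2 * Z \<le> s (Suc n)"
    and Z: "0 \<le> \<kappa>" "Z \<le> \<kappa> * a n" and \<sigma>: "\<sigma> * e \<le> s n" "6958/10000 < \<sigma> * (396/100 - \<kappa> / 21)" "\<kappa> \<le> 83"
  shows False
proof -
  have "e * t\<^sup>2 * Z \<le> e * t\<^sup>2 * (\<kappa> * a n)" using e Z by (intro mult_left_mono) auto
  also have "\<dots> \<le> 1/50 * t\<^sup>2 * (\<kappa> * a n)" using e Z by (intro mult_right_mono) (auto simp: a_def)
  also have "\<dots> = \<kappa> / 21 * (42/100 * t\<^sup>2 * a n)" by simp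
  also have "\<dots> \<le> \<kappa> / 21 * s n" using w Z by (intro mult_left_mono) (auto simp: widened_def)
  finally have "e * t\<^sup>2 * Z \<le> \<kappa> / 21 * s n" .
  moreover have "198/100 * (2 * s n) \<le> cmod \<beta> * (2 * s n + (s n)\<^sup>2 / 2)"
    using \<beta>_ge s_nonneg[of n] e by (intro mult_mono) auto
  ultimately have "396/100 * s n - \<kappa> / 21 * s n \<le> s (Suc n)" using g by linarith
  moreover define k where "k = 396/100 - \<kappa> / 21"
  ultimately have "k * s n \<le> s (Suc n)" by (simp add: left_diff_distrib)
  moreover have "k * (\<sigma> * e) \<le> k * s n"
    using \<sigma> by (intro mult_left_mono) (auto simp: k_def)
  moreover have "6958/10000 * e < \<sigma> * k * e"
    using \<sigma>(2) e unfolding k_def by (intro mult_strict_right_mono)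
  moreover have "k * (\<sigma> * e) = \<sigma> * k * e" by simp
  ultimately show False using s_le[of "Suc n"] by linarith
qed

text \<open>The case \<open>l \<le> a n \<le> h\<close>, with a constant \<open>Y\<close> that is adapted to the interval.\<close>

lemma not_between:
  assumes w: "widened n" and a: "l \<le> a n" "a n \<le> h" and l: "0 < l" and h: "h \<le> 1"
    and v: "403/100 * h - 2 * h\<^sup>2 + 1/50 = v" "v < 2" "v \<le> Y * (2 - v)"
    and \<kappa>: "Y + Y\<^sup>2 / 2 \<le> \<kappa> * l" "0 \<le> \<kappa>" "\<kappa> \<le> 83"
    and \<sigma>: "\<sigma> * e \<le> s n" "6958/10000 < \<sigma> * (396/100 - \<kappa> / 21)"
  shows False
proof (rule too_large[OF w _ \<kappa>(2) _ \<sigma> \<kappa>(3)])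
  have "0 \<le> (h - a n) * (403/100 - 2 * (h + a n))" using a h by (intro mult_nonneg_nonneg) auto
  also have "\<dots> = 403/100 * h - 403/100 * a n - 2 * h\<^sup>2 + 2 * (a n)\<^sup>2"
    by (simp add: power2_eq_square field_simps)
  finally have "403/100 * a n - 2 * (a n)\<^sup>2 + e \<le> v" using v(1) e by linarith
  then show "cmod \<beta> * (2 * s n + (s n)\<^sup>2 / 2) - e * t\<^sup>2 * (Y + Y\<^sup>2 / 2) \<le> s (Suc n)"
    using v by (intro growth[OF w])
  show "Y + Y\<^sup>2 / 2 \<le> \<kappa> * a n" using \<kappa> a mult_left_mono[of l "a n" \<kappa>] by linarith
qed

lemma near_growth:
  assumes w: "widened n" and a: "a n \<le> 1/10"
  shows "cmod \<beta> * (2 * s n + (s n)\<^sup>2 / 2) - e * t\<^sup>2 * (2938/1000 * a n) \<le> s (Suc n)"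
proof -
  have "e \<le> (43/10 - 403/100) * a n" using w e by (simp add: widened_def)
  then show ?thesis using growth_linear[OF w _ a, of "43/10" "26/10"] by (simp add: power2_eq_square)
qed

text \<open>The possible range of \<open>a n\<close> is cut into pieces on which the loss is bounded by a constant. For \<open>a n\<close>
  up to \<open>1/5\<close>, the assumed lower bound \<open>e/5\<close> of the excess is used, beyond this the stronger one that
  follows from the size of \<open>a n\<close>.\<close>

lemma s_small: "widened n \<Longrightarrow> s n < e / 5"
proof (rule ccontr)
  assume w: "widened n" and "\<not> s n < e / 5"
  then have s: "1/5 * e \<le> s n" by simp
  have \<sigma>: "(1134/1000 * l) * e \<le> s n" if "l \<le> a n" for l
  proof -
    have "e * l \<le> e * a n" using that e by (intro mult_left_mono) auto
    moreover have "(1134/1000 * l) * e = 1134/1000 * (e * l)" by simp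
    ultimately show ?thesis using a_s[OF w] by linarith
  qed
  consider "a n \<le> 1/10" | "1/10 \<le> a n" "a n \<le> 1/5" | "1/5 \<le> a n" "a n \<le> 3/10" | "3/10 \<le> a n" "a n \<le> 2/5"
    | "2/5 \<le> a n" "a n \<le> 1/2" | "1/2 \<le> a n" "a n \<le> 56/100" | "56/100 \<le> a n" "a n \<le> 614/1000"
    using a_le_614[OF w] by linarith
  then show False
  proof cases
    case 1
    show ?thesis
      by (rule too_large[OF w near_growth[OF w 1], where \<kappa> = "2938/1000", OF _ _ s]) simp_all
  next
    case 2
    show ?thesis
      by (rule not_between[OF w 2, where Y = "6/10" and \<kappa> = 8, OF _ _ refl _ _ _ _ _ s]) (simp_all add: power2_eq_square)
  next
    case 3
    show ?thesis
      by (rule not_between[OF w 3, where Y = "112/100" and \<kappa> = 9, OF _ _ refl _ _ _ _ _ \<sigma>[OF 3(1)]]) (simp_all add: power2_eq_square)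
  next
    case 4
    show ?thesis
      by (rule not_between[OF w 4, where Y = "193/100" and \<kappa> = 13, OF _ _ refl _ _ _ _ _ \<sigma>[OF 4(1)]]) (simp_all add: power2_eq_square)
  next
    case 5
    show ?thesis
      by (rule not_between[OF w 5, where Y = "335/100" and \<kappa> = 23, OF _ _ refl _ _ _ _ _ \<sigma>[OF 5(1)]]) (simp_all add: power2_eq_square)
  next
    case 6
    show ?thesis
      by (rule not_between[OF w 6, where Y = "475/100" and \<kappa> = 33, OF _ _ refl _ _ _ _ _ \<sigma>[OF 6(1)]]) (simp_all add: power2_eq_square)
  next
    case 7
    show ?thesis
      by (rule not_between[OF w 7, where Y = "676/100" and \<kappa> = 54, OF _ _ refl _ _ _ _ _ \<sigma>[OF 7(1)]]) (simp_all add: power2_eq_square)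
  qed
qed

text \<open>Having a small excess, the point is close to \<open>0\<close>, so that \<open>a n\<close> grows at least by the
  factor 3. The term \<open>- (a n)^2\<close> in the growth of \<open>a n\<close> leaves enough room for the loss of excess.\<close>

lemma widened_Suc:
  assumes w: "widened n"
  shows "widened (Suc n)" "3 * a n \<le> a (Suc n)"
proof -
  have w': "38/10 * e \<le> a n" "42/100 * t\<^sup>2 * a n \<le> s n" using w by (simp_all add: widened_def)
  have a0: "0 \<le> a n" by (simp add: a_def)
  have "e * (1134/1000 * a n) < e * (1/5)" using a_s[OF w] s_small[OF w] by linarith
  then have a18: "a n \<le> 18/100" using e by simp
  have "(2 - e) * (a n * (2 + s n - a n)) \<le> a (Suc n)"
    unfolding a_Suc mult.assoc using \<beta>_ge a18 s_nonneg[of n] a0 by (intro mult_right_mono mult_nonneg_nonneg) auto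
  moreover have "198/100 * (a n * (182/100)) \<le> (2 - e) * (a n * (2 + s n - a n))"
    using e a18 s_nonneg[of n] a0 by (intro mult_mono mult_nonneg_nonneg) auto
  ultimately show a': "3 * a n \<le> a (Suc n)" using a0 by linarith
  define Z where "Z = (if a n \<le> 1/10 then 2938/1000 * a n else 381/100 * a n)"
  have "cmod \<beta> * (2 * s n + (s n)\<^sup>2 / 2) - e * t\<^sup>2 * Z \<le> s (Suc n)"
  proof (cases "a n \<le> 1/10")
    case True
    then show ?thesis using near_growth[OF w] by (simp add: Z_def)
  next
    case False
    then have "e \<le> (423/100 - 403/100) * a n" using e by simp
    then show ?thesis using growth_linear[OF w _ a18, of "423/100" 3] False by (simp add: Z_def power2_eq_square)
  qed
  moreover have "e * Z \<le> 81/100 * (a n)\<^sup>2"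
  proof (cases "a n \<le> 1/10")
    case True
    have "e * (2938/1000 * a n) \<le> (10/38 * a n) * (2938/1000 * a n)" using w' a0 by (intro mult_right_mono) auto
    also have "\<dots> = 29380/38000 * (a n)\<^sup>2" by (simp add: power2_eq_square)
    also have "\<dots> \<le> 81/100 * (a n)\<^sup>2" by (intro mult_right_mono) auto
    finally show ?thesis using True by (simp add: Z_def)
  next
    case False
    have "e * (381/100 * a n) \<le> (1/5 * a n) * (381/100 * a n)" using False e a0 by (intro mult_right_mono) auto
    also have "\<dots> = 762/1000 * (a n)\<^sup>2" by (simp add: power2_eq_square)
    also have "\<dots> \<le> 81/100 * (a n)\<^sup>2" by (intro mult_right_mono) auto
    finally show ?thesis using False by (simp add: Z_def)
  qed
  then have "t\<^sup>2 * (e * Z) \<le> t\<^sup>2 * (81/100 * (a n)\<^sup>2)" by (intro mult_left_mono) auto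
  moreover have "42/100 * t\<^sup>2 * a (Suc n) + t\<^sup>2 * (81/100 * (a n)\<^sup>2) \<le> cmod \<beta> * (2 * s n + (s n)\<^sup>2 / 2)"
  proof -
    define w where "w = 42/100 * t\<^sup>2 * a n"
    have w0: "0 \<le> w" "w \<le> s n" using a0 w' by (simp_all add: w_def)
    have "w\<^sup>2 \<le> (s n)\<^sup>2" using w0 by (intro power_mono) auto
    then have "w * (2 + s n - a n) + (w * a n - w\<^sup>2 / 2) \<le> 2 * s n + (s n)\<^sup>2 / 2"
    proof -
      have "0 \<le> (s n - w)\<^sup>2" by simp
      then have "w * s n \<le> (w\<^sup>2 + (s n)\<^sup>2) / 2" by (simp add: power2_eq_square algebra_simps)
      then show ?thesis using w0 by (simp add: algebra_simps)
    qed
    then have "cmod \<beta> * (w * (2 + s n - a n) + (w * a n - w\<^sup>2 / 2)) \<le> cmod \<beta> * (2 * s n + (s n)\<^sup>2 / 2)"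
      by (intro mult_left_mono) auto
    moreover have "42/100 * t\<^sup>2 * a (Suc n) = cmod \<beta> * (w * (2 + s n - a n))"
      by (simp add: a_Suc w_def)
    moreover have "t\<^sup>2 * (81/100 * (a n)\<^sup>2) \<le> cmod \<beta> * (w * a n - w\<^sup>2 / 2)"
    proof -
      have "w * a n - w\<^sup>2 / 2 = t\<^sup>2 * (a n)\<^sup>2 * (42/100 - 882/10000 * t\<^sup>2)"
        by (simp add: w_def power2_eq_square algebra_simps)
      also have "t\<^sup>2 * (a n)\<^sup>2 * (4091/10000) \<le> \<dots>" using t_sq_le by (intro mult_left_mono) auto
      finally have "198/100 * (t\<^sup>2 * (a n)\<^sup>2 * (4091/10000)) \<le> cmod \<beta> * (w * a n - w\<^sup>2 / 2)"
        using \<beta>_ge e by (intro mult_mono) auto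
      moreover have "0 \<le> t\<^sup>2 * (a n)\<^sup>2" by simp
      ultimately show ?thesis by linarith
    qed
    ultimately show ?thesis by (simp only: distrib_left)
  qed
  ultimately have "42/100 * t\<^sup>2 * a (Suc n) \<le> s (Suc n)" by (simp add: mult_ac)
  then show "widened (Suc n)" using cone_Suc[OF w] a' w' e by (simp add: widened_def)
qed

text \<open>The excess forces \<open>a n\<close> to stay small, while \<open>a n\<close> grows geometrically.\<close>

theorem contradiction: False
proof -
  have grow: "widened (n + 2) \<and> 3^n * a 2 \<le> a (n + 2)" for n
  proof (induction n)
    case 0
    show ?case using widened_2 by (simp add: numeral_2_eq_2)
  next
    case (Suc n)
    then show ?case using widened_Suc[of "n + 2"] by simp
  qed
  have pos: "0 < a 2" using widened_2 e by (simp add: widened_def)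
  obtain n where "1 / a 2 < 3^n" using real_arch_pow[of 3] by auto
  then have "1 < 3^n * a 2" using pos by (simp add: pos_divide_less_eq)
  then show False using grow[of n] a_le_614[of "n + 2"] by simp
qed

end

lemma left_parameter_below_curve:
  assumes "left_parameter e m"
  shows "10 * m\<^sup>2 \<le> 27 * e^3"
proof (rule ccontr)
  interpret left_parameter e m by fact
  assume "\<not> 10 * m\<^sup>2 \<le> 27 * e^3"
  moreover have "e\<^sup>2 * (27/10 * e) = 27/10 * e^3" by (simp add: power2_eq_square power3_eq_cube)
  ultimately have "e\<^sup>2 * (27/10 * e) < e\<^sup>2 * t\<^sup>2" unfolding t_sq(1)[symmetric] by linarith
  then have "27/10 * e < t\<^sup>2" using e by simp
  then interpret narrow_left_parameter e m by unfold_locales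
  show False by (rule contradiction)
qed

text \<open>With \<open>\<epsilon> = e (3 - e) + m^2\<close> and \<open>b = m (3 - 2 e)\<close>, the bound \<open>10 m^2 \<le> 27 e^3\<close> becomes the
  cuspidal curve, because \<open>3 (3 - 2 e)^2 \<le> (3 - e)^3\<close>.\<close>

theorem near_left_end:
  assumes c: "c \<in> mandelbrot" "0 \<le> Im c" and \<epsilon>: "\<epsilon> = Re c + 2" "\<epsilon> \<le> 119/2000"
  shows "10 * (Im c)\<^sup>2 \<le> 9 * \<epsilon>^3"
proof -
  define \<beta> where "\<beta> = 1/2 + csqrt (1/4 - c)"
  define e m where "e = 2 - Re \<beta>" and "m = - Im \<beta>"
  have \<beta>: "\<beta> = Complex (2 - e) (- m)" by (simp add: e_def m_def complex_eq_iff)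
  have "0 \<le> Re (csqrt (1/4 - c))" using csqrt_principal[of "1/4 - c"] by (auto simp del: csqrt.sel)
  then have e_le: "e \<le> 3/2" by (simp add: e_def \<beta>_def)
  have "\<beta> - \<beta>\<^sup>2 = 1/4 - (csqrt (1/4 - c))\<^sup>2"
    by (simp add: \<beta>_def power2_eq_square field_simps)
  then have c_eq: "c = \<beta> - \<beta>\<^sup>2" by simp
  have b_eq: "Im c = m * (3 - 2 * e)" and \<epsilon>_eq: "\<epsilon> = e * (3 - e) + m\<^sup>2"
    using \<epsilon> by (simp_all add: c_eq \<beta> power2_eq_square algebra_simps)
  have "cmod c \<le> 2" using c(1) by (rule mandelbrot_norm_le_2)
  moreover have "c = \<beta> * (1 - \<beta>)" unfolding c_eq by (simp add: power2_eq_square algebra_simps)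
  ultimately have norm: "cmod \<beta> * cmod (1 - \<beta>) \<le> 2" by (simp add: norm_mult)
  have "m\<^sup>2 * 1 + 4 * 1 \<le> 4" if "e \<le> 0"
  proof -
    have "(cmod \<beta> * cmod (1 - \<beta>))\<^sup>2 \<le> 2\<^sup>2" using norm by (intro power_mono) auto
    then have 1: "((2 - e)\<^sup>2 + m\<^sup>2) * ((1 - e)\<^sup>2 + m\<^sup>2) \<le> 4"
      unfolding power_mult_distrib cmod_power2 by (simp add: \<beta> power2_commute[of e 1])
    have "(4 + m\<^sup>2) * 1 \<le> ((2 - e)\<^sup>2 + m\<^sup>2) * ((1 - e)\<^sup>2 + m\<^sup>2)"
      using power_mono[of 2 "2 - e" 2] one_le_power[of "1 - e" 2] that
      by (intro mult_mono add_mono add_increasing2[OF zero_le_power2]) auto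
    from order_trans[OF this 1] show ?thesis by simp
  qed
  then have m0: "m = 0" if "e \<le> 0" using that zero_le_power2[of m] by simp
  have e0: "0 \<le> e"
  proof (rule ccontr)
    assume "\<not> 0 \<le> e"
    then have "m = 0" "(2 - e) * (1 - e) \<le> 2"
      using m0 norm by (auto simp: \<beta> cmod_def power2_commute[of e 1])
    moreover have "(2 - e) * (1 - e) = 2 + (e\<^sup>2 - 3 * e)" by (simp add: power2_eq_square algebra_simps)
    ultimately show False using \<open>\<not> 0 \<le> e\<close> zero_le_power2[of e] by linarith
  qed
  show ?thesis
  proof (cases "e = 0")
    case True
    then show ?thesis using m0 \<epsilon>_eq b_eq by simp
  next
    case False
    have "e * (3 - e) \<le> 119/2000" using \<epsilon> \<epsilon>_eq zero_le_power2[of m] by linarith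
    then have step: "e * (3 - r) \<le> 119/2000" if "e \<le> r" for r
      using that e0 mult_left_mono[of "3 - r" "3 - e" e] by linarith
    have "e \<le> 1/25" using step[OF e_le] by simp
    from step[OF this] have "e \<le> 202/10000" by simp
    from step[OF this] have e_small: "e \<le> 1/50" by simp
    have "0 \<le> m" using c(2) b_eq e_le e_small by (simp add: zero_le_mult_iff)
    then have "left_parameter e m" using False e0 e_small c(1)[unfolded c_eq \<beta>] by unfold_locales auto
    then have "10 * m\<^sup>2 \<le> 27 * e^3" by (rule left_parameter_below_curve)
    then have "10 * m\<^sup>2 * (3 - 2 * e)\<^sup>2 \<le> 27 * e^3 * (3 - 2 * e)\<^sup>2" by (intro mult_right_mono) auto
    also have "\<dots> \<le> 9 * e^3 * (3 - e)^3"
    proof -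
      have "e * e \<le> e * 1" "e^3 \<le> e * 1"
        using e0 e_small mult_left_mono[of e 1 e] mult_left_mono[of "e * e" 1 e] mult_mono[of e 1 e 1]
        by (auto simp: power3_eq_cube)
      then have "3 * (3 - 2 * e)\<^sup>2 \<le> (3 - e)^3"
        using e0 by (simp add: power2_eq_square power3_eq_cube algebra_simps)
      then have "9 * e^3 * (3 * (3 - 2 * e)\<^sup>2) \<le> 9 * e^3 * (3 - e)^3" using e0 by (intro mult_left_mono) auto
      then show ?thesis by simp
    qed
    also have "\<dots> = 9 * (e * (3 - e))^3" by (simp add: power_mult_distrib)
    also have "\<dots> \<le> 9 * \<epsilon>^3" using \<epsilon>_eq e0 e_small by (intro mult_left_mono power_mono) auto
    finally show ?thesis unfolding b_eq by (simp add: power_mult_distrib mult_ac)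
  qed
qed

section \<open>Reduction to the classical Mandelbrot set\<close>

text \<open>The element \<open>A (1 + j1)/2 + B (1 - j1)/2\<close>; the second coordinate is a multiple of the unit \<open>i2\<close>, and
  \<open>j1 = i1 i2\<close> accounts for the factor \<open>\<i>\<close>.\<close>

definition idempotent_sum :: "complex \<Rightarrow> complex \<Rightarrow> tricomplex" where
  "idempotent_sum A B = Adj (Adj ((A + B) / 2) (\<i> * (A - B) / 2)) 0"

lemma P_idempotent_sum: "P (idempotent_sum A B) (idempotent_sum X Y) = idempotent_sum (X\<^sup>2 + A) (Y\<^sup>2 + B)"
  by (simp add: P_def idempotent_sum_def adj_eq_iff power2_eq_square) (simp add: complex_eq_iff field_simps)

lemma norm_idempotent_sum: "(norm (idempotent_sum A B))\<^sup>2 = ((cmod A)\<^sup>2 + (cmod B)\<^sup>2) / 2"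
proof -
  have "(norm (idempotent_sum A B))\<^sup>2 = (cmod (A + B) / 2)\<^sup>2 + (cmod (A - B) / 2)\<^sup>2"
    by (simp add: idempotent_sum_def norm_adj_def norm_mult norm_divide)
  also have "\<dots> = ((cmod (A + B))\<^sup>2 + (cmod (A - B))\<^sup>2) / 4"
    by (simp add: power_divide add_divide_distrib)
  also have "(cmod (A + B))\<^sup>2 + (cmod (A - B))\<^sup>2 = 2 * ((cmod A)\<^sup>2 + (cmod B)\<^sup>2)"
    unfolding cmod_power2 by (simp add: power2_eq_square algebra_simps)
  finally show ?thesis by simp
qed

lemma idempotent_sum_0: "idempotent_sum 0 0 = 0"
  by (simp add: idempotent_sum_def adj_eq_iff)

lemma orbit_idempotent_sum: "(P (idempotent_sum A B) ^^ n) 0 = idempotent_sum (orbit A n) (orbit B n)"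
  by (induction n) (simp_all add: idempotent_sum_0 P_idempotent_sum orbit_Suc orbit_0)

lemma norm_le_idempotent_sum: "cmod A \<le> 2 * norm (idempotent_sum A B)" "cmod B \<le> 2 * norm (idempotent_sum A B)"
proof -
  have "(2 * norm (idempotent_sum A B))\<^sup>2 = 2 * (cmod A)\<^sup>2 + 2 * (cmod B)\<^sup>2"
    by (simp add: power_mult_distrib norm_idempotent_sum)
  then have le: "(cmod A)\<^sup>2 \<le> (2 * norm (idempotent_sum A B))\<^sup>2" "(cmod B)\<^sup>2 \<le> (2 * norm (idempotent_sum A B))\<^sup>2"
    using zero_le_power2[of "cmod A"] zero_le_power2[of "cmod B"] by linarith+
  show "cmod A \<le> 2 * norm (idempotent_sum A B)" by (rule power2_le_imp_le[OF le(1)]) simp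
  show "cmod B \<le> 2 * norm (idempotent_sum A B)" by (rule power2_le_imp_le[OF le(2)]) simp
qed

lemma bounded_idempotent_sum_iff:
  "bounded (range (\<lambda>n. (P (idempotent_sum A B) ^^ n) 0)) \<longleftrightarrow> A \<in> mandelbrot \<and> B \<in> mandelbrot"
proof
  assume "bounded (range (\<lambda>n. (P (idempotent_sum A B) ^^ n) 0))"
  then obtain K where K: "norm (idempotent_sum (orbit A n) (orbit B n)) \<le> K" for n
    unfolding bounded_iff by (auto simp: orbit_idempotent_sum)
  have "cmod (orbit A n) \<le> 2 * K \<and> cmod (orbit B n) \<le> 2 * K" for n
    using norm_le_idempotent_sum(1)[of "orbit A n" "orbit B n"] norm_le_idempotent_sum(2)[of "orbit B n" "orbit A n"] K[of n]
    by linarith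
  then show "A \<in> mandelbrot \<and> B \<in> mandelbrot"
    unfolding mandelbrot_def by (auto simp: bounded_iff)
next
  assume AB: "A \<in> mandelbrot \<and> B \<in> mandelbrot"
  have "norm (idempotent_sum (orbit A n) (orbit B n)) \<le> 2" for n
  proof (rule power2_le_imp_le)
    have "cmod (orbit A n) \<le> 2" "cmod (orbit B n) \<le> 2" using AB by (auto intro: mandelbrot_orbit_le_2)
    then have "(cmod (orbit A n))\<^sup>2 \<le> 2\<^sup>2" "(cmod (orbit B n))\<^sup>2 \<le> 2\<^sup>2"
      using power_mono[OF _ norm_ge_zero] by blast+
    then show "(norm (idempotent_sum (orbit A n) (orbit B n)))\<^sup>2 \<le> 2\<^sup>2" unfolding norm_idempotent_sum by simp
  qed simp
  then show "bounded (range (\<lambda>n. (P (idempotent_sum A B) ^^ n) 0))"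
    unfolding bounded_iff by (auto simp: orbit_idempotent_sum)
qed

lemma idempotent_sum_M3: "idempotent_sum A B \<in> M3 \<longleftrightarrow> A \<in> mandelbrot \<and> B \<in> mandelbrot"
  unfolding M3_def by (simp add: bounded_idempotent_sum_iff)

lemma coords_idempotent_sum: "a *\<^sub>R 1 + b *\<^sub>R i1 + y *\<^sub>R j1 = idempotent_sum (Complex a b + of_real y) (Complex a b - of_real y)"
  by (simp add: idempotent_sum_def adj_eq_iff complex_eq_iff i1_def i2_def j1_def)

lemma M1_idempotent_sum: "M1 = (\<lambda>z. idempotent_sum z z) ` mandelbrot"
proof -
  have C: "idempotent_sum (Complex a b) (Complex a b) = a *\<^sub>R 1 + b *\<^sub>R i1" for a b
    using coords_idempotent_sum[of a b 0] by (simp add: zero_complex.code[symmetric])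
  have C_i1: "C_i1 = range (\<lambda>z. idempotent_sum z z)"
    unfolding C_i1_def C[symmetric]
  proof (intro subset_antisym subsetI)
    fix v :: tricomplex assume "v \<in> range (\<lambda>z. idempotent_sum z z)"
    then obtain z where "v = idempotent_sum z z" by blast
    then show "v \<in> {idempotent_sum (Complex a b) (Complex a b) | a b. True}" by (cases z) auto
  qed auto
  show ?thesis unfolding M1_def C_i1 by (auto simp: bounded_idempotent_sum_iff)
qed

lemma slice_idempotent_sum:
  "slice 1 i1 j1 = (\<Union>y. (\<lambda>z. idempotent_sum (z + of_real y) (z - of_real y)) ` {z. z + of_real y \<in> mandelbrot \<and> z - of_real y \<in> mandelbrot})"
proof -
  have "span {1, i1, j1} = {v. \<exists>a b y. v = a *\<^sub>R 1 + b *\<^sub>R i1 + y *\<^sub>R j1}"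
    by (auto simp: span_insert algebra_simps)
  also have "\<dots> = {v. \<exists>z y. v = idempotent_sum (z + of_real y) (z - of_real y)}"
    unfolding coords_idempotent_sum
  proof (intro subset_antisym subsetI)
    fix v :: tricomplex assume "v \<in> {v. \<exists>z y. v = idempotent_sum (z + of_real y) (z - of_real y)}"
    then obtain z y where "v = idempotent_sum (z + of_real y) (z - of_real y)" by blast
    then show "v \<in> {v. \<exists>a b y. v = idempotent_sum (Complex a b + of_real y) (Complex a b - of_real y)}"
      by (cases z) blast
  qed blast
  finally have "span {1, i1, j1} = {v. \<exists>z y. v = idempotent_sum (z + of_real y) (z - of_real y)}" .
  then show ?thesis unfolding slice_def
    by (auto simp: idempotent_sum_M3 simp del: adj_add_simps) blast
qed

text \<open>Both shifts are real and keep the two coordinates equal, so they intersect in the plane of pairs with equal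
  coordinates; only the final shift by \<open>y j1\<close> separates the coordinates.\<close>

lemma shifted_M1:
  "((M1 \<ominus>\<^sub>s of_real y) \<inter> (M1 \<oplus>\<^sub>s of_real y)) \<oplus>\<^sub>s (y *\<^sub>R j1)
    = (\<lambda>z. idempotent_sum (z + of_real y) (z - of_real y)) ` {z. z + of_real y \<in> mandelbrot \<and> z - of_real y \<in> mandelbrot}"
proof -
  have diag: "idempotent_sum z z + of_real r = idempotent_sum (z + of_real r) (z + of_real r)" for z r
    by (simp add: idempotent_sum_def adj_eq_iff complex_eq_iff of_real_def)
  have inj: "idempotent_sum z z = idempotent_sum w w \<longleftrightarrow> z = w" for z w by (simp add: idempotent_sum_def)
  have j1: "idempotent_sum z z + y *\<^sub>R j1 = idempotent_sum (z + of_real y) (z - of_real y)" for z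
    by (simp add: idempotent_sum_def adj_eq_iff complex_eq_iff i1_def i2_def j1_def)
  have minus: "M1 \<ominus>\<^sub>s of_real y = (\<lambda>z. idempotent_sum z z) ` {z. z + of_real y \<in> mandelbrot}"
  proof -
    have "idempotent_sum z z - of_real y = idempotent_sum (z - of_real y) (z - of_real y)" for z
      using diag[of z "- y"] by simp
    then have "M1 \<ominus>\<^sub>s of_real y = {idempotent_sum (z - of_real y) (z - of_real y) | z. z \<in> mandelbrot}"
      unfolding set_unshift_def M1_idempotent_sum by (auto simp: image_iff) metis
    also have "\<dots> = (\<lambda>z. idempotent_sum z z) ` {z. z + of_real y \<in> mandelbrot}"
      by (force simp: image_iff)
    finally show ?thesis .
  qed
  have plus: "M1 \<oplus>\<^sub>s of_real y = (\<lambda>z. idempotent_sum z z) ` {z. z - of_real y \<in> mandelbrot}"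
  proof -
    from diag[of _ y]
    have "M1 \<oplus>\<^sub>s of_real y = {idempotent_sum (z + of_real y) (z + of_real y) | z. z \<in> mandelbrot}"
      unfolding set_shift_def M1_idempotent_sum by (auto simp: image_iff) metis
    also have "\<dots> = (\<lambda>z. idempotent_sum z z) ` {z. z - of_real y \<in> mandelbrot}"
      by (force simp: image_iff)
    finally show ?thesis .
  qed
  have inter: "(\<lambda>z. idempotent_sum z z) ` S \<inter> (\<lambda>z. idempotent_sum z z) ` T = (\<lambda>z. idempotent_sum z z) ` (S \<inter> T)" for S T
    by (auto simp: inj)
  have shift: "((\<lambda>z. idempotent_sum z z) ` S) \<oplus>\<^sub>s (y *\<^sub>R j1) = (\<lambda>z. idempotent_sum (z + of_real y) (z - of_real y)) ` S" for S
    unfolding set_shift_def j1[symmetric] by blast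
  show ?thesis by (simp only: minus plus inter shift Collect_conj_eq)
qed

section \<open>The width of horizontal sections of the Mandelbrot set\<close>

lemma Re_mandelbrot_less:
  assumes c: "c \<in> mandelbrot" "0 \<le> Im c"
  shows "Re c < 1/2"
proof (rule ccontr)
  assume "\<not> Re c < 1/2"
  moreover have "Re c \<le> 2" "Im c \<le> 2"
    using mandelbrot_norm_le_2[OF c(1)] complex_Re_le_cmod[of c] abs_Im_le_cmod[of c] by linarith+
  ultimately have "in_box 2048 8192 0 8192 c" using c by (simp add: in_box_def between_def)
  from cover_sound(1)[OF c(1) cover_half_plane this] show False by simp
qed

text \<open>For \<open>\<rho> = sqrt \<delta>\<close> below \<open>1/20\<close> the orbit passes the gate by the invariants, otherwise by the
  computation.\<close>

lemma above_cusp_curve: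
  assumes c: "c \<in> mandelbrot" "0 \<le> Im c" and \<delta>: "\<delta> = Re c - 1/4" "0 < \<delta>"
  shows "9 * \<delta>^3 < 10 * (Im c)\<^sup>2"
proof (rule ccontr)
  assume "\<not> 9 * \<delta>^3 < 10 * (Im c)\<^sup>2"
  moreover have \<delta>_less: "\<delta> < 1/4" using Re_mandelbrot_less[OF c] \<delta> by simp
  moreover have "Complex (1/4 + \<delta>) (Im c) = c" using \<delta> by (simp add: complex_eq_iff)
  ultimately interpret right_parameter \<delta> "Im c" using c \<delta> by unfold_locales simp_all
  define \<rho> where "\<rho> = sqrt \<delta>"
  have \<rho>: "0 < \<rho>" "\<rho>\<^sup>2 = \<delta>" using \<delta> by (simp_all add: \<rho>_def)
  show False
  proof (cases "\<rho> \<le> 1/20")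
    case True
    then interpret right_parameter_near_cusp \<delta> "Im c" \<rho> using \<rho> by unfold_locales auto
    show False by (rule contradiction)
  next
    case False
    have "\<rho>\<^sup>2 < (1/2)\<^sup>2" using \<rho> \<delta>_less by (simp add: power2_eq_square)
    then have "\<rho> < 1/2" by (rule power2_less_imp_less) simp
    then show False using sweep_sound(1)[OF \<rho> sweep_from_20th] False by simp
  qed
qed

lemma below_cusp_curve_at_tip:
  assumes c: "c \<in> mandelbrot" "0 \<le> Im c" and \<epsilon>: "\<epsilon> = Re c + 2" "\<epsilon> \<le> 1/4"
  shows "10 * (Im c)\<^sup>2 \<le> 9 * \<epsilon>^3"
proof (cases "\<epsilon> \<le> 119/2000")
  case True
  then show ?thesis using near_left_end[OF c \<epsilon>(1)] by simp
next
  case False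
  have "Im c \<le> 2" using mandelbrot_norm_le_2[OF c(1)] abs_Im_le_cmod[of c] by linarith
  then have "in_box (-7949) (-7168) 0 8192 c" using c \<epsilon> False by (simp add: in_box_def between_def)
  from cover_sound(1)[OF c(1) cover_tip this] obtain a0 a1 b0 b1
    where below: "below_cusp_curve a0 a1 b0 b1" and box: "in_box a0 a1 b0 b1 c" by blast
  define A B :: real where "A = of_int a0 + 8192" and "B = of_int b1"
  have "10 * 2^12 * (b1 * b1) \<le> 9 * ((a0 + 8192) * (a0 + 8192) * (a0 + 8192))"
    using below by (simp only: below_cusp_curve_def)
  then have "real_of_int (10 * 2^12 * (b1 * b1)) \<le> of_int (9 * ((a0 + 8192) * (a0 + 8192) * (a0 + 8192)))"
    by (simp only: of_int_le_iff)
  then have AB: "40960 * B\<^sup>2 \<le> 9 * A^3"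
    by (simp add: A_def B_def power2_eq_square power3_eq_cube)
  have le: "A \<le> 4096 * \<epsilon>" "4096 * Im c \<le> B"
    using box \<epsilon> by (simp_all add: in_box_def between_def A_def B_def)
  have "(4096 * Im c)\<^sup>2 \<le> B\<^sup>2" using le c by (intro power_mono) auto
  moreover have "A^3 \<le> (4096 * \<epsilon>)^3" using le(1) by (intro power_mono_odd) auto
  ultimately have "40960 * (4096 * Im c)\<^sup>2 \<le> 9 * (4096 * \<epsilon>)^3" using AB by linarith
  then show ?thesis by (simp add: power_mult_distrib)
qed

lemma width_le_upper:
  assumes c: "c \<in> mandelbrot" "0 \<le> Im c" and c': "c' \<in> mandelbrot" "Im c' = Im c"
  shows "Re c - Re c' \<le> 9/4"
proof (rule ccontr)
  define \<delta> \<epsilon> where "\<delta> = Re c - 1/4" and "\<epsilon> = Re c' + 2"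
  assume "\<not> Re c - Re c' \<le> 9/4"
  then have less: "\<epsilon> < \<delta>" by (simp add: \<delta>_def \<epsilon>_def)
  have \<epsilon>0: "0 \<le> \<epsilon>"
    using mandelbrot_norm_le_2[OF c'(1)] abs_Re_le_cmod[of c'] by (simp add: \<epsilon>_def)
  have "\<epsilon> \<le> 1/4" using less Re_mandelbrot_less[OF c] by (simp add: \<delta>_def)
  then have "10 * (Im c)\<^sup>2 \<le> 9 * \<epsilon>^3"
    using below_cusp_curve_at_tip[of c' \<epsilon>] c c' by (simp add: \<epsilon>_def)
  also have "\<dots> \<le> 9 * \<delta>^3" using less \<epsilon>0 by (intro mult_left_mono power_mono) auto
  also have "\<dots> < 10 * (Im c)\<^sup>2" using above_cusp_curve[OF c \<delta>_def] less \<epsilon>0 by simp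
  finally show False by simp
qed

text \<open>The Mandelbrot set is symmetric under conjugation, which reduces the claim to the upper half-plane.\<close>

proposition width_le:
  assumes "c \<in> mandelbrot" "c' \<in> mandelbrot" "Im c' = Im c"
  shows "Re c - Re c' \<le> 9/4"
proof (cases "0 \<le> Im c")
  case True
  then show ?thesis using width_le_upper assms by blast
next
  case False
  then show ?thesis
    using width_le_upper[of "cnj c" "cnj c'"] assms by (simp add: mandelbrot_cnj)
qed

theorem proposition3:
  "slice 1 i1 j1 =
    (\<Union>y\<in>{- (9/8) .. 9/8 :: real}.
      ((M1 \<ominus>\<^sub>s of_real y) \<inter> (M1 \<oplus>\<^sub>s of_real y)) \<oplus>\<^sub>s (y *\<^sub>R j1))"
proof -
  have "y \<in> {- (9/8) .. 9/8}" if "z + of_real y \<in> mandelbrot" "z - of_real y \<in> mandelbrot" for z y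
    using width_le[OF that] width_le[OF that(2,1)] by simp
  then show ?thesis unfolding slice_idempotent_sum shifted_M1 by blast
qed

end
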